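(* Let $\mathbf{k}$ be a field, let $n\ge d\ge 1$ be integers, and let $A_{n,d}$ be the higher Auslander algebra of type $\mathbb{A}$ over $\mathbf{k}$. Then $A_{n,d}$ is rigid, that is, it does not admit non-trivial deformations, and $A_{n,d}$ is intrinsically formal.
   Context: Higher Auslander algebras of type $\mathbb{A}$: for natural numbers $n,d\geq 1$, let $P$ be the poset of all $d$-tuples of integers $\Sigma=(\sigma_1,\dots,\sigma_d)$ with $1\le\sigma_1\le\cdots\le\sigma_d\le n$, ordered by $\Sigma\le\Sigma'$ if and only if $\sigma_i\le\sigma_i'$ for all $1\le i\le d$. Let $P^{\mathrm{b}}\subseteq P$ be the subset of those $\Sigma$ for which there exists $1\le i<d$ with $\sigma_i=\sigma_{i+1}$. Consider the $\mathbf{k}$-algebra with basis $\{f_{\Gamma\Sigma}\mid \Sigma\le\Gamma \text{ in } P\}$ and multiplication $f_{\Delta\Gamma'}\cdot f_{\Gamma\Sigma}=f_{\Delta\Sigma}$ if $\Gamma=\Gamma'$ and $0$ otherwise (the incidence algebra of $P$). Then $A_{n,d}$ is the quotient of this algebra by the two-sided ideal generated by the idempotents $f_{\Delta\Delta}$ with $\Delta\in P^{\mathrm{b}}$. Deformations: a formal deformation of a $\mathbf{k}$-algebra $A$ is an associative $\mathbf{k}[[t]]$-bilinear, $t$-adically continuous multiplication on $A[[t]]$ which reduces modulo $t$ to the multiplication of $A$. It is trivial if there is a $\mathbf{k}[[t]]$-linear algebra isomorphism, reducing to the identity of $A$ modulo $t$, from $A[[t]]$ with this multiplication to $A[[t]]$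 with the $\mathbf{k}[[t]]$-bilinear ($t$-adically continuous) extension of the multiplication of $A$. Intrinsic formality: a graded $\mathbf{k}$-algebra $A$ (here $A_{n,d}$ concentrated in degree $0$) is intrinsically formal if every $A_\infty$-algebra over $\mathbf{k}$ whose cohomology is isomorphic to $A$ as a graded algebra is $A_\infty$-quasi-isomorphic to $A$ viewed as an $A_\infty$-algebra with zero differential and zero higher products. *)

theory Defs
  imports "HOL-Algebra.Module" "HOL-Algebra.QuotRing"
begin

section \<open>Linear maps and quotients\<close>

text \<open>
  Vector spaces and algebras over a field \<open>K\<close> are HOL-Algebra module records over \<open>K\<close>; when only
  the vector space structure matters, the fields \<open>mult\<close> and \<open>one\<close> are ignored.
\<close>

definition linear_map ::
  "('k, 'r) ring_scheme \<Rightarrow> ('k, 'a) module \<Rightarrow> ('k, 'b) module \<Rightarrow> ('a \<Rightarrow> 'b) \<Rightarrow> bool" where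
  "linear_map K M N f \<longleftrightarrow>
     f \<in> carrier M \<rightarrow> carrier N \<and>
     (\<forall>x\<in>carrier M. \<forall>y\<in>carrier M. f (x \<oplus>\<^bsub>M\<^esub> y) = f x \<oplus>\<^bsub>N\<^esub> f y) \<and>
     (\<forall>a\<in>carrier K. \<forall>x\<in>carrier M. f (a \<odot>\<^bsub>M\<^esub> x) = a \<odot>\<^bsub>N\<^esub> f x)"

text \<open>
  The library's \<^const>\<open>FactRing\<close> equipped with the induced scalar multiplication. It is the quotient
  algebra if \<open>I\<close> is an ideal, and the quotient vector space if \<open>I\<close> is merely a subspace.
\<close>

definition quotient_module :: "('k, 'a) module \<Rightarrow> 'a set \<Rightarrow> ('k, 'a set) module" where
  "quotient_module M I =
     \<lparr>carrier = carrier (M Quot I),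
      monoid.mult = monoid.mult (M Quot I),
      monoid.one = \<one>\<^bsub>M Quot I\<^esub>,
      ring.zero = \<zero>\<^bsub>M Quot I\<^esub>,
      ring.add = ring.add (M Quot I),
      module.smult = (\<lambda>a C. \<Union>x\<in>C. I +>\<^bsub>M\<^esub> (a \<odot>\<^bsub>M\<^esub> x))\<rparr>"


section \<open>Higher Auslander algebras of type A\<close>

definition tuples :: "nat \<Rightarrow> nat \<Rightarrow> int list set" where
  "tuples n d = {\<sigma>. length \<sigma> = d \<and> sorted \<sigma> \<and> set \<sigma> \<subseteq> {1..int n}}"

definition boundary_tuples :: "nat \<Rightarrow> nat \<Rightarrow> int list set" where
  "boundary_tuples n d = {\<sigma> \<in> tuples n d. \<exists>i. Suc i < d \<and> \<sigma> ! i = \<sigma> ! Suc i}"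

definition tuple_le :: "int list \<Rightarrow> int list \<Rightarrow> bool" where
  "tuple_le = list_all2 (\<le>)"

text \<open>
  An element of the incidence algebra is its family of coefficients: the value at \<open>(\<Gamma>, \<Sigma>)\<close> is the
  coefficient of the basis vector \<open>f\<^bsub>\<Gamma>\<Sigma>\<^esub>\<close>, which exists for \<open>\<Sigma> \<le> \<Gamma>\<close> in the (finite) poset.
\<close>

definition incidence_pairs :: "nat \<Rightarrow> nat \<Rightarrow> (int list \<times> int list) set" where
  "incidence_pairs n d = {(\<Gamma>, \<Sigma>). \<Gamma> \<in> tuples n d \<and> \<Sigma> \<in> tuples n d \<and> tuple_le \<Sigma> \<Gamma>}"

definition incidence_algebra ::
  "('k, 'r) ring_scheme \<Rightarrow> nat \<Rightarrow> nat \<Rightarrow> ('k, int list \<times> int list \<Rightarrow> 'k) module" where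
  "incidence_algebra K n d =
     \<lparr>carrier = {\<phi>. (\<forall>p\<in>incidence_pairs n d. \<phi> p \<in> carrier K) \<and>
                    (\<forall>p. p \<notin> incidence_pairs n d \<longrightarrow> \<phi> p = \<zero>\<^bsub>K\<^esub>)},
      monoid.mult = (\<lambda>\<phi> \<psi> (\<Delta>, \<Sigma>).
                \<Oplus>\<^bsub>K\<^esub>\<Gamma>\<in>{\<Gamma> \<in> tuples n d. tuple_le \<Sigma> \<Gamma> \<and> tuple_le \<Gamma> \<Delta>}. \<phi> (\<Delta>, \<Gamma>) \<otimes>\<^bsub>K\<^esub> \<psi> (\<Gamma>, \<Sigma>)),
      monoid.one = (\<lambda>(\<Gamma>, \<Sigma>). if \<Gamma> = \<Sigma> \<and> \<Gamma> \<in> tuples n d then \<one>\<^bsub>K\<^esub> else \<zero>\<^bsub>K\<^esub>),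
      ring.zero = (\<lambda>_. \<zero>\<^bsub>K\<^esub>),
      ring.add = (\<lambda>\<phi> \<psi> p. \<phi> p \<oplus>\<^bsub>K\<^esub> \<psi> p),
      module.smult = (\<lambda>a \<phi> p. a \<otimes>\<^bsub>K\<^esub> \<phi> p)\<rparr>"

definition incidence_basis ::
  "('k, 'r) ring_scheme \<Rightarrow> int list \<Rightarrow> int list \<Rightarrow> int list \<times> int list \<Rightarrow> 'k" where
  "incidence_basis K \<Gamma> \<Sigma> = (\<lambda>p. if p = (\<Gamma>, \<Sigma>) then \<one>\<^bsub>K\<^esub> else \<zero>\<^bsub>K\<^esub>)"

definition higher_auslander_algebra ::
  "('k, 'r) ring_scheme \<Rightarrow> nat \<Rightarrow> nat \<Rightarrow> ('k, (int list \<times> int list \<Rightarrow> 'k) set) module" where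
  "higher_auslander_algebra K n d =
     quotient_module (incidence_algebra K n d)
       (Idl\<^bsub>incidence_algebra K n d\<^esub> ((\<lambda>\<Delta>. incidence_basis K \<Delta> \<Delta>) ` boundary_tuples n d))"


section \<open>Formal deformations\<close>

text \<open>A formal power series is its sequence of coefficients.\<close>

definition power_series_ring :: "('k, 'r) ring_scheme \<Rightarrow> (nat \<Rightarrow> 'k) ring" where
  "power_series_ring K =
     \<lparr>carrier = {a. \<forall>i. a i \<in> carrier K},
      monoid.mult = (\<lambda>a b i. \<Oplus>\<^bsub>K\<^esub>j\<in>{..i}. a j \<otimes>\<^bsub>K\<^esub> b (i - j)),
      monoid.one = (\<lambda>i. if i = 0 then \<one>\<^bsub>K\<^esub> else \<zero>\<^bsub>K\<^esub>),
      ring.zero = (\<lambda>_. \<zero>\<^bsub>K\<^esub>),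
      ring.add = (\<lambda>a b i. a i \<oplus>\<^bsub>K\<^esub> b i)\<rparr>"

text \<open>
  \<open>A[[t]]\<close> as a module over \<open>K[[t]]\<close>, with the bilinear, \<open>t\<close>-adically continuous extension of the
  multiplication of \<open>A\<close>.
\<close>

definition power_series_algebra :: "('k, 'a) module \<Rightarrow> (nat \<Rightarrow> 'k, nat \<Rightarrow> 'a) module" where
  "power_series_algebra A =
     \<lparr>carrier = {x. \<forall>i. x i \<in> carrier A},
      monoid.mult = (\<lambda>x y i. \<Oplus>\<^bsub>A\<^esub>j\<in>{..i}. x j \<otimes>\<^bsub>A\<^esub> y (i - j)),
      monoid.one = (\<lambda>i. if i = 0 then \<one>\<^bsub>A\<^esub> else \<zero>\<^bsub>A\<^esub>),
      ring.zero = (\<lambda>_. \<zero>\<^bsub>A\<^esub>),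
      ring.add = (\<lambda>x y i. x i \<oplus>\<^bsub>A\<^esub> y i),
      module.smult = (\<lambda>a x i. \<Oplus>\<^bsub>A\<^esub>j\<in>{..i}. a j \<odot>\<^bsub>A\<^esub> x (i - j))\<rparr>"

definition t_adically_continuous ::
  "('k, 'a) module \<Rightarrow> ((nat \<Rightarrow> 'a) \<Rightarrow> (nat \<Rightarrow> 'a) \<Rightarrow> (nat \<Rightarrow> 'a)) \<Rightarrow> bool" where
  "t_adically_continuous A \<mu> \<longleftrightarrow>
     (let S = carrier (power_series_algebra A) in
      \<forall>x\<in>S. \<forall>y\<in>S. \<forall>N. \<exists>M. \<forall>x'\<in>S. \<forall>y'\<in>S.
        (\<forall>i<M. x' i = x i \<and> y' i = y i) \<longrightarrow> (\<forall>i<N. \<mu> x' y' i = \<mu> x y i))"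

definition formal_deformation ::
  "('k, 'r) ring_scheme \<Rightarrow> ('k, 'a) module \<Rightarrow> ((nat \<Rightarrow> 'a) \<Rightarrow> (nat \<Rightarrow> 'a) \<Rightarrow> (nat \<Rightarrow> 'a)) \<Rightarrow> bool"
  where
  "formal_deformation K A \<mu> \<longleftrightarrow>
     (let R = power_series_ring K; M = power_series_algebra A in
      (\<forall>x\<in>carrier M. linear_map R M M (\<lambda>y. \<mu> x y)) \<and>
      (\<forall>y\<in>carrier M. linear_map R M M (\<lambda>x. \<mu> x y)) \<and>
      t_adically_continuous A \<mu> \<and>
      (\<forall>x\<in>carrier M. \<forall>y\<in>carrier M. \<forall>z\<in>carrier M. \<mu> (\<mu> x y) z = \<mu> x (\<mu> y z)) \<and>
      (\<forall>x\<in>carrier M. \<forall>y\<in>carrier M. \<mu> x y 0 = x 0 \<otimes>\<^bsub>A\<^esub> y 0))"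

definition trivial_deformation ::
  "('k, 'r) ring_scheme \<Rightarrow> ('k, 'a) module \<Rightarrow> ((nat \<Rightarrow> 'a) \<Rightarrow> (nat \<Rightarrow> 'a) \<Rightarrow> (nat \<Rightarrow> 'a)) \<Rightarrow> bool"
  where
  "trivial_deformation K A \<mu> \<longleftrightarrow>
     (let R = power_series_ring K; M = power_series_algebra A in
      \<exists>\<phi>. linear_map R M M \<phi> \<and> bij_betw \<phi> (carrier M) (carrier M) \<and>
          (\<forall>x\<in>carrier M. \<forall>y\<in>carrier M. \<phi> (\<mu> x y) = \<phi> x \<otimes>\<^bsub>M\<^esub> \<phi> y) \<and>
          (\<forall>x\<in>carrier M. \<phi> x 0 = x 0))"

definition rigid :: "('k, 'r) ring_scheme \<Rightarrow> ('k, 'a) module \<Rightarrow> bool" where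
  "rigid K A \<longleftrightarrow> (\<forall>\<mu>. formal_deformation K A \<mu> \<longrightarrow> trivial_deformation K A \<mu>)"


section \<open>Graded algebras\<close>

text \<open>A graded vector space is the family of its homogeneous components.\<close>

record ('k, 'a) graded_algebra =
  component :: "int \<Rightarrow> ('k, 'a) module"
  gmult :: "int \<Rightarrow> int \<Rightarrow> 'a \<Rightarrow> 'a \<Rightarrow> 'a" \<comment> \<open>\<open>gmult G i j\<close> multiplies degree \<open>i\<close> by degree \<open>j\<close>\<close>

definition graded_algebra_iso ::
  "('k, 'r) ring_scheme \<Rightarrow> ('k, 'a) graded_algebra \<Rightarrow> ('k, 'b) graded_algebra \<Rightarrow>
   (int \<Rightarrow> 'a \<Rightarrow> 'b) \<Rightarrow> bool" where
  "graded_algebra_iso K G H \<phi> \<longleftrightarrow>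
     (\<forall>i. linear_map K (component G i) (component H i) (\<phi> i) \<and>
          bij_betw (\<phi> i) (carrier (component G i)) (carrier (component H i))) \<and>
     (\<forall>i j. \<forall>x\<in>carrier (component G i). \<forall>y\<in>carrier (component G j).
        \<phi> (i + j) (gmult G i j x y) = gmult H i j (\<phi> i x) (\<phi> j y))"

definition concentrated_in_degree_0 :: "('k, 'a) module \<Rightarrow> ('k, 'a) graded_algebra" where
  "concentrated_in_degree_0 A =
     \<lparr>component = (\<lambda>i. if i = 0 then A else A\<lparr>carrier := {\<zero>\<^bsub>A\<^esub>}\<rparr>),
      gmult = (\<lambda>i j x y. x \<otimes>\<^bsub>A\<^esub> y)\<rparr>"


section \<open>A-infinity-algebras\<close>

text \<open>
  A homogeneous element is paired with its degree, and a multilinear map acts on the list of its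
  homogeneous arguments; a family of operations of all arities is a single function on nonempty
  lists, the arity being the length. The operation of arity \<open>s\<close> has degree \<open>p - s\<close>: the higher
  products have \<open>p = 2\<close>, the components of a morphism have \<open>p = 1\<close>.
\<close>

record ('k, 'a) A_infinity =
  A_space :: "int \<Rightarrow> ('k, 'a) module"
  A_ops :: "(int \<times> 'a) list \<Rightarrow> 'a"

definition homogeneous :: "(int \<Rightarrow> ('k, 'a) module) \<Rightarrow> (int \<times> 'a) list \<Rightarrow> bool" where
  "homogeneous V xs \<longleftrightarrow> (\<forall>(i, x)\<in>set xs. x \<in> carrier (V i))"

definition total_degree :: "(int \<times> 'a) list \<Rightarrow> int" where
  "total_degree xs = sum_list (map fst xs)"

definition output_degree :: "int \<Rightarrow> (int \<times> 'a) list \<Rightarrow> int" where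
  "output_degree p xs = total_degree xs + p - int (length xs)"

definition multilinear_family ::
  "('k, 'r) ring_scheme \<Rightarrow> (int \<Rightarrow> ('k, 'a) module) \<Rightarrow> (int \<Rightarrow> ('k, 'b) module) \<Rightarrow> int \<Rightarrow>
   ((int \<times> 'a) list \<Rightarrow> 'b) \<Rightarrow> bool" where
  "multilinear_family K V W p F \<longleftrightarrow>
     (\<forall>us i vs. homogeneous V us \<and> homogeneous V vs \<longrightarrow>
        linear_map K (V i) (W (output_degree p us + i - 1 + output_degree 0 vs))
          (\<lambda>x. F (us @ (i, x) # vs)))"

definition signed :: "('k, 'a) module \<Rightarrow> int \<Rightarrow> 'a \<Rightarrow> 'a" where
  "signed M e x = (if even e then x else \<ominus>\<^bsub>M\<^esub> x)"

text \<open>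
  \<open>\<Sum> (-1)\<^bsup>r + s t\<^esup> F (1\<^bsup>\<otimes> r\<^esup> \<otimes> m\<^sub>s \<otimes> 1\<^bsup>\<otimes> t\<^esup>)\<close> over \<open>r + s + t = n\<close>, \<open>s \<ge> 1\<close>, evaluated on \<open>n\<close> elements.
  The last summand of the exponent is the Koszul sign arising when \<open>m\<^sub>s\<close>, of degree \<open>2 - s\<close>, passes
  the first \<open>r\<close> arguments.
\<close>

definition insertion_sum ::
  "('k, 'b) module \<Rightarrow> ((int \<times> 'a) list \<Rightarrow> 'a) \<Rightarrow> ((int \<times> 'a) list \<Rightarrow> 'b) \<Rightarrow> (int \<times> 'a) list \<Rightarrow> 'b" where
  "insertion_sum M m F xs =
     (\<Oplus>\<^bsub>M\<^esub>p\<in>{(r, s). 1 \<le> s \<and> r + s \<le> length xs}.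
        case p of (r, s) \<Rightarrow>
          let us = take r xs; ys = take s (drop r xs); vs = drop (r + s) xs
          in signed M (int r + int s * int (length vs) + (2 - int s) * total_degree us)
               (F (us @ (output_degree 2 ys, m ys) # vs)))"

definition A_infinity_algebra ::
  "('k, 'r) ring_scheme \<Rightarrow> ('k, 'a) A_infinity \<Rightarrow> bool" where
  "A_infinity_algebra K X \<longleftrightarrow>
     (\<forall>i. module K (A_space X i)) \<and>
     multilinear_family K (A_space X) (A_space X) 2 (A_ops X) \<and>
     (\<forall>xs. homogeneous (A_space X) xs \<and> xs \<noteq> [] \<longrightarrow>
        (let M = A_space X (output_degree 3 xs)
         in insertion_sum M (A_ops X) (A_ops X) xs = \<zero>\<^bsub>M\<^esub>))"

text \<open>
  The other side of the morphism equation of arity \<open>n\<close>,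
  \<open>\<Sum> (-1)\<^bsup>e\<^esup> m\<^sub>k (f\<^bsub>i\<^sub>1\<^esub> \<otimes> \<dots> \<otimes> f\<^bsub>i\<^sub>k\<^esub>)\<close> over \<open>i\<^sub>1 + \<dots> + i\<^sub>k = n\<close> with all \<open>i\<^sub>j \<ge> 1\<close>, where
  \<open>e = (k - 1) (i\<^sub>1 - 1) + (k - 2) (i\<^sub>2 - 1) + \<dots> + (i\<^bsub>k-1\<^esub> - 1)\<close>. The sum runs over the ways to cut the
  list of arguments into nonempty blocks. The second product in the exponent is the Koszul sign
  arising when \<open>f\<^bsub>i\<^sub>j\<^esub>\<close>, of degree \<open>1 - i\<^sub>j\<close>, passes the arguments in the previous blocks.
\<close>

definition composition_sum ::
  "('k, 'b) module \<Rightarrow> ((int \<times> 'b) list \<Rightarrow> 'b) \<Rightarrow> ((int \<times> 'a) list \<Rightarrow> 'b) \<Rightarrow> (int \<times> 'a) list \<Rightarrow> 'b" where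
  "composition_sum M m F xs =
     (\<Oplus>\<^bsub>M\<^esub>B\<in>{B. concat B = xs \<and> [] \<notin> set B}.
        signed M
          (\<Sum>j<length B. int (length B - 1 - j) * (int (length (B ! j)) - 1) +
                         (1 - int (length (B ! j))) * total_degree (concat (take j B)))
          (m (map (\<lambda>ys. (output_degree 1 ys, F ys)) B)))"

definition A_infinity_morphism ::
  "('k, 'r) ring_scheme \<Rightarrow> ('k, 'a) A_infinity \<Rightarrow> ('k, 'b) A_infinity \<Rightarrow>
   ((int \<times> 'a) list \<Rightarrow> 'b) \<Rightarrow> bool" where
  "A_infinity_morphism K X Y F \<longleftrightarrow>
     multilinear_family K (A_space X) (A_space Y) 1 F \<and>
     (\<forall>xs. homogeneous (A_space X) xs \<and> xs \<noteq> [] \<longrightarrow>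
        (let M = A_space Y (output_degree 2 xs)
         in insertion_sum M (A_ops X) F xs = composition_sum M (A_ops Y) F xs))"


subsection \<open>Cohomology and quasi-isomorphisms\<close>

definition cocycles :: "('k, 'a) A_infinity \<Rightarrow> int \<Rightarrow> 'a set" where
  "cocycles X i = {x \<in> carrier (A_space X i). A_ops X [(i, x)] = \<zero>\<^bsub>A_space X (i + 1)\<^esub>}"

definition coboundaries :: "('k, 'a) A_infinity \<Rightarrow> int \<Rightarrow> 'a set" where
  "coboundaries X i = (\<lambda>x. A_ops X [(i - 1, x)]) ` carrier (A_space X (i - 1))"

definition cohomology_space :: "('k, 'a) A_infinity \<Rightarrow> int \<Rightarrow> ('k, 'a set) module" where
  "cohomology_space X i =
     quotient_module ((A_space X i)\<lparr>carrier := cocycles X i\<rparr>) (coboundaries X i)"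

definition cohomology :: "('k, 'a) A_infinity \<Rightarrow> ('k, 'a set) graded_algebra" where
  "cohomology X =
     \<lparr>component = cohomology_space X,
      gmult = (\<lambda>i j C D. \<Union>x\<in>C. \<Union>y\<in>D.
                 coboundaries X (i + j) +>\<^bsub>A_space X (i + j)\<^esub> A_ops X [(i, x), (j, y)])\<rparr>"

definition cohomology_map ::
  "('k, 'b) A_infinity \<Rightarrow> ((int \<times> 'a) list \<Rightarrow> 'b) \<Rightarrow> int \<Rightarrow> 'a set \<Rightarrow> 'b set" where
  "cohomology_map Y F i C = (\<Union>x\<in>C. coboundaries Y i +>\<^bsub>A_space Y i\<^esub> F [(i, x)])"

definition A_infinity_quasi_isomorphism ::
  "('k, 'r) ring_scheme \<Rightarrow> ('k, 'a) A_infinity \<Rightarrow> ('k, 'b) A_infinity \<Rightarrow>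
   ((int \<times> 'a) list \<Rightarrow> 'b) \<Rightarrow> bool" where
  "A_infinity_quasi_isomorphism K X Y F \<longleftrightarrow>
     A_infinity_morphism K X Y F \<and>
     (\<forall>i. bij_betw (cohomology_map Y F i)
            (carrier (cohomology_space X i)) (carrier (cohomology_space Y i)))"


subsection \<open>Intrinsic formality\<close>

text \<open>A graded algebra with zero differential and zero higher products.\<close>

definition formal_A_infinity :: "('k, 'a) graded_algebra \<Rightarrow> ('k, 'a) A_infinity" where
  "formal_A_infinity G =
     \<lparr>A_space = component G,
      A_ops = (\<lambda>xs. case xs of
                [(i, x), (j, y)] \<Rightarrow> gmult G i j x y
              | _ \<Rightarrow> \<zero>\<^bsub>component G (output_degree 2 xs)\<^esub>)\<rparr>"

text \<open>
  The type argument \<open>'b\<close> is the type in which the homogeneous components of the A-infinity-algebras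
  under consideration live; a theorem that leaves it free covers all A-infinity-algebras.
\<close>

definition intrinsically_formal ::
  "'b itself \<Rightarrow> ('k, 'r) ring_scheme \<Rightarrow> ('k, 'a) graded_algebra \<Rightarrow> bool" where
  "intrinsically_formal (_ :: 'b itself) K G \<longleftrightarrow>
     (\<forall>X :: ('k, 'b) A_infinity.
        A_infinity_algebra K X \<and> (\<exists>\<phi>. graded_algebra_iso K (cohomology X) G \<phi>) \<longrightarrow>
        (\<exists>F. A_infinity_quasi_isomorphism K X (formal_A_infinity G) F))"

end

theory Submission
  imports Defs
begin

text \<open>
  The two halves of the theorem have unrelated reasons, and only the second one looks at the
  combinatorics of the algebra.

  \<^emph>\<open>Intrinsic formality\<close> holds for every algebra \<open>A\<close> over a field that is concentrated in degree
  \<open>0\<close>. After the usual change of signs, an A-infinity-morphism from \<open>X\<close> to \<open>A\<close> is a function \<open>\<tau>\<close> on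
  words in \<open>X\<close>, multilinear and living in one degree, with \<open>D \<tau> = \<tau> \<union> \<tau>\<close>, where \<open>D\<close> is dual to the bar
  differential and the cup product is dual to cutting words. It is built by recursion on the length
  of words. The defect in length \<open>n\<close> is a cocycle, because \<open>D\<close> squares to zero and is a derivation of
  the cup product, which is associative (\<open>D_D\<close>, \<open>D_cuts\<close>, \<open>cup_assoc\<close>). A contraction of \<open>X\<close> onto its
  cohomology induces a contraction of the functions on words of a given length
  (\<open>homotopy_formula\<close>), so that the defect can be removed as soon as it vanishes on words of
  representatives of cohomology classes. For \<open>n = 2\<close> this says that the given isomorphism is
  multiplicative; for \<open>n \<ge> 3\<close> it holds for degree reasons (\<open>U_map_e_letter\<close>,
  \<open>twisting_equation\<close>).

  \<^emph>\<open>Rigidity\<close> follows from the vanishing of second Hochschild cohomology: the identity of \<open>A\<close> is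
  lifted to an isomorphism between \<open>A[[t]]\<close> and the deformed algebra, one power of \<open>t\<close> at a time,
  and the obstruction at each stage is a two-cocycle (\<open>stage_step\<close>).
  The algebra has a basis of elements \<open>f\<^bsub>\<Gamma>\<Sigma>\<^esub>\<close>, for the pairs that interlace,
  \<open>\<sigma>\<^sub>1 \<le> \<gamma>\<^sub>1 < \<sigma>\<^sub>2 \<le> \<gamma>\<^sub>2 < \<dots>\<close>: these are the pairs with no boundary tuple in between (\<open>J_iff\<close>).
  Once a two-cocycle is normalised with respect to the idempotents \<open>f\<^bsub>\<Sigma>\<Sigma>\<^esub>\<close>, it is a simplicial
  two-cocycle on the chains of tuples whose end points interlace. That simplicial complex is
  contractible. If \<open>R\<^sub>i\<close> replaces the first \<open>i\<close> entries of a tuple by \<open>1, \<dots>, i\<close>, then for every chain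
  the chain of its images under \<open>R\<^sub>i\<close>, preceded by any of the images under \<open>R\<^bsub>i+1\<^esub>\<close> of its smaller
  members, is again such a chain; so \<open>R\<^sub>i\<close> and \<open>R\<^bsub>i+1\<^esub>\<close> are homotopic, \<open>R\<^sub>0\<close> is the identity and
  \<open>R\<^sub>d\<close> is constant (\<open>interlacing_pack\<close>, \<open>k_homotopy\<close>).
\<close>

section \<open>Additive and linear maps\<close>

lemma additive_zero:
  assumes "abelian_group G" "abelian_group H" "f \<in> carrier G \<rightarrow> carrier H"
    and "\<And>x y. x \<in> carrier G \<Longrightarrow> y \<in> carrier G \<Longrightarrow> f (x \<oplus>\<^bsub>G\<^esub> y) = f x \<oplus>\<^bsub>H\<^esub> f y"
  shows "f \<zero>\<^bsub>G\<^esub> = \<zero>\<^bsub>H\<^esub>"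
proof -
  interpret G: abelian_group G by fact
  interpret H: abelian_group H by fact
  have f0: "f \<zero>\<^bsub>G\<^esub> \<in> carrier H" using assms(3) by auto
  have "f \<zero>\<^bsub>G\<^esub> = f \<zero>\<^bsub>G\<^esub> \<oplus>\<^bsub>H\<^esub> f \<zero>\<^bsub>G\<^esub>"
    using assms(4)[of "\<zero>\<^bsub>G\<^esub>" "\<zero>\<^bsub>G\<^esub>"] by simp
  then show ?thesis using H.add.l_cancel_one'[OF f0 f0] by simp
qed

lemma additive_minus:
  assumes "abelian_group G" "abelian_group H" "f \<in> carrier G \<rightarrow> carrier H"
    and "\<And>x y. x \<in> carrier G \<Longrightarrow> y \<in> carrier G \<Longrightarrow> f (x \<oplus>\<^bsub>G\<^esub> y) = f x \<oplus>\<^bsub>H\<^esub> f y"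
    and "x \<in> carrier G"
  shows "f (\<ominus>\<^bsub>G\<^esub> x) = \<ominus>\<^bsub>H\<^esub> f x"
proof -
  interpret G: abelian_group G by fact
  interpret H: abelian_group H by fact
  have "f x \<oplus>\<^bsub>H\<^esub> f (\<ominus>\<^bsub>G\<^esub> x) = \<zero>\<^bsub>H\<^esub>"
    using assms additive_zero[OF assms(1-4)] by (metis G.a_inv_closed G.r_neg)
  then show ?thesis using assms(3,5)
    by (metis G.a_inv_closed H.minus_equality H.minus_minus PiE H.a_inv_closed H.a_comm)
qed

lemma additive_finsum:
  assumes "abelian_group G" "abelian_group H" "f \<in> carrier G \<rightarrow> carrier H"
    and "\<And>x y. x \<in> carrier G \<Longrightarrow> y \<in> carrier G \<Longrightarrow> f (x \<oplus>\<^bsub>G\<^esub> y) = f x \<oplus>\<^bsub>H\<^esub> f y"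
    and "g \<in> S \<rightarrow> carrier G"
  shows "f (\<Oplus>\<^bsub>G\<^esub>s\<in>S. g s) = (\<Oplus>\<^bsub>H\<^esub>s\<in>S. f (g s))"
proof -
  interpret G: abelian_group G by fact
  interpret H: abelian_group H by fact
  note z = additive_zero[OF assms(1-4)]
  show ?thesis using assms(5)
  proof (induction S rule: infinite_finite_induct)
    case (infinite S) then show ?case using z by simp
  next
    case empty show ?case using z by simp
  next
    case (insert s S)
    then have "(\<Oplus>\<^bsub>G\<^esub>s\<in>S. g s) \<in> carrier G" "g s \<in> carrier G" by auto
    moreover have "(\<lambda>s. f (g s)) \<in> S \<rightarrow> carrier H" "f (g s) \<in> carrier H"
      using insert.prems assms(3) by auto
    ultimately show ?case using insert assms(4) by (simp add: Pi_iff)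
  qed
qed

lemma (in abelian_group) finsum_swap:
  assumes "finite S" "finite T" "\<And>s t. s \<in> S \<Longrightarrow> t \<in> T \<Longrightarrow> f s t \<in> carrier G"
  shows "(\<Oplus>s\<in>S. \<Oplus>t\<in>T. f s t) = (\<Oplus>t\<in>T. \<Oplus>s\<in>S. f s t)"
  using assms(1,3)
proof (induction S)
  case empty then show ?case by (simp add: finsum_zero)
next
  case (insert s S)
  have "(\<Oplus>t\<in>T. \<Oplus>s\<in>insert s S. f s t) = (\<Oplus>t\<in>T. f s t \<oplus> (\<Oplus>s\<in>S. f s t))"
    by (rule finsum_cong') (use insert in \<open>auto intro!: finsum_closed simp: Pi_iff\<close>)
  also have "\<dots> = (\<Oplus>t\<in>T. f s t) \<oplus> (\<Oplus>t\<in>T. \<Oplus>s\<in>S. f s t)"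
    by (rule finsum_addf) (use insert in \<open>auto intro!: finsum_closed\<close>)
  finally show ?case using insert
    by (subst finsum_insert) (auto intro!: finsum_closed simp: Pi_iff)
qed

lemma (in abelian_group) add_exchange:
  assumes "a \<in> carrier G" "b \<in> carrier G" "c \<in> carrier G" "d \<in> carrier G"
  shows "(a \<oplus> b) \<oplus> (c \<oplus> d) = (a \<oplus> c) \<oplus> (b \<oplus> d)"
  using assms by (simp add: a_ac)

lemma (in abelian_group) neg_zero: "\<ominus> \<zero> = \<zero>"
  by (rule minus_equality) auto

lemma (in abelian_group) finsum_sing: "f a \<in> carrier G \<Longrightarrow> finsum G f {a} = f a"
  by (subst finsum_insert) auto

lemma (in abelian_group) finsum_three:
  assumes "a \<noteq> b" "a \<noteq> c" "b \<noteq> c" "f a \<in> carrier G" "f b \<in> carrier G" "f c \<in> carrier G"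
  shows "finsum G f {a, b, c} = f a \<oplus> (f b \<oplus> f c)"
  using assms by (simp add: finsum_insert)

lemma (in abelian_group) finsum_additive_endo:
  assumes "\<And>x. x \<in> carrier G \<Longrightarrow> f x \<in> carrier G"
    and "\<And>x y. x \<in> carrier G \<Longrightarrow> y \<in> carrier G \<Longrightarrow> f (x \<oplus> y) = f x \<oplus> f y"
    and "g \<in> S \<rightarrow> carrier G"
  shows "(\<Oplus>s\<in>S. f (g s)) = f (\<Oplus>s\<in>S. g s)"
  by (rule additive_finsum[symmetric]) (use assms abelian_group_axioms in auto)

lemma (in abelian_group) finsum_delta:
  assumes "finite S" "u \<in> S" "g u \<in> carrier G" "\<And>v. v \<in> S \<Longrightarrow> v \<noteq> u \<Longrightarrow> g v = \<zero>"
  shows "(\<Oplus>v\<in>S. g v) = g u"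
proof -
  have "S = insert u (S - {u})" using assms(2) by auto
  then have "(\<Oplus>v\<in>S. g v) = (\<Oplus>v\<in>insert u (S - {u}). g v)" by simp
  also have "\<dots> = g u \<oplus> (\<Oplus>v\<in>S - {u}. g v)"
    by (rule finsum_insert) (use assms in auto)
  also have "(\<Oplus>v\<in>S - {u}. g v) = \<zero>"
    by (rule add.finprod_one_eqI) (use assms in auto)
  finally show ?thesis using assms(3) by simp
qed

locale kalgebra = V?: module K A + A?: ring A
  for K :: "('k, 'r) ring_scheme" and A :: "('k, 'a) module" (structure) +
  assumes smult_mult_left: "c \<in> carrier K \<Longrightarrow> x \<in> carrier A \<Longrightarrow> y \<in> carrier A \<Longrightarrow>
      (c \<odot> x) \<otimes> y = c \<odot> (x \<otimes> y)"
    and smult_mult_right: "c \<in> carrier K \<Longrightarrow> x \<in> carrier A \<Longrightarrow> y \<in> carrier A \<Longrightarrow>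
      x \<otimes> (c \<odot> y) = c \<odot> (x \<otimes> y)"

lemma linear_map_closed: "linear_map K M N f \<Longrightarrow> x \<in> carrier M \<Longrightarrow> f x \<in> carrier N"
  by (auto simp: linear_map_def)

lemma linear_map_add:
  "linear_map K M N f \<Longrightarrow> x \<in> carrier M \<Longrightarrow> y \<in> carrier M \<Longrightarrow> f (x \<oplus>\<^bsub>M\<^esub> y) = f x \<oplus>\<^bsub>N\<^esub> f y"
  by (auto simp: linear_map_def)

lemma linear_map_smult:
  "linear_map K M N f \<Longrightarrow> a \<in> carrier K \<Longrightarrow> x \<in> carrier M \<Longrightarrow> f (a \<odot>\<^bsub>M\<^esub> x) = a \<odot>\<^bsub>N\<^esub> f x"
  by (auto simp: linear_map_def)

lemma linear_mapI:
  assumes "\<And>x. x \<in> carrier M \<Longrightarrow> f x \<in> carrier N"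
    and "\<And>x y. x \<in> carrier M \<Longrightarrow> y \<in> carrier M \<Longrightarrow> f (x \<oplus>\<^bsub>M\<^esub> y) = f x \<oplus>\<^bsub>N\<^esub> f y"
    and "\<And>a x. a \<in> carrier K \<Longrightarrow> x \<in> carrier M \<Longrightarrow> f (a \<odot>\<^bsub>M\<^esub> x) = a \<odot>\<^bsub>N\<^esub> f x"
  shows "linear_map K M N f"
  using assms by (auto simp: linear_map_def)

lemma linear_map_zero:
  assumes "linear_map K M N f" "abelian_group M" "abelian_group N"
  shows "f \<zero>\<^bsub>M\<^esub> = \<zero>\<^bsub>N\<^esub>"
  using assms by (intro additive_zero) (auto simp: linear_map_def)

lemma linear_map_minus:
  assumes "linear_map K M N f" "abelian_group M" "abelian_group N" "x \<in> carrier M"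
  shows "f (\<ominus>\<^bsub>M\<^esub> x) = \<ominus>\<^bsub>N\<^esub> f x"
  using assms by (intro additive_minus) (auto simp: linear_map_def)

lemma linear_map_finsum:
  assumes "linear_map K M N f" "abelian_group M" "abelian_group N" "g \<in> S \<rightarrow> carrier M"
  shows "f (\<Oplus>\<^bsub>M\<^esub>s\<in>S. g s) = (\<Oplus>\<^bsub>N\<^esub>s\<in>S. f (g s))"
  using assms by (intro additive_finsum) (auto simp: linear_map_def)

lemma linear_map_comp:
  "linear_map K M N f \<Longrightarrow> linear_map K N P g \<Longrightarrow> linear_map K M P (\<lambda>x. g (f x))"
  by (auto simp: linear_map_def Pi_iff)

lemma linear_map_cong:
  assumes "linear_map K M N f" "\<And>x. x \<in> carrier M \<Longrightarrow> f x = g x" "module K M"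
  shows "linear_map K M N g"
proof -
  interpret module K M by fact
  show ?thesis using assms(1) unfolding linear_map_def
    by (auto simp: Pi_iff simp flip: assms(2))
qed

context kalgebra begin

abbreviation lin :: "('k, 'b) module \<Rightarrow> ('b \<Rightarrow> 'a) \<Rightarrow> bool" where
  "lin U f \<equiv> linear_map K U A f"

lemma lin_zero: "lin U (\<lambda>x. \<zero>)"
  by (rule linear_mapI) auto

lemma lin_add: "lin U f \<Longrightarrow> lin U g \<Longrightarrow> lin U (\<lambda>x. f x \<oplus> g x)"
  by (rule linear_mapI)
    (auto simp: linear_map_add linear_map_smult linear_map_closed add_exchange smult_r_distr)

lemma lin_uminus: "lin U f \<Longrightarrow> lin U (\<lambda>x. \<ominus> f x)"
  by (rule linear_mapI)
    (auto simp: linear_map_add linear_map_smult linear_map_closed minus_add smult_r_minus)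

lemma lin_diff: "lin U f \<Longrightarrow> lin U g \<Longrightarrow> lin U (\<lambda>x. f x \<ominus> g x)"
  by (simp add: a_minus_def lin_add lin_uminus)

lemma lin_mult_left: "lin U f \<Longrightarrow> a \<in> carrier A \<Longrightarrow> lin U (\<lambda>x. a \<otimes> f x)"
  by (rule linear_mapI)
    (auto simp: linear_map_add linear_map_smult linear_map_closed r_distr smult_mult_right)

lemma lin_mult_right: "lin U f \<Longrightarrow> a \<in> carrier A \<Longrightarrow> lin U (\<lambda>x. f x \<otimes> a)"
  by (rule linear_mapI)
    (auto simp: linear_map_add linear_map_smult linear_map_closed l_distr smult_mult_left)

lemma lin_id: "lin A (\<lambda>x. x)"
  by (rule linear_mapI) auto

lemma lin_finsum:
  assumes "\<And>v. v \<in> S \<Longrightarrow> linear_map K U A (g v)"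
  shows "linear_map K U A (\<lambda>x. \<Oplus>v\<in>S. g v x)"
proof (rule linear_mapI)
  show "(\<Oplus>v\<in>S. g v x) \<in> carrier A" if "x \<in> carrier U" for x
    using linear_map_closed[OF assms that] by auto
  show "(\<Oplus>v\<in>S. g v (x \<oplus>\<^bsub>U\<^esub> y)) = (\<Oplus>v\<in>S. g v x) \<oplus> (\<Oplus>v\<in>S. g v y)"
    if xy: "x \<in> carrier U" "y \<in> carrier U" for x y
  proof -
    have "(\<Oplus>v\<in>S. g v (x \<oplus>\<^bsub>U\<^esub> y)) = (\<Oplus>v\<in>S. g v x \<oplus> g v y)"
      by (rule finsum_cong') (use linear_map_closed[OF assms] linear_map_add[OF assms] xy in auto)
    also have "\<dots> = (\<Oplus>v\<in>S. g v x) \<oplus> (\<Oplus>v\<in>S. g v y)"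
      by (rule finsum_addf) (use linear_map_closed[OF assms] xy in auto)
    finally show ?thesis .
  qed
  show "(\<Oplus>v\<in>S. g v (a \<odot>\<^bsub>U\<^esub> x)) = a \<odot> (\<Oplus>v\<in>S. g v x)" if ax: "a \<in> carrier K" "x \<in> carrier U" for a x
  proof -
    have "(\<Oplus>v\<in>S. g v (a \<odot>\<^bsub>U\<^esub> x)) = (\<Oplus>v\<in>S. a \<odot> g v x)"
      by (rule finsum_cong') (use linear_map_closed[OF assms] linear_map_smult[OF assms] ax in auto)
    also have "\<dots> = a \<odot> (\<Oplus>v\<in>S. g v x)"
      by (rule additive_finsum[OF A.is_abelian_group A.is_abelian_group, symmetric])
        (use linear_map_closed[OF assms] ax smult_r_distr in auto)
    finally show ?thesis .
  qed
qed

end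

section \<open>Splitting complexes over a field\<close>

text \<open>
  The kernel of the retraction is a complement of \<open>U\<close>, obtained from Zorn's lemma as a maximal
  subspace that meets \<open>U\<close> trivially.
\<close>
lemma linear_retraction:
  fixes V :: "('k, 'b) module" (structure)
  assumes "field K" "module K V"
    and sub: "U \<subseteq> carrier V" "\<zero> \<in> U"
      "\<And>x y. x \<in> U \<Longrightarrow> y \<in> U \<Longrightarrow> x \<oplus> y \<in> U"
      "\<And>a x. a \<in> carrier K \<Longrightarrow> x \<in> U \<Longrightarrow> a \<odot> x \<in> U"
  obtains \<pi> where "linear_map K V V \<pi>" "\<And>x. x \<in> carrier V \<Longrightarrow> \<pi> x \<in> U" "\<And>x. x \<in> U \<Longrightarrow> \<pi> x = x"
proof -
  interpret F: field K by fact
  interpret module K V by fact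
  define subsp where "subsp = (\<lambda>W. W \<subseteq> carrier V \<and> \<zero> \<in> W \<and>
    (\<forall>x\<in>W. \<forall>y\<in>W. x \<oplus> y \<in> W) \<and> (\<forall>a\<in>carrier K. \<forall>x\<in>W. a \<odot> x \<in> W))"
  have minus_sub: "\<ominus> x \<in> W" if "subsp W" "x \<in> W" for W x
  proof -
    have "(\<ominus>\<^bsub>K\<^esub> \<one>\<^bsub>K\<^esub>) \<odot> x \<in> W" using that by (auto simp: subsp_def)
    moreover have "(\<ominus>\<^bsub>K\<^esub> \<one>\<^bsub>K\<^esub>) \<odot> x = \<ominus> x" using that
      by (subst smult_l_minus) (auto simp: subsp_def)
    ultimately show ?thesis by simp
  qed
  have subU: "subsp U" using sub by (auto simp: subsp_def)
  define \<A> where "\<A> = {C. subsp C \<and> C \<inter> U = {\<zero>}}"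
  have "\<exists>C\<in>\<A>. \<forall>W\<in>\<A>. C \<subseteq> W \<longrightarrow> W = C"
  proof (rule subset_Zorn_nonempty)
    have "{\<zero>} \<in> \<A>" using sub by (auto simp: \<A>_def subsp_def)
    then show "\<A> \<noteq> {}" by blast
  next
    fix \<C> assume ne: "\<C> \<noteq> {}" and ch: "subset.chain \<A> \<C>"
    have mem: "W \<in> \<C> \<Longrightarrow> subsp W \<and> W \<inter> U = {\<zero>}" for W
      using ch by (auto simp: subset.chain_def \<A>_def)
    have "x \<oplus> y \<in> \<Union>\<C>" if xy: "x \<in> \<Union>\<C>" "y \<in> \<Union>\<C>" for x y
    proof -
      obtain W W' where W: "W \<in> \<C>" "x \<in> W" "W' \<in> \<C>" "y \<in> W'" using xy by blast
      then have "W \<subseteq> W' \<or> W' \<subseteq> W" using ch by (auto simp: subset.chain_def)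
      then show ?thesis using W mem unfolding subsp_def by (metis UnionI subsetD)
    qed
    moreover have "a \<odot> x \<in> \<Union>\<C>" if "a \<in> carrier K" "x \<in> \<Union>\<C>" for a x
      using that mem unfolding subsp_def by blast
    moreover have "\<Union>\<C> \<subseteq> carrier V" "\<zero> \<in> \<Union>\<C>" using mem ne unfolding subsp_def by blast+
    ultimately have "subsp (\<Union>\<C>)" by (auto simp: subsp_def)
    moreover have "\<Union>\<C> \<inter> U = {\<zero>}" using mem ne by blast
    ultimately show "\<Union>\<C> \<in> \<A>" by (simp add: \<A>_def)
  qed
  then obtain C where C: "subsp C" "C \<inter> U = {\<zero>}"
    and max: "\<And>W. subsp W \<Longrightarrow> W \<inter> U = {\<zero>} \<Longrightarrow> C \<subseteq> W \<Longrightarrow> W = C"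
    by (auto simp: \<A>_def)
  note Cd = C(1)[unfolded subsp_def]
  have CV: "c \<in> carrier V" if "c \<in> C" for c using Cd that by blast
  have dec: "\<exists>u\<in>U. \<exists>c\<in>C. v = u \<oplus> c" if v: "v \<in> carrier V" for v
  proof (rule ccontr)
    assume no: "\<not> ?thesis"
    define W where "W = {c \<oplus> a \<odot> v | c a. c \<in> C \<and> a \<in> carrier K}"
    have cW: "c \<oplus> a \<odot> v \<in> W" if "c \<in> C" "a \<in> carrier K" for c a
      using that by (auto simp: W_def)
    have CW: "c \<in> W" if "c \<in> C" for c
      using cW[OF that F.zero_closed] that v Cd by (auto simp: smult_l_null subsetD)
    have vW: "v \<in> W" using cW[of "\<zero>" "\<one>\<^bsub>K\<^esub>"] v Cd by simp
    have "subsp W"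
      unfolding subsp_def
    proof (intro conjI ballI)
      show "W \<subseteq> carrier V" using v Cd by (auto simp: W_def subsetD)
      show "\<zero> \<in> W" using CW Cd by blast
    next
      fix x y assume "x \<in> W" "y \<in> W"
      then obtain c a c' a' where *: "x = c \<oplus> a \<odot> v" "y = c' \<oplus> a' \<odot> v"
        "c \<in> C" "c' \<in> C" "a \<in> carrier K" "a' \<in> carrier K" by (auto simp: W_def)
      have "x \<oplus> y = (c \<oplus> c') \<oplus> (a \<oplus>\<^bsub>K\<^esub> a') \<odot> v"
        using * v CV by (simp add: smult_l_distr M.a_ac)
      then show "x \<oplus> y \<in> W" using cW[of "c \<oplus> c'" "a \<oplus>\<^bsub>K\<^esub> a'"] * Cd by auto
    next
      fix b x assume b: "b \<in> carrier K" and "x \<in> W"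
      then obtain c a where *: "x = c \<oplus> a \<odot> v" "c \<in> C" "a \<in> carrier K" by (auto simp: W_def)
      have "b \<odot> x = b \<odot> c \<oplus> (b \<otimes>\<^bsub>K\<^esub> a) \<odot> v"
        using * v b CV by (simp add: smult_r_distr smult_assoc1)
      then show "b \<odot> x \<in> W" using cW[of "b \<odot> c" "b \<otimes>\<^bsub>K\<^esub> a"] * b Cd by auto
    qed
    moreover have "W \<inter> U = {\<zero>}"
    proof -
      have "x = \<zero>" if "x \<in> W" "x \<in> U" for x
      proof -
        obtain c a where *: "x = c \<oplus> a \<odot> v" "c \<in> C" "a \<in> carrier K"
          using \<open>x \<in> W\<close> by (auto simp: W_def)
        have c: "c \<in> carrier V" "x \<in> carrier V" using * Cd sub that by auto
        show ?thesis
        proof (cases "a = \<zero>\<^bsub>K\<^esub>")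
          case True
          then have "x = c" using * c v by (simp add: smult_l_null)
          then show ?thesis using C(2) * that by blast
        next
          case False
          then have a: "inv\<^bsub>K\<^esub> a \<in> carrier K" "inv\<^bsub>K\<^esub> a \<otimes>\<^bsub>K\<^esub> a = \<one>\<^bsub>K\<^esub>"
            using * by (auto simp: F.field_Units)
          have "a \<odot> v = x \<oplus> \<ominus> c"
            unfolding *(1) using * c v
            by (simp add: M.a_ac M.r_neg1 M.r_neg2 M.r_neg M.l_neg)
          then have "inv\<^bsub>K\<^esub> a \<odot> (a \<odot> v) = inv\<^bsub>K\<^esub> a \<odot> x \<oplus> inv\<^bsub>K\<^esub> a \<odot> (\<ominus> c)"
            using a c by (simp add: smult_r_distr)
          moreover have "inv\<^bsub>K\<^esub> a \<odot> (a \<odot> v) = v" using a * v by (simp flip: smult_assoc1)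
          moreover have "inv\<^bsub>K\<^esub> a \<odot> x \<in> U" using a sub that by auto
          moreover have "inv\<^bsub>K\<^esub> a \<odot> (\<ominus> c) \<in> C" using a minus_sub[OF C(1)] * Cd by auto
          ultimately show ?thesis using no by metis
        qed
      qed
      then show ?thesis using CW Cd sub by blast
    qed
    ultimately have "W = C" using max CW by blast
    then have "v \<in> C" using vW by simp
    then show False using no sub v by force
  qed
  have uniq: "u = u'" if "u \<in> U" "u' \<in> U" "c \<in> C" "c' \<in> C" "u \<oplus> c = u' \<oplus> c'" for u u' c c'
  proof -
    have cl: "u \<in> carrier V" "u' \<in> carrier V" "c \<in> carrier V" "c' \<in> carrier V" using that sub Cd by auto
    have "u \<oplus> \<ominus> u' = (u \<oplus> c) \<oplus> \<ominus> c \<oplus> \<ominus> u'"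
      using cl by (simp add: M.a_assoc M.r_neg)
    also have "\<dots> = (u' \<oplus> \<ominus> u') \<oplus> (c' \<oplus> \<ominus> c)"
      unfolding that(5) using cl by (simp only: M.a_ac M.a_closed M.a_inv_closed)
    also have "\<dots> = c' \<oplus> \<ominus> c" using cl by (simp add: M.r_neg)
    finally have "u \<oplus> \<ominus> u' = c' \<oplus> \<ominus> c" .
    moreover have "u \<oplus> \<ominus> u' \<in> U" using that minus_sub[OF subU] sub by auto
    moreover have "c' \<oplus> \<ominus> c \<in> C" using that minus_sub[OF C(1)] Cd by auto
    ultimately have "u \<oplus> \<ominus> u' = \<zero>" using C(2) by auto
    then show ?thesis using cl by (metis M.minus_equality M.minus_minus M.a_inv_closed M.a_comm)
  qed
  define \<pi> where "\<pi> v = (THE u. u \<in> U \<and> (\<exists>c\<in>C. v = u \<oplus> c))" for v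
  have \<pi>: "\<pi> (u \<oplus> c) = u" if "u \<in> U" "c \<in> C" for u c
    unfolding \<pi>_def by (rule the_equality) (use that uniq in blast)+
  show ?thesis
  proof
    show "\<pi> x \<in> U" if "x \<in> carrier V" for x using dec[OF that] \<pi> by auto
    show "\<pi> x = x" if "x \<in> U" for x using \<pi>[OF that, of "\<zero>"] Cd that sub by auto
    show "linear_map K V V \<pi>"
    proof (rule linear_mapI)
      show "\<pi> x \<in> carrier V" if "x \<in> carrier V" for x using dec[OF that] \<pi> sub by auto
    next
      fix x y assume "x \<in> carrier V" "y \<in> carrier V"
      then obtain u c u' c' where *: "u \<in> U" "c \<in> C" "x = u \<oplus> c" "u' \<in> U" "c' \<in> C" "y = u' \<oplus> c'"
        using dec by metis
      have "x \<oplus> y = (u \<oplus> u') \<oplus> (c \<oplus> c')"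
        using * sub(1) CV by (simp add: M.a_ac subsetD)
      then show "\<pi> (x \<oplus> y) = \<pi> x \<oplus> \<pi> y" using * \<pi> sub Cd by simp
    next
      fix a x assume a: "a \<in> carrier K" and "x \<in> carrier V"
      then obtain u c where *: "u \<in> U" "c \<in> C" "x = u \<oplus> c" using dec by metis
      have "a \<odot> x = a \<odot> u \<oplus> a \<odot> c"
        using * a sub(1) CV by (simp add: smult_r_distr subsetD)
      then show "\<pi> (a \<odot> x) = a \<odot> \<pi> x" using * \<pi> a sub Cd by simp
    qed
  qed
qed

text \<open>
  On the image of \<open>f\<close>, the inverse is taken along a complement of the kernel; it is extended to \<open>Y\<close>
  by a retraction onto the image.
\<close>
lemma generalized_inverse:
  assumes "field K" "module K X" "module K Y" "linear_map K X Y f"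
  obtains g where "linear_map K Y X g" "\<And>x. x \<in> carrier X \<Longrightarrow> f (g (f x)) = f x"
proof -
  interpret X: module K X by fact
  interpret Y: module K Y by fact
  note f = linear_map_closed[OF assms(4)] linear_map_add[OF assms(4)] linear_map_smult[OF assms(4)]
  note f0 = linear_map_zero[OF assms(4) X.M.abelian_group_axioms Y.M.abelian_group_axioms]
  obtain \<rho> where \<rho>: "linear_map K X X \<rho>"
    "\<And>x. x \<in> carrier X \<Longrightarrow> \<rho> x \<in> {x \<in> carrier X. f x = \<zero>\<^bsub>Y\<^esub>}"
    "\<And>x. x \<in> {x \<in> carrier X. f x = \<zero>\<^bsub>Y\<^esub>} \<Longrightarrow> \<rho> x = x"
    by (rule linear_retraction[OF assms(1,2), of "{x \<in> carrier X. f x = \<zero>\<^bsub>Y\<^esub>}"])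
      (auto simp: f f0 Y.smult_r_null)
  obtain \<sigma> where \<sigma>: "linear_map K Y Y \<sigma>" "\<And>y. y \<in> carrier Y \<Longrightarrow> \<sigma> y \<in> f ` carrier X"
    "\<And>y. y \<in> f ` carrier X \<Longrightarrow> \<sigma> y = y"
  proof (rule linear_retraction[OF assms(1,3), of "f ` carrier X"])
    show "\<zero>\<^bsub>Y\<^esub> \<in> f ` carrier X" using f0 by (metis X.M.zero_closed imageI)
    show "x \<oplus>\<^bsub>Y\<^esub> y \<in> f ` carrier X" if "x \<in> f ` carrier X" "y \<in> f ` carrier X" for x y
      using that f(2) by (auto simp flip: f(2))
    show "a \<odot>\<^bsub>Y\<^esub> x \<in> f ` carrier X" if "a \<in> carrier K" "x \<in> f ` carrier X" for a x
      using that by (auto simp flip: f(3))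
  qed (auto simp: f)
  note r = linear_map_closed[OF \<rho>(1)] linear_map_add[OF \<rho>(1)] linear_map_smult[OF \<rho>(1)]
    linear_map_minus[OF \<rho>(1) X.M.abelian_group_axioms X.M.abelian_group_axioms]
  note fm = linear_map_minus[OF assms(4) X.M.abelian_group_axioms Y.M.abelian_group_axioms]
  define q where "q x = x \<oplus>\<^bsub>X\<^esub> \<ominus>\<^bsub>X\<^esub> \<rho> x" for x
  have q: "linear_map K X X q"
    by (rule linear_mapI) (auto simp: q_def r X.M.minus_add X.M.a_ac X.smult_r_distr X.smult_r_minus)
  have fq: "f (q x) = f x" if "x \<in> carrier X" for x
    using that \<rho>(2)[OF that] by (simp add: q_def f fm)
  have qeq: "q x = q x'" if "x \<in> carrier X" "x' \<in> carrier X" "f x = f x'" for x x'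
  proof -
    have "x \<oplus>\<^bsub>X\<^esub> \<ominus>\<^bsub>X\<^esub> x' \<in> {x \<in> carrier X. f x = \<zero>\<^bsub>Y\<^esub>}"
      using that by (simp add: f fm Y.M.r_neg)
    from \<rho>(3)[OF this] have "q (x \<oplus>\<^bsub>X\<^esub> \<ominus>\<^bsub>X\<^esub> x') = \<zero>\<^bsub>X\<^esub>"
      using that by (simp add: q_def X.M.r_neg)
    then have "q x \<oplus>\<^bsub>X\<^esub> \<ominus>\<^bsub>X\<^esub> q x' = \<zero>\<^bsub>X\<^esub>"
      using that by (simp add: linear_map_add[OF q]
        linear_map_minus[OF q X.M.abelian_group_axioms X.M.abelian_group_axioms])
    then show ?thesis using that linear_map_closed[OF q]
      by (metis X.M.minus_equality X.M.minus_minus X.M.a_inv_closed X.M.a_comm)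
  qed
  define s where "s y = q (SOME x. x \<in> carrier X \<and> f x = y)" for y
  have s: "s (f x) = q x" if "x \<in> carrier X" for x
    unfolding s_def
    using someI[of "\<lambda>x'. x' \<in> carrier X \<and> f x' = f x" x] that by (intro qeq) auto
  show ?thesis
  proof
    show "linear_map K Y X (\<lambda>y. s (\<sigma> y))"
    proof (rule linear_mapI)
      show "s (\<sigma> y) \<in> carrier X" if "y \<in> carrier Y" for y
        using \<sigma>(2)[OF that] s linear_map_closed[OF q] by auto
    next
      fix x y assume "x \<in> carrier Y" "y \<in> carrier Y"
      then obtain u v where *: "u \<in> carrier X" "v \<in> carrier X" "\<sigma> x = f u" "\<sigma> y = f v" using \<sigma>(2) by blast
      have "\<sigma> (x \<oplus>\<^bsub>Y\<^esub> y) = f (u \<oplus>\<^bsub>X\<^esub> v)"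
        using * \<open>x \<in> carrier Y\<close> \<open>y \<in> carrier Y\<close> by (simp add: linear_map_add[OF \<sigma>(1)] f)
      then show "s (\<sigma> (x \<oplus>\<^bsub>Y\<^esub> y)) = s (\<sigma> x) \<oplus>\<^bsub>X\<^esub> s (\<sigma> y)"
        using * by (simp add: s linear_map_add[OF q])
    next
      fix a y assume a: "a \<in> carrier K" "y \<in> carrier Y"
      then obtain u where *: "u \<in> carrier X" "\<sigma> y = f u" using \<sigma>(2) by blast
      have "\<sigma> (a \<odot>\<^bsub>Y\<^esub> y) = f (a \<odot>\<^bsub>X\<^esub> u)"
        using * a by (simp add: linear_map_smult[OF \<sigma>(1)] f)
      then show "s (\<sigma> (a \<odot>\<^bsub>Y\<^esub> y)) = a \<odot>\<^bsub>X\<^esub> s (\<sigma> y)"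
        using * a by (simp add: s linear_map_smult[OF q])
    qed
    show "f (s (\<sigma> (f x))) = f x" if "x \<in> carrier X" for x
      using that \<sigma>(3) by (simp add: s fq)
  qed
qed

text \<open>
  Let \<open>k\<close> consist of generalized inverses of the differentials. Then \<open>f = 1 - d k - k d\<close> is annihilated
  by \<open>d\<close> on both sides, but it need not vanish where the complex is acyclic. Its square does,
  because \<open>f\<close> takes values in cocycles, which are boundaries there, and \<open>f\<close> kills boundaries; and
  \<open>h = k + k f\<close> is a homotopy from \<open>e = f\<^sup>2\<close> to the identity.
\<close>
lemma contraction_exists:
  fixes V :: "int \<Rightarrow> ('k, 'b) module"
  assumes "field K" and mod: "\<And>i. module K (V i)"
    and d: "\<And>i. linear_map K (V i) (V (i + 1)) (d i)"
    and dd: "\<And>i x. x \<in> carrier (V i) \<Longrightarrow> d (i + 1) (d i x) = \<zero>\<^bsub>V (i + 2)\<^esub>"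
  obtains h e where "\<And>i. linear_map K (V i) (V (i - 1)) (h i)" "\<And>i. linear_map K (V i) (V i) (e i)"
    "\<And>i x. x \<in> carrier (V i) \<Longrightarrow> d (i - 1) (h i x) \<oplus>\<^bsub>V i\<^esub> h (i + 1) (d i x) \<oplus>\<^bsub>V i\<^esub> e i x = x"
    "\<And>i x. x \<in> carrier (V i) \<Longrightarrow> d i (e i x) = \<zero>\<^bsub>V (i + 1)\<^esub>"
    "\<And>i x. x \<in> carrier (V i) \<Longrightarrow> e (i + 1) (d i x) = \<zero>\<^bsub>V (i + 1)\<^esub>"
    "\<And>i x. (\<And>z. z \<in> carrier (V i) \<Longrightarrow> d i z = \<zero>\<^bsub>V (i + 1)\<^esub> \<Longrightarrow>
        \<exists>y\<in>carrier (V (i - 1)). z = d (i - 1) y) \<Longrightarrow> x \<in> carrier (V i) \<Longrightarrow> e i x = \<zero>\<^bsub>V i\<^esub>"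
proof -
  have ab: "abelian_group (V i)" for i using mod module.axioms by blast
  have "\<exists>g. linear_map K (V (i + 1)) (V i) g \<and> (\<forall>x\<in>carrier (V i). d i (g (d i x)) = d i x)" for i
    using generalized_inverse[OF assms(1) mod mod d] by metis
  then obtain g where g: "\<And>i. linear_map K (V (i + 1)) (V i) (g i)"
    "\<And>i x. x \<in> carrier (V i) \<Longrightarrow> d i (g i (d i x)) = d i x" by metis
  define k where "k i = g (i - 1)" for i
  have k: "linear_map K (V i) (V (i - 1)) (k i)" for i using g(1)[of "i - 1"] by (simp add: k_def)
  have k': "linear_map K (V (i + 1)) (V i) (k (i + 1))" for i using k[of "i + 1"] by simp
  have d': "linear_map K (V (i - 1)) (V i) (d (i - 1))" for i using d[of "i - 1"] by simp
  have dkd: "d i (k (i + 1) (d i x)) = d i x" if "x \<in> carrier (V i)" for i x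
    using g(2)[OF that] by (simp add: k_def)
  have dd': "d i (d (i - 1) x) = \<zero>\<^bsub>V (i + 1)\<^esub>" if "x \<in> carrier (V (i - 1))" for i x
    using dd[of x "i - 1"] that by (simp add: add.commute)
  define f where "f i x = x \<ominus>\<^bsub>V i\<^esub> d (i - 1) (k i x) \<ominus>\<^bsub>V i\<^esub> k (i + 1) (d i x)" for i x
  note cl = linear_map_closed[OF d] linear_map_closed[OF d'] linear_map_closed[OF k] linear_map_closed[OF k']
  note ad = linear_map_add[OF d] linear_map_add[OF d'] linear_map_add[OF k] linear_map_add[OF k']
  note sm = linear_map_smult[OF d] linear_map_smult[OF d'] linear_map_smult[OF k] linear_map_smult[OF k']
  note mi = linear_map_minus[OF d ab ab] linear_map_minus[OF d' ab ab]
    linear_map_minus[OF k ab ab] linear_map_minus[OF k' ab ab]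
  have f: "linear_map K (V i) (V i) (f i)" for i
  proof (rule linear_mapI)
    interpret module K "V i" by (rule mod)
    show "f i x \<in> carrier (V i)" if "x \<in> carrier (V i)" for x using that by (simp add: f_def cl)
    show "f i (x \<oplus>\<^bsub>V i\<^esub> y) = f i x \<oplus>\<^bsub>V i\<^esub> f i y" if "x \<in> carrier (V i)" "y \<in> carrier (V i)" for x y
      using that by (simp add: f_def cl ad a_minus_def M.minus_add M.a_ac)
    show "f i (a \<odot>\<^bsub>V i\<^esub> x) = a \<odot>\<^bsub>V i\<^esub> f i x" if "a \<in> carrier K" "x \<in> carrier (V i)" for a x
      using that by (simp add: f_def cl sm a_minus_def smult_r_distr smult_r_minus)
  qed
  note fcl = linear_map_closed[OF f]
  have df: "d i (f i x) = \<zero>\<^bsub>V (i + 1)\<^esub>" if "x \<in> carrier (V i)" for i x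
  proof -
    interpret Vi: abelian_group "V i" by (rule ab)
    interpret Vj: abelian_group "V (i + 1)" by (rule ab)
    show ?thesis using that by (simp add: f_def a_minus_def ad cl mi dd' dkd Vj.r_neg Vj.neg_zero)
  qed
  have fd: "f (i + 1) (d i x) = \<zero>\<^bsub>V (i + 1)\<^esub>" if "x \<in> carrier (V i)" for i x
  proof -
    interpret Vj: abelian_group "V (i + 1)" by (rule ab)
    have "k (i + 1 + 1) \<zero>\<^bsub>V (i + 2)\<^esub> = \<zero>\<^bsub>V (i + 1)\<^esub>"
      using linear_map_zero[OF k'[of "i + 1"] ab ab] by (simp add: add.assoc)
    then show ?thesis using that by (simp add: f_def a_minus_def cl dkd dd Vj.r_neg Vj.neg_zero)
  qed
  define e where "e i x = f i (f i x)" for i x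
  define h where "h i x = k i x \<oplus>\<^bsub>V (i - 1)\<^esub> k i (f i x)" for i x
  show ?thesis
  proof
    show "linear_map K (V i) (V i) (e i)" for i
      using linear_map_comp[OF f f] by (simp add: e_def[abs_def])
    show "linear_map K (V i) (V (i - 1)) (h i)" for i
    proof (rule linear_mapI)
      interpret module K "V (i - 1)" by (rule mod)
      show "h i x \<in> carrier (V (i - 1))" if "x \<in> carrier (V i)" for x
        using that by (simp add: h_def cl fcl)
      show "h i (x \<oplus>\<^bsub>V i\<^esub> y) = h i x \<oplus>\<^bsub>V (i - 1)\<^esub> h i y"
        if "x \<in> carrier (V i)" "y \<in> carrier (V i)" for x y
        using that by (simp add: h_def cl fcl ad linear_map_add[OF f] M.a_ac)
      show "h i (a \<odot>\<^bsub>V i\<^esub> x) = a \<odot>\<^bsub>V (i - 1)\<^esub> h i x" if "a \<in> carrier K" "x \<in> carrier (V i)" for a x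
        using that by (simp add: h_def cl fcl sm linear_map_smult[OF f] smult_r_distr)
    qed
    fix i x assume x: "x \<in> carrier (V i)"
    show "d i (e i x) = \<zero>\<^bsub>V (i + 1)\<^esub>" using x by (simp add: e_def df fcl)
    show "e (i + 1) (d i x) = \<zero>\<^bsub>V (i + 1)\<^esub>"
      using x linear_map_zero[OF f ab ab] by (simp add: e_def fd)
    interpret Vi: abelian_group "V i" by (rule ab)
    have kf: "k (i + 1) \<zero>\<^bsub>V (i + 1)\<^esub> = \<zero>\<^bsub>V i\<^esub>" using linear_map_zero[OF k' ab ab] .
    have 1: "f i x = x \<ominus>\<^bsub>V i\<^esub> d (i - 1) (k i x) \<ominus>\<^bsub>V i\<^esub> k (i + 1) (d i x)" by (simp add: f_def)
    have 2: "e i x = f i x \<ominus>\<^bsub>V i\<^esub> d (i - 1) (k i (f i x))"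
      using x by (simp add: e_def f_def[of i "f i x"] df kf fcl cl a_minus_def Vi.neg_zero)
    have 3: "h (i + 1) (d i x) = k (i + 1) (d i x)" using x
      by (simp add: h_def fd kf cl)
    have 4: "d (i - 1) (h i x) = d (i - 1) (k i x) \<oplus>\<^bsub>V i\<^esub> d (i - 1) (k i (f i x))"
      using x by (simp add: h_def ad cl fcl)
    have *: "(a \<oplus>\<^bsub>V i\<^esub> b) \<oplus>\<^bsub>V i\<^esub> c \<oplus>\<^bsub>V i\<^esub> ((x \<ominus>\<^bsub>V i\<^esub> a \<ominus>\<^bsub>V i\<^esub> c) \<ominus>\<^bsub>V i\<^esub> b) = x"
      if "a \<in> carrier (V i)" "b \<in> carrier (V i)" "c \<in> carrier (V i)" "x \<in> carrier (V i)" for a b c x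
    proof -
      define s where "s = a \<oplus>\<^bsub>V i\<^esub> b \<oplus>\<^bsub>V i\<^esub> c"
      have s: "s \<in> carrier (V i)" using that by (simp add: s_def)
      have "(x \<ominus>\<^bsub>V i\<^esub> a \<ominus>\<^bsub>V i\<^esub> c) \<ominus>\<^bsub>V i\<^esub> b = x \<oplus>\<^bsub>V i\<^esub> \<ominus>\<^bsub>V i\<^esub> s"
        using that by (simp add: a_minus_def s_def Vi.minus_add Vi.a_ac)
      then show ?thesis using s that by (simp add: s_def[symmetric] Vi.a_lcomm[of s] Vi.r_neg)
    qed
    show "d (i - 1) (h i x) \<oplus>\<^bsub>V i\<^esub> h (i + 1) (d i x) \<oplus>\<^bsub>V i\<^esub> e i x = x"
      unfolding 2 3 4 using x
      by (subst (2) 1) (rule *, auto simp: cl fcl)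
  next
    fix i x
    assume ex: "\<And>z. z \<in> carrier (V i) \<Longrightarrow> d i z = \<zero>\<^bsub>V (i + 1)\<^esub> \<Longrightarrow> \<exists>y\<in>carrier (V (i - 1)). z = d (i - 1) y"
      and x: "x \<in> carrier (V i)"
    obtain y where "y \<in> carrier (V (i - 1))" "f i x = d (i - 1) y" using ex df x fcl by metis
    then show "e i x = \<zero>\<^bsub>V i\<^esub>" using fd[of y "i - 1"] by (simp add: e_def)
  qed
qed

section \<open>Functions on words and the dual bar differential\<close>

context kalgebra begin

text \<open>
  The sum over all ways to cut a word into two, possibly empty, parts. The recursion replaces the
  reindexing of sums over pairs of words in what follows; \<open>cuts_finsum\<close> returns to such a sum.
\<close>
primrec cuts :: "('w list \<Rightarrow> 'w list \<Rightarrow> 'a) \<Rightarrow> 'w list \<Rightarrow> 'a" where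
  "cuts f [] = f [] []"
| "cuts f (x # xs) = f [] (x # xs) \<oplus> cuts (\<lambda>us vs. f (x # us) vs) xs"

lemma cuts_closed [simp, intro]:
  "(\<And>us vs. us @ vs = xs \<Longrightarrow> f us vs \<in> carrier A) \<Longrightarrow> cuts f xs \<in> carrier A"
proof (induction xs arbitrary: f)
  case (Cons x xs)
  have "f [] (x # xs) \<in> carrier A" using Cons.prems[of "[]"] by simp
  moreover have "cuts (\<lambda>us vs. f (x # us) vs) xs \<in> carrier A"
    by (rule Cons.IH) (auto intro!: Cons.prems)
  ultimately show ?case by simp
qed simp

lemma cuts_cong:
  "(\<And>us vs. us @ vs = xs \<Longrightarrow> f us vs = g us vs) \<Longrightarrow> cuts f xs = cuts g xs"
proof (induction xs arbitrary: f g)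
  case (Cons x xs)
  have "cuts (\<lambda>us vs. f (x # us) vs) xs = cuts (\<lambda>us vs. g (x # us) vs) xs"
    by (rule Cons.IH) (auto intro!: Cons.prems)
  then show ?case using Cons.prems[of "[]"] by simp
qed simp

lemma cuts_zero: "(\<And>us vs. us @ vs = xs \<Longrightarrow> f us vs = \<zero>) \<Longrightarrow> cuts f xs = \<zero>"
proof (induction xs arbitrary: f)
  case (Cons x xs)
  have "cuts (\<lambda>us vs. f (x # us) vs) xs = \<zero>"
    by (rule Cons.IH) (auto intro!: Cons.prems)
  then show ?case using Cons.prems[of "[]"] by simp
qed simp

lemma cuts_add:
  assumes "\<And>us vs. f us vs \<in> carrier A" "\<And>us vs. g us vs \<in> carrier A"
  shows "cuts (\<lambda>us vs. f us vs \<oplus> g us vs) xs = cuts f xs \<oplus> cuts g xs"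
  using assms
proof (induction xs arbitrary: f g)
  case (Cons x xs)
  have "cuts (\<lambda>us vs. f (x # us) vs) xs \<in> carrier A" "cuts (\<lambda>us vs. g (x # us) vs) xs \<in> carrier A"
    "f [] (x # xs) \<in> carrier A" "g [] (x # xs) \<in> carrier A"
    using Cons.prems by auto
  moreover have "cuts (\<lambda>us vs. f (x # us) vs \<oplus> g (x # us) vs) xs =
      cuts (\<lambda>us vs. f (x # us) vs) xs \<oplus> cuts (\<lambda>us vs. g (x # us) vs) xs"
    by (rule Cons.IH) (auto intro!: Cons.prems)
  ultimately show ?case using Cons.prems by (simp add: add_exchange)
qed simp

lemma cuts_additive:
  assumes "\<And>us vs. f us vs \<in> carrier A" "\<And>x. x \<in> carrier A \<Longrightarrow> \<theta> x \<in> carrier A"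
    and "\<And>x y. x \<in> carrier A \<Longrightarrow> y \<in> carrier A \<Longrightarrow> \<theta> (x \<oplus> y) = \<theta> x \<oplus> \<theta> y"
  shows "cuts (\<lambda>us vs. \<theta> (f us vs)) xs = \<theta> (cuts f xs)"
  using assms(1)
proof (induction xs arbitrary: f)
  case (Cons x xs)
  have "cuts (\<lambda>us vs. \<theta> (f (x # us) vs)) xs = \<theta> (cuts (\<lambda>us vs. f (x # us) vs) xs)"
    by (rule Cons.IH) (auto intro!: Cons.prems)
  moreover have "cuts (\<lambda>us vs. f (x # us) vs) xs \<in> carrier A" "f [] (x # xs) \<in> carrier A"
    using Cons.prems by auto
  ultimately show ?case by (simp add: assms(3))
qed simp

lemma cuts_append_Cons:
  assumes "\<And>us vs. f us vs \<in> carrier A"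
  shows "cuts f (us @ y # vs) =
    cuts (\<lambda>a b. f a (b @ y # vs)) us \<oplus> cuts (\<lambda>a b. f (us @ y # a) b) vs"
  using assms
proof (induction us arbitrary: f)
  case (Cons u us)
  have "cuts (\<lambda>a b. f (u # a) b) (us @ y # vs) =
    cuts (\<lambda>a b. f (u # a) (b @ y # vs)) us \<oplus> cuts (\<lambda>a b. f (u # us @ y # a) b) vs"
    using Cons.IH[of "\<lambda>a b. f (u # a) b"] Cons.prems by simp
  then show ?case using Cons.prems by (simp add: a_assoc)
qed simp

text \<open>Both sides sum over the ways to cut a word into three parts.\<close>
lemma cuts_coassoc:
  assumes "\<And>a b c. f a b c \<in> carrier A"
  shows "cuts (\<lambda>a b. cuts (\<lambda>c e. f a c e) b) xs = cuts (\<lambda>a b. cuts (\<lambda>c e. f c e b) a) xs"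
  using assms
proof (induction xs arbitrary: f)
  case (Cons x xs)
  have "cuts (\<lambda>a b. cuts (\<lambda>c e. f a c e) b) (x # xs) =
     f [] [] (x # xs) \<oplus> cuts (\<lambda>c e. f [] (x # c) e) xs
       \<oplus> cuts (\<lambda>a b. cuts (\<lambda>c e. f (x # a) c e) b) xs" by simp
  also have "\<dots> = f [] [] (x # xs) \<oplus> cuts (\<lambda>c e. f [] (x # c) e) xs
       \<oplus> cuts (\<lambda>a b. cuts (\<lambda>c e. f (x # c) e b) a) xs"
    using Cons.IH[of "\<lambda>a. f (x # a)"] Cons.prems by simp
  also have "\<dots> = f [] [] (x # xs) \<oplus> cuts (\<lambda>a b. f [] (x # a) b \<oplus> cuts (\<lambda>c e. f (x # c) e b) a) xs"
    using Cons.prems by (simp add: cuts_add a_assoc)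
  finally show ?case by simp
qed simp

definition flip :: "bool \<Rightarrow> 'a \<Rightarrow> 'a" where
  "flip b x = (if b then \<ominus> x else x)"

lemma flip_closed [simp, intro]: "x \<in> carrier A \<Longrightarrow> flip b x \<in> carrier A"
  by (simp add: flip_def)

lemma flip_flip: "x \<in> carrier A \<Longrightarrow> flip b (flip c x) = flip (b \<noteq> c) x"
  by (simp add: flip_def)

lemma flip_add: "x \<in> carrier A \<Longrightarrow> y \<in> carrier A \<Longrightarrow> flip b (x \<oplus> y) = flip b x \<oplus> flip b y"
  by (simp add: flip_def minus_add)

lemma flip_zero [simp]: "flip b \<zero> = \<zero>"
  by (simp add: flip_def)

lemma flip_False [simp]: "flip False x = x"
  by (simp add: flip_def)

lemma cuts_flip:
  assumes "\<And>us vs. f us vs \<in> carrier A"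
  shows "cuts (\<lambda>us vs. flip b (f us vs)) xs = flip b (cuts f xs)"
  by (rule cuts_additive) (auto simp: assms flip_add)

definition cup :: "('w list \<Rightarrow> 'a) \<Rightarrow> ('w list \<Rightarrow> 'a) \<Rightarrow> 'w list \<Rightarrow> 'a" where
  "cup F G = cuts (\<lambda>us vs. F us \<otimes> G vs)"

lemma cup_closed [simp, intro]:
  "(\<And>w. F w \<in> carrier A) \<Longrightarrow> (\<And>w. G w \<in> carrier A) \<Longrightarrow> cup F G w \<in> carrier A"
  by (auto simp: cup_def)

lemma cup_assoc:
  assumes "\<And>w. F w \<in> carrier A" "\<And>w. G w \<in> carrier A" "\<And>w. H w \<in> carrier A"
  shows "cup (cup F G) H w = cup F (cup G H) w"
proof -
  have "cup F (cup G H) w = cuts (\<lambda>a b. cuts (\<lambda>c e. F a \<otimes> (G c \<otimes> H e)) b) w"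
    unfolding cup_def
  proof (rule cuts_cong)
    fix us vs
    show "F us \<otimes> cuts (\<lambda>us vs. G us \<otimes> H vs) vs = cuts (\<lambda>c e. F us \<otimes> (G c \<otimes> H e)) vs"
      by (rule cuts_additive[symmetric]) (auto simp: assms r_distr)
  qed
  also have "\<dots> = cuts (\<lambda>a b. cuts (\<lambda>c e. F c \<otimes> (G e \<otimes> H b)) a) w"
    by (rule cuts_coassoc) (auto simp: assms)
  also have "\<dots> = cup (cup F G) H w"
    unfolding cup_def
  proof (rule cuts_cong)
    fix us vs
    have "cuts (\<lambda>c e. (F c \<otimes> G e) \<otimes> H vs) us = cuts (\<lambda>us vs. F us \<otimes> G vs) us \<otimes> H vs"
      by (rule cuts_additive) (auto simp: assms l_distr)
    then show "cuts (\<lambda>c e. F c \<otimes> (G e \<otimes> H vs)) us = cuts (\<lambda>us vs. F us \<otimes> G vs) us \<otimes> H vs"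
      by (simp add: assms m_assoc)
  qed
  finally show ?thesis by simp
qed

end

text \<open>
  \<open>M\<close> multiplies a nonempty word into a single letter, and \<open>odd\<close> is the parity of a letter in the bar
  construction, where degrees are shifted by one.
\<close>
locale word_algebra = kalgebra K A
  for K :: "('k, 'r) ring_scheme" and A :: "('k, 'a) module" (structure) +
  fixes M :: "'w list \<Rightarrow> 'w" and odd :: "'w \<Rightarrow> bool"
begin

definition par :: "'w list \<Rightarrow> bool" where
  "par w = foldr (\<lambda>x b. odd x \<noteq> b) w False"

lemma par_simps [simp]: "par [] = False" "par (x # w) = (odd x \<noteq> par w)"
  by (auto simp: par_def)

lemma par_append [simp]: "par (u @ v) = (par u \<noteq> par v)"
  by (induction u) auto

text \<open>
  The composite of \<open>G\<close> with the bar differential: the sum of the values of \<open>G\<close> on all words in which a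
  nonempty block has been multiplied out, with the sign of the letters to the left of the block.
  The first summand of the recursion collects the blocks that contain the first letter.
\<close>
primrec D :: "('w list \<Rightarrow> 'a) \<Rightarrow> 'w list \<Rightarrow> 'a" where
  "D G [] = \<zero>"
| "D G (x # xs) = cuts (\<lambda>c e. G (M (x # c) # e)) xs \<oplus> flip (odd x) (D (\<lambda>z. G (x # z)) xs)"

lemma D_closed [simp, intro]: "(\<And>w. G w \<in> carrier A) \<Longrightarrow> D G xs \<in> carrier A"
  by (induction xs arbitrary: G) auto

lemma D_cong:
  "(\<And>us c vs. us @ c @ vs = xs \<Longrightarrow> c \<noteq> [] \<Longrightarrow> G (us @ M c # vs) = G' (us @ M c # vs)) \<Longrightarrow> D G xs = D G' xs"
proof (induction xs arbitrary: G G')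
  case (Cons x xs)
  have "cuts (\<lambda>c e. G (M (x # c) # e)) xs = cuts (\<lambda>c e. G' (M (x # c) # e)) xs"
    by (rule cuts_cong) (use Cons.prems[of "[]"] in auto)
  moreover have "D (\<lambda>z. G (x # z)) xs = D (\<lambda>z. G' (x # z)) xs"
  proof (rule Cons.IH)
    fix us c vs assume "us @ c @ vs = xs" "c \<noteq> []"
    then show "G (x # us @ M c # vs) = G' (x # us @ M c # vs)"
      using Cons.prems[of "x # us" c vs] by simp
  qed
  ultimately show ?case by simp
qed simp

lemma D_additive:
  assumes "\<And>w. G w \<in> carrier A" "\<And>x. x \<in> carrier A \<Longrightarrow> \<theta> x \<in> carrier A"
    and "\<And>x y. x \<in> carrier A \<Longrightarrow> y \<in> carrier A \<Longrightarrow> \<theta> (x \<oplus> y) = \<theta> x \<oplus> \<theta> y"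
  shows "D (\<lambda>w. \<theta> (G w)) xs = \<theta> (D G xs)"
  using assms(1)
proof (induction xs arbitrary: G)
  case Nil
  have "\<theta> \<zero> = \<zero>"
    by (rule additive_zero) (auto simp: assms is_abelian_group intro: assms(2))
  then show ?case by simp
next
  case (Cons x xs)
  have fl: "flip b (\<theta> y) = \<theta> (flip b y)" if "y \<in> carrier A" for b y
    using additive_minus[OF A.is_abelian_group A.is_abelian_group, of \<theta> y] assms that
    by (auto simp: flip_def)
  have "cuts (\<lambda>c e. \<theta> (G (M (x # c) # e))) xs = \<theta> (cuts (\<lambda>c e. G (M (x # c) # e)) xs)"
    by (rule cuts_additive) (auto simp: Cons.prems assms)
  moreover have "D (\<lambda>z. \<theta> (G (x # z))) xs = \<theta> (D (\<lambda>z. G (x # z)) xs)"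
    by (rule Cons.IH) (simp add: Cons.prems)
  ultimately show ?case using Cons.prems by (simp add: assms(3) fl)
qed

lemma D_add:
  assumes "\<And>w. G w \<in> carrier A" "\<And>w. H w \<in> carrier A"
  shows "D (\<lambda>w. G w \<oplus> H w) xs = D G xs \<oplus> D H xs"
  using assms
proof (induction xs arbitrary: G H)
  case (Cons x xs)
  have "D (\<lambda>z. G (x # z) \<oplus> H (x # z)) xs = D (\<lambda>z. G (x # z)) xs \<oplus> D (\<lambda>z. H (x # z)) xs"
    by (rule Cons.IH) (auto simp: Cons.prems)
  moreover have "cuts (\<lambda>c e. G (M (x # c) # e) \<oplus> H (M (x # c) # e)) xs =
     cuts (\<lambda>c e. G (M (x # c) # e)) xs \<oplus> cuts (\<lambda>c e. H (M (x # c) # e)) xs"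
    by (rule cuts_add) (auto simp: Cons.prems)
  moreover have "cuts (\<lambda>c e. G (M (x # c) # e)) xs \<in> carrier A" "cuts (\<lambda>c e. H (M (x # c) # e)) xs \<in> carrier A"
    "flip (odd x) (D (\<lambda>z. G (x # z)) xs) \<in> carrier A" "flip (odd x) (D (\<lambda>z. H (x # z)) xs) \<in> carrier A"
    using Cons.prems by auto
  ultimately show ?case using Cons.prems by (simp add: flip_add add_exchange)
qed simp

text \<open>
  The derivation rule. It is stated for functions of the two parts of a cut rather than for cup
  products, because the proof of \<open>D_D\<close> needs it in this form as well.
\<close>
lemma D_cuts:
  assumes "\<And>a b. P a b \<in> carrier A"
  shows "D (cuts P) xs =
    cuts (\<lambda>c e. D (\<lambda>c'. P c' e) c \<oplus> flip (par c) (D (P c) e)) xs"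
  using assms
proof (induction xs arbitrary: P)
  case (Cons x xs)
  note [simp, intro] = Cons.prems
  define a1 where "a1 = cuts (\<lambda>c e. P [] (M (x # c) # e)) xs"
  define a2 where "a2 = cuts (\<lambda>c e. cuts (\<lambda>u v. P (M (x # c) # u) v) e) xs"
  define a3 where "a3 = flip (odd x) (D (\<lambda>z. P [] (x # z)) xs)"
  define a4 where "a4 = flip (odd x) (cuts (\<lambda>c e. D (\<lambda>c'. P (x # c') e) c
      \<oplus> flip (par c) (D (P (x # c)) e)) xs)"
  have cl: "a1 \<in> carrier A" "a2 \<in> carrier A" "a3 \<in> carrier A" "a4 \<in> carrier A"
    by (auto simp: a1_def a2_def a3_def a4_def)
  have "cuts (\<lambda>c e. cuts P (M (x # c) # e)) xs = a1 \<oplus> a2"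
    by (simp add: cuts_add a1_def a2_def)
  moreover have "flip (odd x) (D (\<lambda>z. cuts P (x # z)) xs) = a3 \<oplus> a4"
  proof -
    have "D (\<lambda>z. cuts P (x # z)) xs = D (\<lambda>z. P [] (x # z)) xs \<oplus> D (cuts (\<lambda>u v. P (x # u) v)) xs"
      by (simp add: D_add)
    also have "D (cuts (\<lambda>u v. P (x # u) v)) xs = cuts (\<lambda>c e. D (\<lambda>c'. P (x # c') e) c
      \<oplus> flip (par c) (D (P (x # c)) e)) xs" by (rule Cons.IH) auto
    finally show ?thesis by (simp add: a3_def a4_def flip_add)
  qed
  ultimately have l: "D (cuts P) (x # xs) = (a1 \<oplus> a2) \<oplus> (a3 \<oplus> a4)" by simp
  have "cuts (\<lambda>c e. D (\<lambda>c'. P c' e) (x # c) \<oplus> flip (par (x # c)) (D (P (x # c)) e)) xs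
    = cuts (\<lambda>c e. cuts (\<lambda>u v. P (M (x # u) # v) e) c \<oplus>
        flip (odd x) (D (\<lambda>c'. P (x # c') e) c \<oplus> flip (par c) (D (P (x # c)) e))) xs"
    by (rule cuts_cong) (simp add: flip_add flip_flip a_assoc)
  also have "\<dots> = cuts (\<lambda>c e. cuts (\<lambda>u v. P (M (x # u) # v) e) c) xs \<oplus> a4"
    unfolding a4_def by (subst cuts_flip[symmetric]) (auto simp: cuts_add)
  also have "cuts (\<lambda>c e. cuts (\<lambda>u v. P (M (x # u) # v) e) c) xs = a2"
    unfolding a2_def by (rule cuts_coassoc[symmetric]) auto
  finally have r: "cuts (\<lambda>c e. D (\<lambda>c'. P c' e) (x # c) \<oplus> flip (par (x # c)) (D (P (x # c)) e)) xs
    = a2 \<oplus> a4" .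
  have "cuts (\<lambda>c e. D (\<lambda>c'. P c' e) c \<oplus> flip (par c) (D (P c) e)) (x # xs) =
    (a1 \<oplus> a3) \<oplus> (a2 \<oplus> a4)"
    using r by (simp add: a1_def a3_def)
  with l cl show ?case by (simp only: add_exchange)
qed simp

end

locale A_infinity_words = word_algebra K A M odd
  for K :: "('k, 'r) ring_scheme" and A :: "('k, 'a) module" (structure)
    and M :: "'w list \<Rightarrow> 'w" and odd :: "'w \<Rightarrow> bool" +
  fixes hom :: "'w \<Rightarrow> bool"
  assumes odd_M: "c \<noteq> [] \<Longrightarrow> odd (M c) = (\<not> par c)"
    and hom_M: "c \<noteq> [] \<Longrightarrow> list_all hom c \<Longrightarrow> hom (M c)"
begin

text \<open>
  The A-infinity relation, applied in one slot of \<open>G\<close>. In this form it makes sense without a linear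
  structure on letters.
\<close>
definition relation :: "('w list \<Rightarrow> 'a) \<Rightarrow> bool" where
  "relation G \<longleftrightarrow> (\<forall>us w vs. list_all hom us \<and> list_all hom w \<and> list_all hom vs \<and> w \<noteq> [] \<longrightarrow>
     D (\<lambda>z. G (us @ M z # vs)) w = \<zero>)"

text \<open>
  Two blocks that are multiplied out one after the other are either disjoint or nested. Disjoint
  blocks occur in both orders, with opposite signs since \<open>M\<close> changes the parity. Nested blocks with a
  fixed outer block add up to an instance of the A-infinity relation. The induction on words treats
  the case that the outer or the left block contains the first letter.
\<close>
lemma D_D:
  assumes "\<And>w. G w \<in> carrier A" "relation G" "list_all hom w"
  shows "D (D G) w = \<zero>"
  using assms
proof (induction w arbitrary: G)
  case (Cons x xs)
  note [simp, intro] = Cons.prems(1)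
  let ?Y = "\<lambda>c e. flip (par c) (D (\<lambda>e'. G (M (x # c) # e')) e)"
  let ?X = "\<lambda>c e. cuts (\<lambda>u v. G (M (M (x # c) # u) # v)) e"
  let ?Z = "\<lambda>c e. D (\<lambda>c'. G (M (x # c') # e)) c"
  have rel: "relation (\<lambda>z. G (x # z))"
    unfolding relation_def
  proof (intro allI impI, elim conjE)
    fix us w vs assume "list_all hom us" "list_all hom w" "list_all hom vs" "w \<noteq> []"
    then show "D (\<lambda>z. G (x # us @ M z # vs)) w = \<zero>"
      using Cons.prems(2)[unfolded relation_def, rule_format, of "x # us" w vs] Cons.prems(3) by simp
  qed
  have IH: "D (D (\<lambda>z. G (x # z))) xs = \<zero>"
    by (rule Cons.IH) (use rel Cons.prems in auto)
  have "D (\<lambda>z. D G (x # z)) xs = D (cuts (\<lambda>c e. G (M (x # c) # e))) xs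
     \<oplus> flip (odd x) (D (D (\<lambda>z. G (x # z))) xs)"
    by (simp add: D_add) (subst D_additive, auto simp: flip_add)
  also have "\<dots> = cuts (\<lambda>c e. ?Z c e \<oplus> ?Y c e) xs"
    by (simp add: IH D_cuts)
  finally have 2: "flip (odd x) (D (\<lambda>z. D G (x # z)) xs) =
      cuts (\<lambda>c e. flip (odd x) (?Z c e \<oplus> ?Y c e)) xs"
    by (subst cuts_flip) auto
  have 1: "cuts (\<lambda>c e. D G (M (x # c) # e)) xs = cuts (\<lambda>c e. ?X c e \<oplus> flip (\<not> odd x) (?Y c e)) xs"
    by (rule cuts_cong) (auto simp: odd_M flip_flip)
  have "D (D G) (x # xs) = cuts (\<lambda>c e. ?X c e \<oplus> flip (\<not> odd x) (?Y c e)) xs \<oplus>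
      cuts (\<lambda>c e. flip (odd x) (?Z c e \<oplus> ?Y c e)) xs"
    using 1 2 by simp
  also have "\<dots> = cuts (\<lambda>c e. (?X c e \<oplus> flip (\<not> odd x) (?Y c e)) \<oplus> flip (odd x) (?Z c e \<oplus> ?Y c e)) xs"
    by (rule cuts_add[symmetric]) auto
  also have "\<dots> = cuts (\<lambda>c e. ?X c e \<oplus> flip (odd x) (?Z c e)) xs"
  proof (rule cuts_cong)
    fix c e
    have *: "(X \<oplus> flip (\<not> odd x) Y) \<oplus> flip (odd x) (Z \<oplus> Y) = X \<oplus> flip (odd x) Z"
      if "X \<in> carrier A" "Y \<in> carrier A" "Z \<in> carrier A" for X Y Z
      using that by (cases "odd x"; simp add: flip_def; algebra)
    show "(?X c e \<oplus> flip (\<not> odd x) (?Y c e)) \<oplus> flip (odd x) (?Z c e \<oplus> ?Y c e)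
       = ?X c e \<oplus> flip (odd x) (?Z c e)"
      by (rule *) auto
  qed
  also have "\<dots> = cuts ?X xs \<oplus> cuts (\<lambda>c e. flip (odd x) (?Z c e)) xs"
    by (rule cuts_add) auto
  also have "cuts ?X xs = cuts (\<lambda>b q. cuts (\<lambda>c u. G (M (M (x # c) # u) # q)) b) xs"
    by (rule cuts_coassoc) auto
  also have "\<dots> \<oplus> cuts (\<lambda>c e. flip (odd x) (?Z c e)) xs =
     cuts (\<lambda>b q. D (\<lambda>z. G (M z # q)) (x # b)) xs"
    by (subst cuts_add[symmetric]) auto
  also have "\<dots> = \<zero>"
  proof (rule cuts_zero)
    fix b q assume "b @ q = xs"
    then have "list_all hom (x # b)" "list_all hom q" using Cons.prems(3) by auto
    then show "D (\<lambda>z. G (M z # q)) (x # b) = \<zero>"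
      using Cons.prems(2)[unfolded relation_def, rule_format, of "[]" "x # b" q] by simp
  qed
  finally show ?case .
qed simp

end

section \<open>A contraction of multilinear functions on words\<close>

context kalgebra begin

lemma lin_flip: "lin U f \<Longrightarrow> lin U (\<lambda>x. flip b (f x))"
  by (cases b) (auto simp: flip_def lin_uminus)

lemma lin_cuts:
  "(\<And>a b. a @ b = xs \<Longrightarrow> lin U (\<lambda>x. f x a b)) \<Longrightarrow> lin U (\<lambda>x. cuts (f x) xs)"
proof (induction xs arbitrary: f)
  case (Cons y ys)
  have "lin U (\<lambda>x. f x [] (y # ys))" using Cons.prems by simp
  moreover have "lin U (\<lambda>x. cuts (\<lambda>us vs. f x (y # us) vs) ys)"
    by (rule Cons.IH) (simp add: Cons.prems)
  ultimately show ?case by (simp add: lin_add)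
qed simp

end

definition shifted_degree :: "(int \<times> 'b) list \<Rightarrow> int" where
  "shifted_degree w = total_degree w - int (length w)"

lemma shifted_degree_simps [simp]:
  "shifted_degree [] = 0" "shifted_degree (x # w) = fst x - 1 + shifted_degree w"
  "shifted_degree (u @ v) = shifted_degree u + shifted_degree v"
  by (auto simp: shifted_degree_def total_degree_def)

lemma output_degree_shifted: "output_degree p w = shifted_degree w + p"
  by (simp add: output_degree_def shifted_degree_def)

text \<open>
  \<open>(h, e)\<close> contracts the complex with differential \<open>\<mu>\<^sub>1\<close> onto its cohomology, which is concentrated in
  degree \<open>0\<close>, and \<open>p\<close> induces a multiplicative map from the cohomology to \<open>A\<close>.
\<close>
locale twisting = kalgebra K A
  for K :: "('k, 'r) ring_scheme" and A :: "('k, 'a) module" (structure) +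
  fixes V :: "int \<Rightarrow> ('k, 'b) module" and \<mu> :: "(int \<times> 'b) list \<Rightarrow> 'b"
    and h e :: "int \<Rightarrow> 'b \<Rightarrow> 'b" and p :: "'b \<Rightarrow> 'a"
  assumes module_V: "module K (V i)"
    and \<mu>_multilinear: "multilinear_family K V V 2 \<mu>"
    and h_linear: "linear_map K (V i) (V (i - 1)) (h i)"
    and e_linear: "linear_map K (V i) (V i) (e i)"
    and p_linear: "linear_map K (V 0) A p"
    and homotopy: "x \<in> carrier (V i) \<Longrightarrow>
      \<mu> [(i - 1, h i x)] \<oplus>\<^bsub>V i\<^esub> h (i + 1) (\<mu> [(i, x)]) \<oplus>\<^bsub>V i\<^esub> e i x = x"
    and d_e: "x \<in> carrier (V i) \<Longrightarrow> \<mu> [(i, e i x)] = \<zero>\<^bsub>V (i + 1)\<^esub>"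
    and e_d: "x \<in> carrier (V i) \<Longrightarrow> e (i + 1) (\<mu> [(i, x)]) = \<zero>\<^bsub>V (i + 1)\<^esub>"
    and e_zero: "i \<noteq> 0 \<Longrightarrow> x \<in> carrier (V i) \<Longrightarrow> e i x = \<zero>\<^bsub>V i\<^esub>"
    and p_d: "x \<in> carrier (V (- 1)) \<Longrightarrow> p (\<mu> [(- 1, x)]) = \<zero>"
    and p_mult: "x \<in> carrier (V 0) \<Longrightarrow> y \<in> carrier (V 0) \<Longrightarrow>
      p (\<mu> [(0, e 0 x), (0, e 0 y)]) = p (e 0 x) \<otimes> p (e 0 y)"
begin

definition M :: "(int \<times> 'b) list \<Rightarrow> int \<times> 'b" where
  "M c = (output_degree 2 c, \<mu> c)"

definition odd_letter :: "int \<times> 'b \<Rightarrow> bool" where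
  "odd_letter x = even (fst x)"

definition hom :: "int \<times> 'b \<Rightarrow> bool" where
  "hom x = (snd x \<in> carrier (V (fst x)))"

sublocale word_algebra K A M odd_letter ..

lemma odd_letter_pair [simp]: "odd_letter (i, x) \<longleftrightarrow> even i"
  by (simp add: odd_letter_def)

lemma hom_pair [simp]: "hom (i, x) \<longleftrightarrow> x \<in> carrier (V i)"
  by (simp add: hom_def)

lemma homogeneous_iff: "homogeneous V w \<longleftrightarrow> list_all hom w"
  by (auto simp: homogeneous_def list_all_iff)

lemma shifted_degree_M [simp]: "fst (M c) = shifted_degree c + 2"
  by (simp add: M_def output_degree_shifted)

lemma \<mu>_linear:
  "list_all hom us \<Longrightarrow> list_all hom vs \<Longrightarrow>
    linear_map K (V i) (V (output_degree 2 (us @ (i, y) # vs))) (\<lambda>x. \<mu> (us @ (i, x) # vs))"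
  using \<mu>_multilinear[unfolded multilinear_family_def homogeneous_iff, rule_format, of us vs i]
  by (simp add: output_degree_shifted add_ac diff_add_eq)

text \<open>The degree of a letter, shifted by one, is odd if and only if the degree is even.\<close>
lemma par_iff: "par c \<longleftrightarrow> odd (shifted_degree c)"
proof (induction c)
  case (Cons x c) then show ?case by (cases x) auto
qed simp

lemma hom_M: "c \<noteq> [] \<Longrightarrow> list_all hom c \<Longrightarrow> hom (M c)"
proof (cases c)
  case (Cons x vs)
  assume "list_all hom c"
  then show ?thesis using linear_map_closed[OF \<mu>_linear[of "[]" vs "fst x" "snd x"], of "snd x"]
    by (auto simp: M_def Cons hom_def)
qed simp

sublocale A_infinity_words K A M odd_letter hom
proof unfold_locales
  show "odd_letter (M c) = (\<not> par c)" for c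
    unfolding M_def odd_letter_pair par_iff output_degree_shifted by simp
qed (rule hom_M)

definition multilinear :: "((int \<times> 'b) list \<Rightarrow> 'a) \<Rightarrow> bool" where
  "multilinear G \<longleftrightarrow> (\<forall>us i vs. list_all hom us \<and> list_all hom vs \<longrightarrow> lin (V i) (\<lambda>x. G (us @ (i, x) # vs)))"

lemma multilinearD: "multilinear G \<Longrightarrow> list_all hom us \<Longrightarrow> list_all hom vs \<Longrightarrow>
    lin (V i) (\<lambda>x. G (us @ (i, x) # vs))"
  by (simp add: multilinear_def)

lemma multilinear_Cons: "multilinear G \<Longrightarrow> hom x \<Longrightarrow> multilinear (\<lambda>z. G (x # z))"
  unfolding multilinear_def
proof (intro allI impI)
  fix us i vs
  assume "\<forall>us i vs. list_all hom us \<and> list_all hom vs \<longrightarrow> lin (V i) (\<lambda>x. G (us @ (i, x) # vs))"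
    "hom x" "list_all hom us \<and> list_all hom vs"
  from this(1)[rule_format, of "x # us" vs i] this(2,3)
  show "lin (V i) (\<lambda>xa. G (x # us @ (i, xa) # vs))" by simp
qed

lemma abelian_V: "abelian_group (V i)"
  using module_V module.axioms by blast

lemma multilinear_zero:
  assumes "multilinear G" "list_all hom us" "list_all hom vs"
  shows "G (us @ (i, \<zero>\<^bsub>V i\<^esub>) # vs) = \<zero>"
  using linear_map_zero[OF multilinearD[OF assms] abelian_V is_abelian_group] .

definition h_letter :: "int \<times> 'b \<Rightarrow> int \<times> 'b" where "h_letter x = (fst x - 1, h (fst x) (snd x))"
definition e_letter :: "int \<times> 'b \<Rightarrow> int \<times> 'b" where "e_letter x = (fst x, e (fst x) (snd x))"

lemma hom_h_letter [simp]: "hom x \<Longrightarrow> hom (h_letter x)"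
  using linear_map_closed[OF h_linear] by (auto simp: hom_def h_letter_def)

lemma hom_e_letter [simp]: "hom x \<Longrightarrow> hom (e_letter x)"
  using linear_map_closed[OF e_linear] by (auto simp: hom_def e_letter_def)

lemma hom_map_e_letter [simp]: "list_all hom w \<Longrightarrow> list_all hom (map e_letter w)"
  by (induction w) auto

text \<open>The part of \<open>D\<close> that preserves the length of words: only single letters are multiplied out.\<close>
primrec single :: "((int \<times> 'b) list \<Rightarrow> 'a) \<Rightarrow> (int \<times> 'b) list \<Rightarrow> 'a" where
  "single G [] = \<zero>"
| "single G (x # xs) = G (M [x] # xs) \<oplus> flip (odd_letter x) (single (\<lambda>z. G (x # z)) xs)"

text \<open>
  Composition with the homotopy \<open>\<Sum> 1\<^bsup>\<otimes> r\<^esup> \<otimes> h \<otimes> e\<^bsup>\<otimes> s\<^esup>\<close> on tensor powers, which contracts them onto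
  the tensor powers of the image of \<open>e\<close>.
\<close>
primrec contract :: "((int \<times> 'b) list \<Rightarrow> 'a) \<Rightarrow> (int \<times> 'b) list \<Rightarrow> 'a" where
  "contract G [] = \<zero>"
| "contract G (x # xs) = G (h_letter x # map e_letter xs) \<oplus> flip (odd_letter x) (contract (\<lambda>z. G (x # z)) xs)"

lemma single_closed [simp, intro]: "(\<And>w. G w \<in> carrier A) \<Longrightarrow> single G xs \<in> carrier A"
  by (induction xs arbitrary: G) auto

lemma contract_closed [simp, intro]: "(\<And>w. G w \<in> carrier A) \<Longrightarrow> contract G xs \<in> carrier A"
  by (induction xs arbitrary: G) auto

lemma single_zero:
  "(\<And>us x vs. us @ x # vs = xs \<Longrightarrow> G (us @ M [x] # vs) = \<zero>) \<Longrightarrow> single G xs = \<zero>"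
proof (induction xs arbitrary: G)
  case (Cons x xs)
  have "single (\<lambda>z. G (x # z)) xs = \<zero>"
  proof (rule Cons.IH)
    fix us y vs assume "us @ y # vs = xs"
    then show "G (x # us @ M [y] # vs) = \<zero>" using Cons.prems[of "x # us"] by simp
  qed
  then show ?case using Cons.prems[of "[]"] by simp
qed simp

lemma contract_zero:
  "(\<And>us x vs. us @ x # vs = xs \<Longrightarrow> G (us @ h_letter x # map e_letter vs) = \<zero>) \<Longrightarrow> contract G xs = \<zero>"
proof (induction xs arbitrary: G)
  case (Cons x xs)
  have "contract (\<lambda>z. G (x # z)) xs = \<zero>"
  proof (rule Cons.IH)
    fix us y vs assume "us @ y # vs = xs"
    then show "G (x # us @ h_letter y # map e_letter vs) = \<zero>" using Cons.prems[of "x # us"] by simp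
  qed
  then show ?case using Cons.prems[of "[]"] by simp
qed simp

lemma single_cong:
  "(\<And>us x vs. us @ x # vs = xs \<Longrightarrow> G (us @ M [x] # vs) = G' (us @ M [x] # vs)) \<Longrightarrow> single G xs = single G' xs"
proof (induction xs arbitrary: G G')
  case (Cons x xs)
  have "single (\<lambda>z. G (x # z)) xs = single (\<lambda>z. G' (x # z)) xs"
  proof (rule Cons.IH)
    fix us y vs assume "us @ y # vs = xs"
    then show "G (x # us @ M [y] # vs) = G' (x # us @ M [y] # vs)" using Cons.prems[of "x # us"] by simp
  qed
  then show ?case using Cons.prems[of "[]"] by simp
qed simp

lemma single_add:
  assumes "\<And>w. G w \<in> carrier A" "\<And>w. H w \<in> carrier A"
  shows "single (\<lambda>w. G w \<oplus> H w) xs = single G xs \<oplus> single H xs"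
  using assms
proof (induction xs arbitrary: G H)
  case (Cons x xs)
  have "single (\<lambda>z. G (x # z) \<oplus> H (x # z)) xs = single (\<lambda>z. G (x # z)) xs \<oplus> single (\<lambda>z. H (x # z)) xs"
    by (rule Cons.IH) (auto simp: Cons.prems)
  then show ?case using Cons.prems by (simp add: flip_add add_exchange)
qed simp

lemma contract_add:
  assumes "\<And>w. G w \<in> carrier A" "\<And>w. H w \<in> carrier A"
  shows "contract (\<lambda>w. G w \<oplus> H w) xs = contract G xs \<oplus> contract H xs"
  using assms
proof (induction xs arbitrary: G H)
  case (Cons x xs)
  have "contract (\<lambda>z. G (x # z) \<oplus> H (x # z)) xs = contract (\<lambda>z. G (x # z)) xs \<oplus> contract (\<lambda>z. H (x # z)) xs"
    by (rule Cons.IH) (auto simp: Cons.prems)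
  then show ?case using Cons.prems by (simp add: flip_add add_exchange)
qed simp

lemma single_flip:
  assumes "\<And>w. G w \<in> carrier A"
  shows "single (\<lambda>w. flip b (G w)) xs = flip b (single G xs)"
  using assms
proof (induction xs arbitrary: G)
  case (Cons x xs)
  have "single (\<lambda>z. flip b (G (x # z))) xs = flip b (single (\<lambda>z. G (x # z)) xs)"
    by (rule Cons.IH) (auto simp: Cons.prems)
  moreover have "(odd_letter x \<noteq> b) = (b \<noteq> odd_letter x)" by auto
  ultimately show ?case using Cons.prems by (simp add: flip_add flip_flip)
qed simp

lemma contract_flip:
  assumes "\<And>w. G w \<in> carrier A"
  shows "contract (\<lambda>w. flip b (G w)) xs = flip b (contract G xs)"
  using assms
proof (induction xs arbitrary: G)
  case (Cons x xs)
  have "contract (\<lambda>z. flip b (G (x # z))) xs = flip b (contract (\<lambda>z. G (x # z)) xs)"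
    by (rule Cons.IH) (auto simp: Cons.prems)
  moreover have "(odd_letter x \<noteq> b) = (b \<noteq> odd_letter x)" by auto
  ultimately show ?case using Cons.prems by (simp add: flip_add flip_flip)
qed simp

lemma M_single: "M [(i, x)] = (i + 1, \<mu> [(i, x)])"
  by (simp add: M_def output_degree_shifted)

text \<open>
  The tensor power of the contraction \<open>1 - e = d h + h d\<close>. The terms in which \<open>d\<close> meets a letter
  \<open>e x\<close> vanish, as \<open>d e = 0\<close> and \<open>e d = 0\<close>.
\<close>
lemma homotopy_formula:
  assumes "\<And>w. G w \<in> carrier A" "multilinear G" "list_all hom xs"
  shows "contract (single G) xs \<oplus> single (contract G) xs = G xs \<ominus> G (map e_letter xs)"
  using assms
proof (induction xs arbitrary: G)
  case Nil then show ?case by (simp add: r_neg a_minus_def)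
next
  case (Cons x xs)
  note [simp, intro] = Cons.prems(1)
  obtain i y where x: "x = (i, y)" by (cases x)
  have y: "y \<in> carrier (V i)" and xs: "list_all hom xs" and hx: "hom x" using Cons.prems x by auto
  note mx = multilinear_Cons[OF Cons.prems(2)]
  let ?s = "flip (odd_letter x)"
  have hhx: "hom (h_letter x)" and hdx: "hom (M [x])" using hx hom_M[of "[x]"] by auto
  have 1: "single (\<lambda>z. G (h_letter x # z)) (map e_letter xs) = \<zero>"
  proof (rule single_zero)
    fix us z vs assume eq: "us @ z # vs = map e_letter xs"
    then obtain z' where z': "z = e_letter z'" "z' \<in> set xs"
      by (metis in_set_conv_decomp list.set_map imageE)
    then have "snd z' \<in> carrier (V (fst z'))" using xs by (auto simp: list_all_iff hom_def)
    then have "M [z] = (fst z' + 1, \<zero>\<^bsub>V (fst z' + 1)\<^esub>)"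
      using z' by (simp add: e_letter_def M_single d_e)
    moreover have "list_all hom (us @ z # vs)" using eq xs by simp
    ultimately show "G (h_letter x # us @ M [z] # vs) = \<zero>"
      using multilinear_zero[OF mx[OF hhx], of us vs] by simp
  qed
  have 2: "single (\<lambda>z. G (h_letter x # map e_letter z)) xs = \<zero>"
  proof (rule single_zero)
    fix us z vs assume eq: "us @ z # vs = xs"
    then have z: "hom z" "list_all hom us" "list_all hom vs" using xs by auto
    then have "e_letter (M [z]) = (fst z + 1, \<zero>\<^bsub>V (fst z + 1)\<^esub>)"
      using e_d[of "snd z" "fst z"] by (cases z) (simp add: e_letter_def M_single)
    then show "G (h_letter x # map e_letter (us @ M [z] # vs)) = \<zero>"
      using multilinear_zero[OF mx[OF hhx], of "map e_letter us" "map e_letter vs"] z by simp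
  qed
  have A1: "contract (single G) (x # xs) = G (M [h_letter x] # map e_letter xs)
      \<oplus> ?s (contract (\<lambda>z. G (M [x] # z)) xs) \<oplus> contract (single (\<lambda>z. G (x # z))) xs"
    using 1 by (simp add: contract_add flip_add contract_flip flip_flip a_assoc)
  have A2: "single (contract G) (x # xs) = G (h_letter (M [x]) # map e_letter xs) \<oplus> flip (odd_letter (M [x])) (contract (\<lambda>z. G (M [x] # z)) xs)
      \<oplus> single (contract (\<lambda>z. G (x # z))) xs"
    using 2 by (simp add: single_add flip_add single_flip flip_flip)
  have s: "odd_letter (M [x]) = (\<not> odd_letter x)"
    using odd_M[of "[x]"] by simp
  have IH: "contract (single (\<lambda>z. G (x # z))) xs \<oplus> single (contract (\<lambda>z. G (x # z))) xs = G (x # xs) \<ominus> G (x # map e_letter xs)"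
    by (rule Cons.IH) (use mx hx xs in auto)
  let ?f = "\<lambda>w. G ((i, w) # map e_letter xs)"
  have lf: "lin (V i) ?f" using multilinearD[OF Cons.prems(2), of "[]" "map e_letter xs"] xs by simp
  interpret Vi: abelian_group "V i" by (rule abelian_V)
  have c1: "\<mu> [(i - 1, h i y)] \<in> carrier (V i)" using hom_M[of "[h_letter x]"] hhx x
    by (simp add: h_letter_def M_single)
  have c2: "h (i + 1) (\<mu> [(i, y)]) \<in> carrier (V i)"
    using hom_h_letter[OF hdx] x by (simp add: h_letter_def M_single)
  have c3: "e i y \<in> carrier (V i)" using hom_e_letter[OF hx] x by (simp add: e_letter_def)
  have "G (x # map e_letter xs) = ?f (\<mu> [(i - 1, h i y)] \<oplus>\<^bsub>V i\<^esub> h (i + 1) (\<mu> [(i, y)]) \<oplus>\<^bsub>V i\<^esub> e i y)"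
    using homotopy[OF y] x by simp
  also have "\<dots> = G (M [h_letter x] # map e_letter xs) \<oplus> G (h_letter (M [x]) # map e_letter xs) \<oplus> G (map e_letter (x # xs))"
    using c1 c2 c3 by (simp add: linear_map_add[OF lf] x h_letter_def e_letter_def M_single)
  finally have f: "G (x # map e_letter xs) = G (M [h_letter x] # map e_letter xs) \<oplus> G (h_letter (M [x]) # map e_letter xs) \<oplus> G (map e_letter (x # xs))" .
  have *: "(a \<oplus> flip b u \<oplus> v) \<oplus> (c \<oplus> flip (\<not> b) u \<oplus> v') = g \<ominus> l"
    if "v \<oplus> v' = g \<ominus> k" "k = a \<oplus> c \<oplus> l" "a \<in> carrier A" "u \<in> carrier A" "v \<in> carrier A" "v' \<in> carrier A"
      "c \<in> carrier A" "l \<in> carrier A" "g \<in> carrier A" for a b u v c v' k l g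
  proof -
    have "(a \<oplus> flip b u \<oplus> v) \<oplus> (c \<oplus> flip (\<not> b) u \<oplus> v') = a \<oplus> c \<oplus> (v \<oplus> v')"
      using that(3-) by (cases b; simp add: flip_def; algebra)
    also have "\<dots> = g \<ominus> l" unfolding that(1,2) using that(3-) by algebra
    finally show ?thesis .
  qed
  show ?case unfolding A1 A2 s by (rule *[OF IH f]) auto
qed

end

section \<open>The twisting cochain\<close>

context kalgebra begin

lemma cuts_finsum:
  assumes "\<And>a b. f a b \<in> carrier A"
  shows "cuts f xs = (\<Oplus>k\<in>{..length xs}. f (take k xs) (drop k xs))"
  using assms
proof (induction xs arbitrary: f)
  case Nil then show ?case by (simp add: finsum_0)
next
  case (Cons x xs)
  have "(\<Oplus>k\<in>{..length (x # xs)}. f (take k (x # xs)) (drop k (x # xs))) =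
     (\<Oplus>k\<in>{..length xs}. f (x # take k xs) (drop k xs)) \<oplus> f [] (x # xs)"
    using Cons.prems by (simp add: finsum_Suc2 del: finsum_Suc)
  also have "(\<Oplus>k\<in>{..length xs}. f (x # take k xs) (drop k xs)) = cuts (\<lambda>a. f (x # a)) xs"
    by (rule Cons.IH[symmetric]) (rule Cons.prems)
  finally show ?case using Cons.prems by (simp add: a_comm)
qed

end

context word_algebra begin

lemma D_finsum:
  assumes "\<And>w. G w \<in> carrier A"
  shows "D G xs = (\<Oplus>q\<in>{(r, s). 1 \<le> s \<and> r + s \<le> length xs}. case q of (r, s) \<Rightarrow>
      flip (par (take r xs)) (G (take r xs @ M (take s (drop r xs)) # drop (r + s) xs)))"
  using assms
proof (induction xs arbitrary: G)
  case Nil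
  have S: "{(r, s). 1 \<le> s \<and> r + s \<le> length []} = {}" by auto
  show ?case unfolding S by simp
next
  case (Cons x xs)
  note [simp, intro] = Cons.prems
  let ?n = "length xs"
  define S where "S = (\<lambda>n. {(r, s). 1 \<le> s \<and> r + s \<le> n} :: (nat \<times> nat) set)"
  define g where "g = (\<lambda>(r, s). flip (par (take r (x # xs)))
      (G (take r (x # xs) @ M (take s (drop r (x # xs))) # drop (r + s) (x # xs))))"
  have fin: "finite (S n)" for n
    by (rule finite_subset[of _ "{..n} \<times> {..n}"]) (auto simp: S_def)
  have split: "S (Suc ?n) = (\<lambda>k. (0, Suc k)) ` {..?n} \<union> (\<lambda>(r, s). (Suc r, s)) ` S ?n" (is "?l = ?r")
  proof
    show "?l \<subseteq> ?r"
    proof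
      fix q assume "q \<in> ?l"
      then obtain r s where q: "q = (r, s)" "1 \<le> s" "r + s \<le> Suc ?n" by (auto simp: S_def)
      show "q \<in> ?r"
      proof (cases r)
        case 0
        then have "q = (\<lambda>k. (0, Suc k)) (s - 1)" "s - 1 \<in> {..?n}" using q by auto
        then show ?thesis by blast
      next
        case (Suc r')
        then have "q = (\<lambda>(r, s). (Suc r, s)) (r', s)" "(r', s) \<in> S ?n" using q by (auto simp: S_def)
        then show ?thesis by blast
      qed
    qed
    show "?r \<subseteq> ?l" by (auto simp: S_def)
  qed
  have gc: "g q \<in> carrier A" for q by (cases q) (simp add: g_def)
  have "(\<Oplus>q\<in>S (Suc ?n). g q) = (\<Oplus>q\<in>(\<lambda>k. (0, Suc k)) ` {..?n}. g q) \<oplus>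
      (\<Oplus>q\<in>(\<lambda>(r, s). (Suc r, s)) ` S ?n. g q)"
    unfolding split by (rule finsum_Un_disjoint) (auto simp: fin gc)
  also have "(\<Oplus>q\<in>(\<lambda>k. (0, Suc k)) ` {..?n}. g q) = (\<Oplus>k\<in>{..?n}. g (0, Suc k))"
    by (rule finsum_reindex) (auto simp: gc inj_on_def)
  also have "\<dots> = cuts (\<lambda>c e. G (M (x # c) # e)) xs"
    by (subst cuts_finsum) (auto simp: g_def)
  also have "(\<Oplus>q\<in>(\<lambda>(r, s). (Suc r, s)) ` S ?n. g q) = (\<Oplus>q\<in>S ?n. g (case q of (r, s) \<Rightarrow> (Suc r, s)))"
    by (rule finsum_reindex) (auto simp: gc inj_on_def)
  also have "\<dots> = (\<Oplus>q\<in>S ?n. flip (odd x) (case q of (r, s) \<Rightarrow> flip (par (take r xs))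
      (G (x # take r xs @ M (take s (drop r xs)) # drop (r + s) xs))))"
    by (rule finsum_cong') (auto simp: g_def flip_flip split: prod.splits)
  also have "\<dots> = flip (odd x) (\<Oplus>q\<in>S ?n. (case q of (r, s) \<Rightarrow> flip (par (take r xs))
      (G (x # take r xs @ M (take s (drop r xs)) # drop (r + s) xs))))"
    by (rule additive_finsum[OF A.is_abelian_group A.is_abelian_group, symmetric])
      (auto simp: flip_add split: prod.splits)
  also have "\<dots> = flip (odd x) (D (\<lambda>z. G (x # z)) xs)"
    using Cons.IH[of "\<lambda>z. G (x # z)"] by (simp add: S_def)
  finally show ?case by (simp add: S_def g_def)
qed

end

context twisting begin

lemma lin_M:
  assumes "multilinear G" "list_all hom us" "list_all hom vs" "list_all hom as" "list_all hom bs"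
  shows "lin (V i) (\<lambda>x. G (us @ M (as @ (i, x) # bs) # vs))"
proof -
  let ?j = "output_degree 2 (as @ (i, undefined) # bs)"
  have "linear_map K (V i) (V ?j) (\<lambda>x. \<mu> (as @ (i, x) # bs))"
    by (rule \<mu>_linear) (use assms in auto)
  from linear_map_comp[OF this multilinearD[OF assms(1-3)]]
  show ?thesis by (simp add: M_def output_degree_shifted)
qed

lemma lin_D:
  assumes "list_all hom w" "\<And>z. list_all hom z \<Longrightarrow> lin U (\<lambda>x. G x z)"
  shows "lin U (\<lambda>x. D (G x) w)"
  using assms
proof (induction w arbitrary: G)
  case Nil show ?case by (simp add: lin_zero)
next
  case (Cons y w)
  have "lin U (\<lambda>x. cuts (\<lambda>c e. G x (M (y # c) # e)) w)"
    by (rule lin_cuts, rule Cons.prems(2)) (use Cons.prems(1) in \<open>auto simp: hom_M\<close>)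
  moreover have "lin U (\<lambda>x. D (\<lambda>z. G x (y # z)) w)"
    by (rule Cons.IH) (use Cons.prems in auto)
  ultimately show ?case by (simp add: lin_add lin_flip)
qed

lemma lin_contract:
  assumes "list_all hom w" "\<And>z. list_all hom z \<Longrightarrow> lin U (\<lambda>x. G x z)"
  shows "lin U (\<lambda>x. contract (G x) w)"
  using assms
proof (induction w arbitrary: G)
  case Nil show ?case by (simp add: lin_zero)
next
  case (Cons y w)
  have "lin U (\<lambda>x. G x (h_letter y # map e_letter w))"
    by (rule Cons.prems(2)) (use Cons.prems(1) in auto)
  moreover have "lin U (\<lambda>x. contract (\<lambda>z. G x (y # z)) w)"
    by (rule Cons.IH) (use Cons.prems in auto)
  ultimately show ?case by (simp add: lin_add lin_flip)
qed

lemma multilinear_D: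
  assumes "\<And>w. G w \<in> carrier A" "multilinear G"
  shows "multilinear (D G)"
proof -
  have "lin (V i) (\<lambda>x. D G (us @ (i, x) # vs))"
    if "list_all hom us" "list_all hom vs" for us i vs
    using that assms
  proof (induction us arbitrary: G)
    case Nil
    have "lin (V i) (\<lambda>x. cuts (\<lambda>c e. G (M ((i, x) # c) # e)) vs)"
    proof (rule lin_cuts)
      fix a b assume "a @ b = vs"
      then show "lin (V i) (\<lambda>x. G (M ((i, x) # a) # b))"
        using lin_M[of G "[]" b "[]" a i] Nil by auto
    qed
    moreover have "lin (V i) (\<lambda>x. D (\<lambda>z. G ((i, x) # z)) vs)"
      by (rule lin_D) (use Nil multilinearD[of G "[]"] in auto)
    ultimately show ?case by (simp add: lin_add lin_flip)
  next
    case (Cons u us)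
    note [simp, intro] = Cons.prems(3)
    have "lin (V i) (\<lambda>x. cuts (\<lambda>a b. G (M (u # a) # b @ (i, x) # vs)) us \<oplus>
       cuts (\<lambda>a b. G (M (u # us @ (i, x) # a) # b)) vs)"
    proof (intro lin_add lin_cuts)
      fix a b assume "a @ b = us"
      then have "list_all hom (M (u # a) # b)" using Cons.prems(1) by (auto simp: hom_M)
      then show "lin (V i) (\<lambda>x. G (M (u # a) # b @ (i, x) # vs))"
        using multilinearD[OF Cons.prems(4) _ Cons.prems(2)] by fastforce
    next
      fix a b assume "a @ b = vs"
      then show "lin (V i) (\<lambda>x. G (M (u # us @ (i, x) # a) # b))"
        using lin_M[of G "[]" b "u # us" a i] Cons.prems by auto
    qed
    moreover have "lin (V i) (\<lambda>x. D (\<lambda>z. G (u # z)) (us @ (i, x) # vs))"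
      by (rule Cons.IH) (use Cons.prems multilinear_Cons in auto)
    ultimately show ?case by (simp add: lin_add lin_flip cuts_append_Cons)
  qed
  then show ?thesis by (simp add: multilinear_def)
qed

lemma multilinear_contract:
  assumes "\<And>w. G w \<in> carrier A" "multilinear G"
  shows "multilinear (contract G)"
proof -
  have "lin (V i) (\<lambda>x. contract G (us @ (i, x) # vs))"
    if "list_all hom us" "list_all hom vs" for us i vs
    using that assms
  proof (induction us arbitrary: G)
    case Nil
    have "lin (V i) (\<lambda>x. G (h_letter (i, x) # map e_letter vs))"
      using linear_map_comp[OF h_linear[of i] multilinearD[of G "[]" "map e_letter vs" "i - 1"]] Nil
      by (simp add: h_letter_def)
    moreover have "lin (V i) (\<lambda>x. contract (\<lambda>z. G ((i, x) # z)) vs)"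
      by (rule lin_contract) (use Nil multilinearD[of G "[]"] in auto)
    ultimately show ?case by (simp add: lin_add lin_flip)
  next
    case (Cons u us)
    have "list_all hom (h_letter u # map e_letter us)" "list_all hom (map e_letter vs)" using Cons.prems by auto
    from linear_map_comp[OF e_linear[of i] multilinearD[OF Cons.prems(4) this]]
    have "lin (V i) (\<lambda>x. G (h_letter u # map e_letter (us @ (i, x) # vs)))"
      by (simp add: e_letter_def)
    moreover have "lin (V i) (\<lambda>x. contract (\<lambda>z. G (u # z)) (us @ (i, x) # vs))"
      by (rule Cons.IH) (use Cons.prems multilinear_Cons in auto)
    ultimately show ?case by (simp add: lin_add lin_flip)
  qed
  then show ?thesis by (simp add: multilinear_def)
qed

lemma multilinear_cup:
  assumes [simp, intro]: "\<And>w. G w \<in> carrier A" "\<And>w. H w \<in> carrier A"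
    and "multilinear G" "multilinear H"
  shows "multilinear (cup G H)"
proof -
  have "lin (V i) (\<lambda>x. cup G H (us @ (i, x) # vs))"
    if "list_all hom us" "list_all hom vs" for us i vs
  proof -
    have "lin (V i) (\<lambda>x. cuts (\<lambda>a b. G a \<otimes> H (b @ (i, x) # vs)) us \<oplus>
       cuts (\<lambda>a b. G (us @ (i, x) # a) \<otimes> H b) vs)"
      by (intro lin_add lin_cuts lin_mult_right lin_mult_left multilinearD assms) (use that in auto)
    then show ?thesis by (simp add: cup_def cuts_append_Cons)
  qed
  then show ?thesis by (simp add: multilinear_def)
qed

lemma multilinear_add: "multilinear G \<Longrightarrow> multilinear H \<Longrightarrow> multilinear (\<lambda>w. G w \<oplus> H w)"
  by (simp add: multilinear_def lin_add)

lemma multilinear_minus: "multilinear G \<Longrightarrow> multilinear H \<Longrightarrow> multilinear (\<lambda>w. G w \<ominus> H w)"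
  by (simp add: multilinear_def lin_add lin_uminus a_minus_def)

end

text \<open>
  With the signs of the bar construction, the sign of an insertion only depends on the letters to its
  left.
\<close>
locale A_infinity_twisting = twisting K A V \<mu> h e p
  for K :: "('k, 'r) ring_scheme" and A :: "('k, 'a) module" (structure)
    and V :: "int \<Rightarrow> ('k, 'b) module" and \<mu> h e p +
  assumes A_infinity_relation: "list_all hom w \<Longrightarrow> w \<noteq> [] \<Longrightarrow>
    (\<Oplus>\<^bsub>V (shifted_degree w + 3)\<^esub>q\<in>{(r, s). 1 \<le> s \<and> r + s \<le> length w}. case q of (r, s) \<Rightarrow>
      signed (V (shifted_degree w + 3)) (shifted_degree (take r w))
        (\<mu> (take r w @ M (take s (drop r w)) # drop (r + s) w)))
      = \<zero>\<^bsub>V (shifted_degree w + 3)\<^esub>"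
begin

text \<open>In each slot, \<open>G\<close> is linear and so preserves the sum in the A-infinity relation.\<close>
lemma multilinear_imp_relation:
  assumes [simp, intro]: "\<And>w. G w \<in> carrier A" and ml: "multilinear G"
  shows "relation G"
  unfolding relation_def
proof (intro allI impI, elim conjE)
  fix us w vs assume hom: "list_all hom us" "list_all hom w" "list_all hom vs" and "w \<noteq> []"
  let ?k = "shifted_degree w + 3"
  let ?S = "{(r, s). 1 \<le> s \<and> r + s \<le> length w}"
  let ?z = "\<lambda>r s. take r w @ M (take s (drop r w)) # drop (r + s) w"
  let ?g = "\<lambda>y. G (us @ (?k, y) # vs)"
  have lg: "lin (V ?k) ?g" by (rule multilinearD) (use ml hom in auto)
  have w_split: "w = take r w @ take s (drop r w) @ drop (r + s) w" for r s
    by (metis append_take_drop_id drop_drop add.commute)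
  have deg: "M (?z r s) = (?k, \<mu> (?z r s))" and mem: "\<mu> (?z r s) \<in> carrier (V ?k)"
    if "(r, s) \<in> ?S" for r s
  proof -
    have "shifted_degree w = shifted_degree (take r w) + shifted_degree (take s (drop r w))
        + shifted_degree (drop (r + s) w)"
      by (subst w_split[of r s]) (simp only: shifted_degree_simps)
    then show 1: "M (?z r s) = (?k, \<mu> (?z r s))" by (simp add: M_def output_degree_shifted)
    have "list_all hom (take r w @ take s (drop r w) @ drop (r + s) w)" "take s (drop r w) \<noteq> []"
      using hom(2) that by (auto simp flip: w_split)
    then have "hom (M (?z r s))" by (intro hom_M) (auto intro!: hom_M)
    then show "\<mu> (?z r s) \<in> carrier (V ?k)" unfolding 1 by simp
  qed
  have "D (\<lambda>z. G (us @ M z # vs)) w = (\<Oplus>q\<in>?S. case q of (r, s) \<Rightarrow>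
      flip (par (take r w)) (G (us @ M (?z r s) # vs)))"
    by (rule D_finsum) simp
  also have "\<dots> = (\<Oplus>q\<in>?S. ?g (case q of (r, s) \<Rightarrow>
      signed (V ?k) (shifted_degree (take r w)) (\<mu> (?z r s))))"
  proof (rule finsum_cong')
    fix q assume q: "q \<in> ?S"
    obtain r s where rs: "q = (r, s)" by (cases q)
    have "G (us @ M (?z r s) # vs) = ?g (\<mu> (?z r s))" using deg q rs by simp
    then show "(case q of (r, s) \<Rightarrow> flip (par (take r w)) (G (us @ M (?z r s) # vs))) =
       ?g (case q of (r, s) \<Rightarrow> signed (V ?k) (shifted_degree (take r w)) (\<mu> (?z r s)))"
      using linear_map_minus[OF lg abelian_V is_abelian_group mem] q rs
      by (simp add: par_iff signed_def flip_def)
  qed auto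
  also have "\<dots> = ?g (\<Oplus>\<^bsub>V ?k\<^esub>q\<in>?S. case q of (r, s) \<Rightarrow>
      signed (V ?k) (shifted_degree (take r w)) (\<mu> (?z r s)))"
  proof (rule linear_map_finsum[OF lg abelian_V is_abelian_group, symmetric])
    show "(\<lambda>q. case q of (r, s) \<Rightarrow> signed (V ?k) (shifted_degree (take r w)) (\<mu> (?z r s)))
       \<in> ?S \<rightarrow> carrier (V ?k)"
      using mem abelian_group.a_inv_closed[OF abelian_V] by (auto simp: signed_def)
  qed
  also have "\<dots> = ?g \<zero>\<^bsub>V ?k\<^esub>"
    by (simp only: A_infinity_relation[OF hom(2) \<open>w \<noteq> []\<close>])
  also have "\<dots> = \<zero>" by (rule multilinear_zero) (use ml hom in auto)
  finally show "D (\<lambda>z. G (us @ M z # vs)) w = \<zero>" .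
qed

definition base :: "(int \<times> 'b) list \<Rightarrow> 'a" where
  "base w = (if \<exists>x\<in>carrier (V 0). w = [(0, x)] then p (snd (hd w)) else \<zero>)"

text \<open>
  \<open>T n\<close> is the twisting cochain on words of length at most \<open>n\<close>, and zero on longer words. Because of
  the zero, \<open>D (T n)\<close> has no contribution of single letters on words of length \<open>n + 1\<close>, and the defect
  \<open>U n\<close> below is exactly what the component of length \<open>n + 1\<close> has to compensate.
\<close>
primrec T :: "nat \<Rightarrow> (int \<times> 'b) list \<Rightarrow> 'a" where
  "T 0 = (\<lambda>w. \<zero>)"
| "T (Suc n) = (\<lambda>w. T n w \<oplus> (if length w = Suc n then
      (if n = 0 then base w else contract (\<lambda>z. cup (T n) (T n) z \<ominus> D (T n) z) w) else \<zero>))"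

definition U :: "nat \<Rightarrow> (int \<times> 'b) list \<Rightarrow> 'a" where
  "U n z = cup (T n) (T n) z \<ominus> D (T n) z"

lemma T_Suc: "T (Suc n) w = T n w \<oplus> (if length w = Suc n then (if n = 0 then base w else contract (U n) w) else \<zero>)"
  by (simp add: U_def[abs_def])

lemma base_closed [simp, intro]: "base w \<in> carrier A"
  using linear_map_closed[OF p_linear] by (auto simp: base_def)

lemma T_closed [simp, intro]: "T n w \<in> carrier A"
  by (induction n arbitrary: w) auto

lemma U_closed [simp, intro]: "U n w \<in> carrier A"
  by (auto simp: U_def)

lemma multilinear_zero_fun: "multilinear (\<lambda>w. \<zero>)"
  by (simp add: multilinear_def lin_zero)

lemma multilinear_length: "multilinear G \<Longrightarrow> multilinear (\<lambda>w. if length w = n then G w else \<zero>)"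
  unfolding multilinear_def
proof (intro allI impI)
  fix us i vs
  assume "\<forall>us i vs. list_all hom us \<and> list_all hom vs \<longrightarrow> lin (V i) (\<lambda>x. G (us @ (i, x) # vs))"
    "list_all hom us \<and> list_all hom vs"
  then show "lin (V i) (\<lambda>x. if length (us @ (i, x) # vs) = n then G (us @ (i, x) # vs) else \<zero>)"
    by (cases "Suc (length us + length vs) = n") (auto simp: lin_zero)
qed

lemma multilinear_base: "multilinear base"
  unfolding multilinear_def
proof (intro allI impI)
  fix us i vs
  show "lin (V i) (\<lambda>x. base (us @ (i, x) # vs))"
  proof (cases "us = [] \<and> vs = [] \<and> i = 0")
    case True
    show ?thesis
      by (rule linear_map_cong[where f = p, OF _ _ module_V])
        (use p_linear True in \<open>auto simp: base_def\<close>)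
  next
    case False
    then have "base (us @ (i, x) # vs) = \<zero>" for x
      by (auto simp: base_def append_eq_Cons_conv)
    then show ?thesis by (simp add: lin_zero)
  qed
qed

lemma T_long: "n < length w \<Longrightarrow> T n w = \<zero>"
  by (induction n arbitrary: w) auto

lemma T_Nil [simp]: "T n [] = \<zero>"
  by (induction n) auto

declare T.simps(2) [simp del]

lemma T_Suc_short: "length w \<le> n \<Longrightarrow> T (Suc n) w = T n w"
  by (simp add: T_Suc)

lemma multilinear_T: "multilinear (T n)"
proof (induction n)
  case 0 show ?case by (simp add: multilinear_zero_fun)
next
  case (Suc n)
  have "multilinear (contract (U n))"
    by (intro multilinear_contract, simp)
      (simp add: U_def[abs_def] multilinear_minus multilinear_cup multilinear_D Suc)
  then have "multilinear (\<lambda>w. if n = 0 then base w else contract (U n) w)"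
    by (cases "n = 0") (simp_all add: multilinear_base)
  from multilinear_add[OF Suc multilinear_length[OF this, of "Suc n"]]
  show ?case unfolding T_Suc[abs_def] .
qed

lemma multilinear_U: "multilinear (U n)"
  by (simp add: U_def[abs_def] multilinear_minus multilinear_cup multilinear_D multilinear_T)

lemma D_zero:
  assumes "\<And>us c vs. us @ c @ vs = xs \<Longrightarrow> c \<noteq> [] \<Longrightarrow> G (us @ M c # vs) = \<zero>"
  shows "D G xs = \<zero>"
proof -
  have "D G xs = D (\<lambda>_. \<zero>) xs" by (rule D_cong) (simp add: assms)
  also have "\<dots> = \<zero>" by (induction xs) (simp_all add: cuts_zero)
  finally show ?thesis .
qed

lemma U_degree:
  assumes T: "\<And>w. shifted_degree w \<noteq> - 1 \<Longrightarrow> T n w = \<zero>" and "shifted_degree z \<noteq> - 2"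
  shows "U n z = \<zero>"
proof -
  have "cup (T n) (T n) z = \<zero>" unfolding cup_def
  proof (rule cuts_zero)
    fix us vs assume "us @ vs = z"
    then have "shifted_degree us \<noteq> - 1 \<or> shifted_degree vs \<noteq> - 1" using assms(2) by auto
    then show "T n us \<otimes> T n vs = \<zero>" using T by auto
  qed
  moreover have "D (T n) z = \<zero>"
    by (rule D_zero, rule T) (use assms(2) in auto)
  ultimately show ?thesis by (simp add: U_def a_minus_def)
qed

text \<open>\<open>A\<close> lives in degree \<open>0\<close>, which is the shifted degree \<open>- 1\<close>.\<close>
lemma T_degree: "shifted_degree w \<noteq> - 1 \<Longrightarrow> T n w = \<zero>"
proof (induction n arbitrary: w)
  case (Suc n)
  have "contract (U n) w = \<zero>"
  proof (rule contract_zero, rule U_degree[OF Suc.IH])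
    fix us x vs assume "us @ x # vs = w"
    moreover have "shifted_degree (map e_letter vs) = shifted_degree vs"
      by (induction vs) (auto simp: e_letter_def)
    ultimately show "shifted_degree (us @ h_letter x # map e_letter vs) \<noteq> - 2"
      using Suc.prems by (auto simp: h_letter_def)
  qed
  moreover have "base w = \<zero>" using Suc.prems by (auto simp: base_def)
  ultimately show ?case using Suc by (simp add: T_Suc)
qed simp

lemma cuts_first:
  assumes "\<And>us vs. us @ vs = xs \<Longrightarrow> us \<noteq> [] \<Longrightarrow> f us vs = \<zero>" "f [] xs \<in> carrier A"
  shows "cuts f xs = f [] xs"
proof (cases xs)
  case (Cons y ys)
  have "cuts (\<lambda>us vs. f (y # us) vs) ys = \<zero>"
    by (rule cuts_zero) (use assms Cons in auto)
  then show ?thesis using assms(2) Cons by simp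
qed simp

lemma D_eq_single:
  assumes "\<And>us c vs. us @ c @ vs = xs \<Longrightarrow> 2 \<le> length c \<Longrightarrow> G (us @ M c # vs) = \<zero>"
    and "\<And>w. G w \<in> carrier A"
  shows "D G xs = single G xs"
  using assms
proof (induction xs arbitrary: G)
  case (Cons x xs)
  have "cuts (\<lambda>c e. G (M (x # c) # e)) xs = G (M [x] # xs)"
  proof (rule cuts_first)
    fix us vs assume "us @ vs = xs" "us \<noteq> []"
    then show "G (M (x # us) # vs) = \<zero>"
      using Cons.prems(1)[of "[]" "x # us" vs] by (cases us) auto
  qed (simp add: Cons.prems)
  moreover have "D (\<lambda>z. G (x # z)) xs = single (\<lambda>z. G (x # z)) xs"
  proof (rule Cons.IH)
    fix us c vs assume "us @ c @ vs = xs" "2 \<le> length c"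
    then show "G (x # us @ M c # vs) = \<zero>" using Cons.prems(1)[of "x # us" c vs] by simp
  qed (simp add: Cons.prems)
  ultimately show ?case by simp
qed simp

lemma D_minus:
  assumes [simp, intro]: "\<And>w. G w \<in> carrier A" "\<And>w. H w \<in> carrier A"
  shows "D (\<lambda>w. G w \<ominus> H w) xs = D G xs \<ominus> D H xs"
proof -
  have "D (\<lambda>w. \<ominus> H w) xs = \<ominus> D H xs"
    by (rule D_additive) (auto simp: minus_add)
  then show ?thesis by (simp add: a_minus_def D_add)
qed

lemma T_mult_Suc:
  assumes "us @ vs = w" "length w \<le> Suc n"
  shows "T (Suc n) us \<otimes> T (Suc n) vs = T n us \<otimes> T n vs"
proof (cases "us = [] \<or> vs = []")
  case False
  then have "length us \<le> n" "length vs \<le> n" using assms by (auto simp: neq_Nil_conv)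
  then show ?thesis by (simp add: T_Suc_short)
qed auto

lemma cup_T_Suc: "length w \<le> Suc n \<Longrightarrow> cup (T (Suc n)) (T (Suc n)) w = cup (T n) (T n) w"
  unfolding cup_def by (rule cuts_cong) (rule T_mult_Suc)

text \<open>
  The defect is a cocycle. By the derivation rule and the equation on shorter words, its
  differential is the difference of \<open>(T \<union> T) \<union> T\<close> and \<open>T \<union> (T \<union> T)\<close>; the sign in the derivation rule
  is a minus sign since \<open>T\<close> vanishes on words of even shifted degree.
\<close>
lemma single_U:
  assumes IH: "\<And>w. list_all hom w \<Longrightarrow> length w \<le> n \<Longrightarrow> D (T n) w = cup (T n) (T n) w"
    and z: "list_all hom z" "length z = Suc n"
  shows "single (U n) z = \<zero>"
proof -
  have "single (U n) z = D (U n) z"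
  proof (rule D_eq_single[symmetric])
    fix us c vs assume *: "us @ c @ vs = z" "2 \<le> length c"
    then have "c \<noteq> []" by auto
    then have "list_all hom (us @ M c # vs)" "length (us @ M c # vs) \<le> n"
      using z * hom_M[of c] by auto
    then show "U n (us @ M c # vs) = \<zero>" unfolding U_def
      by (subst IH) (auto simp: a_minus_def r_neg)
  qed simp
  also have "\<dots> = D (cup (T n) (T n)) z \<ominus> D (D (T n)) z"
    unfolding U_def[abs_def] by (rule D_minus) auto
  also have "D (D (T n)) z = \<zero>"
    by (rule D_D) (auto simp: multilinear_imp_relation multilinear_T z)
  also have "D (cup (T n) (T n)) z = cuts (\<lambda>c e. cup (T n) (T n) c \<otimes> T n e \<oplus> \<ominus> (T n c \<otimes> cup (T n) (T n) e)) z"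
    unfolding cup_def[of "T n" "T n"]
  proof (subst D_cuts, simp, rule cuts_cong)
    fix c e assume ce: "c @ e = z"
    have "D (\<lambda>c'. T n c' \<otimes> T n e) c = D (T n) c \<otimes> T n e"
      by (rule D_additive) (auto simp: l_distr)
    also have "\<dots> = cup (T n) (T n) c \<otimes> T n e"
      using IH[of c] ce z by (cases e) auto
    finally have 1: "D (\<lambda>c'. T n c' \<otimes> T n e) c = cup (T n) (T n) c \<otimes> T n e" .
    have "D (\<lambda>e'. T n c \<otimes> T n e') e = T n c \<otimes> D (T n) e"
      by (rule D_additive) (auto simp: r_distr)
    also have "\<dots> = T n c \<otimes> cup (T n) (T n) e"
      using IH[of e] ce z by (cases c) auto
    finally have 3: "D (\<lambda>e'. T n c \<otimes> T n e') e = T n c \<otimes> cup (T n) (T n) e" .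
    have "flip (par c) (T n c \<otimes> cup (T n) (T n) e) = \<ominus> (T n c \<otimes> cup (T n) (T n) e)"
    proof (cases "shifted_degree c = - 1")
      case True
      then show ?thesis by (simp add: par_iff flip_def)
    next
      case False
      then show ?thesis by (simp add: T_degree)
    qed
    then have 2: "flip (par c) (D (\<lambda>e'. T n c \<otimes> T n e') e) = \<ominus> (T n c \<otimes> cup (T n) (T n) e)"
      unfolding 3 .
    show "D (\<lambda>c'. T n c' \<otimes> T n e) c \<oplus> flip (par c) (D (\<lambda>e'. T n c \<otimes> T n e') e) =
      cuts (\<lambda>us vs. T n us \<otimes> T n vs) c \<otimes> T n e \<oplus> \<ominus> (T n c \<otimes> cuts (\<lambda>us vs. T n us \<otimes> T n vs) e)"
      unfolding 1 2 by (simp add: cup_def)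
  qed
  also have "\<dots> = cuts (\<lambda>c e. cup (T n) (T n) c \<otimes> T n e) z \<oplus> cuts (\<lambda>c e. \<ominus> (T n c \<otimes> cup (T n) (T n) e)) z"
    by (rule cuts_add) auto
  also have "cuts (\<lambda>c e. \<ominus> (T n c \<otimes> cup (T n) (T n) e)) z = \<ominus> cup (T n) (cup (T n) (T n)) z"
    unfolding cup_def[of "T n" "cup (T n) (T n)"]
    by (rule cuts_additive) (auto simp: minus_add)
  also have "cuts (\<lambda>c e. cup (T n) (T n) c \<otimes> T n e) z = cup (T n) (cup (T n) (T n)) z"
    by (subst cup_assoc[symmetric]) (auto simp: cup_def)
  finally show ?thesis by (simp add: r_neg a_minus_def)
qed

text \<open>
  If \<open>n \<ge> 2\<close>, a word of \<open>n + 1\<close> letters of degree \<open>0\<close> does not have the shifted degree \<open>- 2\<close> of the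
  defect, while letters of other degrees are killed by \<open>e\<close>. For \<open>n = 1\<close> the claim is the
  multiplicativity of \<open>p\<close> on cohomology.
\<close>
lemma U_map_e_letter:
  assumes "list_all hom w" "length w = Suc n" "n \<noteq> 0"
  shows "U n (map e_letter w) = \<zero>"
proof (cases "\<exists>x\<in>set w. fst x \<noteq> 0")
  case True
  then obtain us x vs where w: "w = us @ x # vs" "fst x \<noteq> 0" by (metis split_list)
  then have "e_letter x = (fst x, \<zero>\<^bsub>V (fst x)\<^esub>)" using assms(1) e_zero by (auto simp: e_letter_def hom_def)
  then show ?thesis using multilinear_zero[OF multilinear_U, of "map e_letter us" "map e_letter vs"] w assms(1) by simp
next
  case False
  then have deg: "shifted_degree (map e_letter w) = - int (length w)"
    by (induction w) (auto simp: e_letter_def)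
  show ?thesis
  proof (cases "n = 1")
    case False
    then show ?thesis using deg assms by (intro U_degree T_degree) auto
  next
    case True
    then obtain a b where w: "w = [a, b]" using assms(2) by (auto simp: length_Suc_conv)
    obtain x y where ab: "a = (0, x)" "b = (0, y)" using False w by (cases a, cases b) auto
    have xy: "x \<in> carrier (V 0)" "y \<in> carrier (V 0)" using assms(1) w ab by auto
    let ?x = "e 0 x" and ?y = "e 0 y"
    have exy: "?x \<in> carrier (V 0)" "?y \<in> carrier (V 0)"
      using linear_map_closed[OF e_linear] xy by auto
    have m: "\<mu> [(0, ?x), (0, ?y)] \<in> carrier (V 0)" "M [(0, ?x), (0, ?y)] = (0, \<mu> [(0, ?x), (0, ?y)])"
      using hom_M[of "[(0, ?x), (0, ?y)]"] exy by (auto simp: M_def output_degree_shifted)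
    have T1: "T 1 [(0, z)] = p z" if "z \<in> carrier (V 0)" for z
      using that linear_map_closed[OF p_linear] by (simp add: T_Suc base_def)
    have T2: "T 1 [u, v] = \<zero>" for u v by (rule T_long) simp
    have "cup (T 1) (T 1) [(0, ?x), (0, ?y)] = p ?x \<otimes> p ?y"
      using exy linear_map_closed[OF p_linear] by (simp add: cup_def T1 T2 del: One_nat_def)
    moreover have "D (T 1) [(0, ?x), (0, ?y)] = p (\<mu> [(0, ?x), (0, ?y)])"
      using m linear_map_closed[OF p_linear] by (simp add: T1 T2 del: One_nat_def)
    ultimately have "U 1 [(0, ?x), (0, ?y)] = \<zero>"
      using p_mult[OF xy] exy linear_map_closed[OF p_linear] by (simp add: U_def a_minus_def r_neg)
    then show ?thesis using True w ab by (simp add: e_letter_def)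
  qed
qed

theorem twisting_equation:
  "list_all hom w \<Longrightarrow> length w \<le> n \<Longrightarrow> D (T n) w = cup (T n) (T n) w"
proof (induction n arbitrary: w)
  case 0 then show ?case by (simp add: cup_def)
next
  case (Suc n)
  note [simp del] = One_nat_def
  show ?case
  proof (cases "length w \<le> n")
    case True
    have "D (T (Suc n)) w = D (T n) w"
    proof (rule D_cong)
      fix us c vs assume "us @ c @ vs = w" "c \<noteq> []"
      then have "length (us @ M c # vs) \<le> n" using True by (cases c) auto
      then show "T (Suc n) (us @ M c # vs) = T n (us @ M c # vs)" by (rule T_Suc_short)
    qed
    then show ?thesis using Suc.IH[OF Suc.prems(1) True] cup_T_Suc[OF Suc.prems(2)] by simp
  next
    case False
    then have len: "length w = Suc n" using Suc.prems by simp
    show ?thesis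
    proof (cases "n = 0")
      case True
      then obtain i x where w: "w = [(i, x)]" using len by (metis length_0_conv length_Suc_conv surj_pair)
      have x: "x \<in> carrier (V i)" using Suc.prems w by simp
      have "base [(i + 1, \<mu> [(i, x)])] = \<zero>"
      proof (cases "i = - 1")
        case True then show ?thesis using p_d[of x] x by (simp add: base_def)
      qed (simp add: base_def)
      then show ?thesis using True w by (simp add: T_Suc M_single cup_def)
    next
      case False
      let ?N = "\<lambda>z. if length z = Suc n then contract (U n) z else \<zero>"
      have "T (Suc n) = (\<lambda>z. T n z \<oplus> ?N z)" using False by (intro ext) (simp add: T_Suc)
      then have "D (T (Suc n)) w = D (T n) w \<oplus> D ?N w" by (simp add: D_add)
      also have "D ?N w = single ?N w"
        by (rule D_eq_single) (use len in auto)
      also have "\<dots> = single (contract (U n)) w"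
        by (rule single_cong) (use len in auto)
      also have "\<dots> = U n w"
      proof -
        have "contract (single (U n)) w = \<zero>"
          by (rule contract_zero, rule single_U) (use Suc len in auto)
        with homotopy_formula[OF U_closed multilinear_U Suc.prems(1), of n]
        show ?thesis using U_map_e_letter[OF Suc.prems(1) len False] by (simp add: a_minus_def)
      qed
      also have "D (T n) w \<oplus> U n w = cup (T n) (T n) w"
        unfolding U_def
      proof -
        have "x \<oplus> (y \<ominus> x) = y" if "x \<in> carrier A" "y \<in> carrier A" for x y
          using that by algebra
        then show "D (T n) w \<oplus> (cup (T n) (T n) w \<ominus> D (T n) w) = cup (T n) (T n) w" by simp
      qed
      finally show ?thesis using cup_T_Suc[OF Suc.prems(2)] by simp
    qed
  qed
qed

end

section \<open>A-infinity-algebras with cohomology in degree zero\<close>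

lemma signed_closed: "abelian_group M \<Longrightarrow> x \<in> carrier M \<Longrightarrow> signed M e x \<in> carrier M"
  by (simp add: signed_def abelian_group.a_inv_closed)

lemma signed_signed:
  "abelian_group M \<Longrightarrow> x \<in> carrier M \<Longrightarrow> signed M e (signed M f x) = signed M (e + f) x"
  by (auto simp: signed_def abelian_group.minus_minus)

lemma signed_cong: "even (e - f) \<Longrightarrow> signed M e x = signed M f x"
  by (auto simp: signed_def)

lemma signed_add:
  "abelian_group M \<Longrightarrow> x \<in> carrier M \<Longrightarrow> y \<in> carrier M \<Longrightarrow>
    signed M e (x \<oplus>\<^bsub>M\<^esub> y) = signed M e x \<oplus>\<^bsub>M\<^esub> signed M e y"
  by (auto simp: signed_def abelian_group.minus_add)

lemma signed_zero: "abelian_group M \<Longrightarrow> signed M e \<zero>\<^bsub>M\<^esub> = \<zero>\<^bsub>M\<^esub>"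
  by (auto simp: signed_def abelian_group.neg_zero)

lemma linear_map_signed:
  assumes "linear_map K M N f" "abelian_group M" "abelian_group N" "x \<in> carrier M"
  shows "f (signed M e x) = signed N e (f x)"
  using linear_map_minus[OF assms] by (simp add: signed_def)

lemma linear_map_signed_comp:
  assumes "linear_map K M N f" "module K N"
  shows "linear_map K M N (\<lambda>x. signed N e (f x))"
proof -
  interpret module K N by fact
  show ?thesis
    by (rule linear_mapI)
      (auto simp: linear_map_closed[OF assms(1)] linear_map_add[OF assms(1)]
        linear_map_smult[OF assms(1)] signed_def smult_r_minus M.minus_add)
qed

text \<open>
  The sign \<open>\<Sum> (n - j) |x\<^sub>j|\<close> that arises from moving the suspensions of \<open>n\<close> letters past each
  other. Twisting operations and morphisms by it gives them the simple signs used in \<open>D\<close> and in the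
  cup product.
\<close>
primrec bar_sign :: "(int \<times> 'b) list \<Rightarrow> int" where
  "bar_sign [] = 0"
| "bar_sign (x # xs) = fst x * int (length xs) + bar_sign xs"

lemma total_degree_append [simp]: "total_degree (us @ vs) = total_degree us + total_degree vs"
  by (simp add: total_degree_def)

lemma total_degree_Cons [simp]: "total_degree (x # vs) = fst x + total_degree vs"
  by (simp add: total_degree_def)

lemma bar_sign_append:
  "bar_sign (us @ vs) = bar_sign us + total_degree us * int (length vs) + bar_sign vs"
  by (induction us) (auto simp: total_degree_def algebra_simps)

text \<open>
  The comparison of the sign in the A-infinity relation, on the right, with the sign in \<open>D\<close>.
\<close>
lemma bar_sign_insert:
  "even ((shifted_degree us + (bar_sign (us @ (output_degree 2 ys, y) # vs) + bar_sign ys)) -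
    (bar_sign (us @ ys @ vs) + (int (length us) + int (length ys) * int (length vs)
      + (2 - int (length ys)) * total_degree us)))"
proof -
  have "(shifted_degree us + (bar_sign (us @ (output_degree 2 ys, y) # vs) + bar_sign ys)) -
    (bar_sign (us @ ys @ vs) + (int (length us) + int (length ys) * int (length vs)
      + (2 - int (length ys)) * total_degree us)) =
    2 * (int (length vs) - int (length ys) * int (length vs) - int (length us))"
    by (simp add: bar_sign_append shifted_degree_def output_degree_def algebra_simps)
  then show ?thesis by (simp only: dvd_triv_left)
qed

locale degree_zero_cohomology = kalgebra K A
  for K :: "('k, 'r) ring_scheme" and A :: "('k, 'a) module" (structure) +
  fixes X :: "('k, 'b) A_infinity" and \<phi> :: "int \<Rightarrow> 'b set \<Rightarrow> 'a"
  assumes field_K: "field K"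
    and X: "A_infinity_algebra K X"
    and iso: "graded_algebra_iso K (cohomology X) (concentrated_in_degree_0 A) \<phi>"
begin

abbreviation V where "V \<equiv> A_space X"
abbreviation m where "m \<equiv> A_ops X"
definition d :: "int \<Rightarrow> 'b \<Rightarrow> 'b" where "d i x = m [(i, x)]"

lemma module_V: "module K (V i)"
  using X by (simp add: A_infinity_algebra_def)

lemma abelian_V: "abelian_group (V i)"
  using module_V module.axioms by blast

lemma m_linear:
  assumes "homogeneous V us" "homogeneous V vs"
  shows "linear_map K (V i) (V (output_degree 2 (us @ (i, y) # vs))) (\<lambda>x. m (us @ (i, x) # vs))"
proof -
  have "output_degree 2 us + i - 1 + output_degree 0 vs = output_degree 2 (us @ (i, y) # vs)"
    by (simp add: output_degree_shifted)
  then show ?thesis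
    using X assms unfolding A_infinity_algebra_def multilinear_family_def by metis
qed

lemma m_closed:
  assumes "homogeneous V ys" "ys \<noteq> []"
  shows "m ys \<in> carrier (V (output_degree 2 ys))"
proof (cases ys)
  case (Cons y vs)
  have "homogeneous V []" "homogeneous V vs" "snd y \<in> carrier (V (fst y))"
    using assms Cons by (auto simp: homogeneous_def)
  from linear_map_closed[OF m_linear[OF this(1,2), of "fst y" "snd y"] this(3)]
  show ?thesis by (simp add: Cons)
qed (use assms in simp)

lemma A_infinity:
  assumes "homogeneous V xs" "xs \<noteq> []"
  shows "insertion_sum (V (output_degree 3 xs)) m m xs = \<zero>\<^bsub>V (output_degree 3 xs)\<^esub>"
  using X assms by (auto simp: A_infinity_algebra_def Let_def)

lemma d_linear: "linear_map K (V i) (V (i + 1)) (d i)"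
  using m_linear[of "[]" "[]" i] by (simp add: d_def[abs_def] homogeneous_def output_degree_shifted add.commute)

lemma d_linear': "linear_map K (V (i - 1)) (V i) (d (i - 1))"
  using d_linear[of "i - 1"] by simp

lemma d_d: "x \<in> carrier (V i) \<Longrightarrow> d (i + 1) (d i x) = \<zero>\<^bsub>V (i + 2)\<^esub>"
proof -
  assume x: "x \<in> carrier (V i)"
  have S: "{(r, s). 1 \<le> s \<and> r + s \<le> length [(i, x)]} = {(0, 1)}" by auto
  interpret abelian_group "V (i + 2)" by (rule abelian_V)
  have "d (i + 1) (d i x) \<in> carrier (V (i + 2))"
    using linear_map_closed[OF d_linear, of "d i x" "i + 1"] linear_map_closed[OF d_linear x]
    by (simp add: add.assoc)
  then have "insertion_sum (V (i + 2)) m m [(i, x)] = d (i + 1) (d i x)"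
    unfolding insertion_sum_def S
    by (subst finsum_sing) (simp_all add: Let_def total_degree_def output_degree_shifted signed_def d_def
        add.commute[of 1 i])
  moreover have "output_degree 3 [(i, x)] = i + 2" by (simp add: output_degree_shifted)
  ultimately show ?thesis using A_infinity[of "[(i, x)]"] x by (simp add: homogeneous_def)
qed

text \<open>The A-infinity relation for two arguments.\<close>
lemma Leibniz:
  assumes "x \<in> carrier (V i)" "y \<in> carrier (V j)"
  shows "m [(i + 1, d i x), (j, y)] \<oplus>\<^bsub>V (i + j + 1)\<^esub> signed (V (i + j + 1)) i (m [(i, x), (j + 1, d j y)])
    = d (i + j) (m [(i, x), (j, y)])"
proof -
  interpret abelian_group "V (i + j + 1)" by (rule abelian_V)
  have S: "{(r, s). 1 \<le> s \<and> r + s \<le> length [(i, x), (j, y)]} = {(0, 1), (0, 2), (1, 1)}"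
    by (auto simp: numeral_2_eq_2)
  have dc: "d i x \<in> carrier (V (i + 1))" "d j y \<in> carrier (V (j + 1))"
    using linear_map_closed[OF d_linear] assms by auto
  have m0: "m [(i, x), (j, y)] \<in> carrier (V (i + j))"
    using m_closed[of "[(i, x), (j, y)]"] assms by (simp add: homogeneous_def output_degree_shifted)
  have m2: "d (i + j) (m [(i, x), (j, y)]) \<in> carrier (V (i + j + 1))"
    using linear_map_closed[OF d_linear m0] .
  have m1: "m [(i + 1, d i x), (j, y)] \<in> carrier (V (i + j + 1))"
    "m [(i, x), (j + 1, d j y)] \<in> carrier (V (i + j + 1))"
    using m_closed[of "[(i + 1, d i x), (j, y)]"] m_closed[of "[(i, x), (j + 1, d j y)]"] assms dc
    by (simp_all add: homogeneous_def output_degree_shifted algebra_simps)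
  have "insertion_sum (V (i + j + 1)) m m [(i, x), (j, y)] =
    \<ominus>\<^bsub>V (i + j + 1)\<^esub> m [(i + 1, d i x), (j, y)] \<oplus>\<^bsub>V (i + j + 1)\<^esub>
     (d (i + j) (m [(i, x), (j, y)]) \<oplus>\<^bsub>V (i + j + 1)\<^esub>
      signed (V (i + j + 1)) (i + 1) (m [(i, x), (j + 1, d j y)]))"
    unfolding insertion_sum_def S
    by (subst finsum_three)
      (use m1 m2 in \<open>simp_all add: Let_def total_degree_def output_degree_shifted signed_def d_def
        add.commute[of 1 i] add.commute[of 1 j]\<close>)
  moreover have "insertion_sum (V (i + j + 1)) m m [(i, x), (j, y)] = \<zero>\<^bsub>V (i + j + 1)\<^esub>"
  proof -
    have "output_degree 3 [(i, x), (j, y)] = i + j + 1" by (simp add: output_degree_shifted)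
    then show ?thesis using A_infinity[of "[(i, x), (j, y)]"] assms by (simp add: homogeneous_def)
  qed
  ultimately have zero: "\<ominus>\<^bsub>V (i + j + 1)\<^esub> m [(i + 1, d i x), (j, y)] \<oplus>\<^bsub>V (i + j + 1)\<^esub>
     (d (i + j) (m [(i, x), (j, y)]) \<oplus>\<^bsub>V (i + j + 1)\<^esub>
      signed (V (i + j + 1)) (i + 1) (m [(i, x), (j + 1, d j y)])) = \<zero>\<^bsub>V (i + j + 1)\<^esub>" by simp
  have cancel: "a \<oplus>\<^bsub>V (i + j + 1)\<^esub> b = c"
    if "\<ominus>\<^bsub>V (i + j + 1)\<^esub> a \<oplus>\<^bsub>V (i + j + 1)\<^esub> (c \<oplus>\<^bsub>V (i + j + 1)\<^esub> \<ominus>\<^bsub>V (i + j + 1)\<^esub> b) = \<zero>\<^bsub>V (i + j + 1)\<^esub>"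
      "a \<in> carrier (V (i + j + 1))" "b \<in> carrier (V (i + j + 1))" "c \<in> carrier (V (i + j + 1))" for a b c
  proof -
    have "a \<oplus>\<^bsub>V (i + j + 1)\<^esub> b = (a \<oplus>\<^bsub>V (i + j + 1)\<^esub> b) \<oplus>\<^bsub>V (i + j + 1)\<^esub>
      (\<ominus>\<^bsub>V (i + j + 1)\<^esub> a \<oplus>\<^bsub>V (i + j + 1)\<^esub> (c \<oplus>\<^bsub>V (i + j + 1)\<^esub> \<ominus>\<^bsub>V (i + j + 1)\<^esub> b))"
      using that by simp
    also have "\<dots> = (a \<oplus>\<^bsub>V (i + j + 1)\<^esub> \<ominus>\<^bsub>V (i + j + 1)\<^esub> a) \<oplus>\<^bsub>V (i + j + 1)\<^esub>
      (b \<oplus>\<^bsub>V (i + j + 1)\<^esub> \<ominus>\<^bsub>V (i + j + 1)\<^esub> b) \<oplus>\<^bsub>V (i + j + 1)\<^esub> c"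
      using that(2-) by (simp only: a_ac a_closed a_inv_closed)
    also have "\<dots> = c" using that(2-) by (simp add: r_neg)
    finally show ?thesis .
  qed
  have flip: "signed (V (i + j + 1)) (i + 1) z = \<ominus>\<^bsub>V (i + j + 1)\<^esub> signed (V (i + j + 1)) i z"
    if "z \<in> carrier (V (i + j + 1))" for z using that by (simp add: signed_def)
  show ?thesis
    by (rule cancel) (use m1 m2 zero in \<open>simp_all only: flip[OF m1(2)] signed_closed[OF abelian_V]\<close>)
qed

abbreviation Z where "Z \<equiv> cocycles X"
abbreviation B where "B \<equiv> coboundaries X"
definition coset :: "int \<Rightarrow> 'b \<Rightarrow> 'b set" where "coset i x = {b \<oplus>\<^bsub>V i\<^esub> x | b. b \<in> B i}"

lemma Z_iff: "x \<in> Z i \<longleftrightarrow> x \<in> carrier (V i) \<and> d i x = \<zero>\<^bsub>V (i + 1)\<^esub>"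
  by (auto simp: cocycles_def d_def)

lemma B_iff: "x \<in> B i \<longleftrightarrow> (\<exists>y\<in>carrier (V (i - 1)). x = d (i - 1) y)"
  by (auto simp: coboundaries_def d_def)

lemma d_B: "y \<in> carrier (V (i - 1)) \<Longrightarrow> d (i - 1) y \<in> B i"
  by (auto simp: B_iff)

lemma B_sub: "x \<in> B i \<Longrightarrow> x \<in> carrier (V i)"
  using linear_map_closed[OF d_linear, of _ "i - 1"] by (auto simp: B_iff)

lemma B_Z: "x \<in> B i \<Longrightarrow> x \<in> Z i"
  using d_d[of _ "i - 1"] B_sub by (auto simp: B_iff Z_iff add.commute)

lemma B_cases:
  assumes "x \<in> B i"
  obtains y where "y \<in> carrier (V (i - 1))" "x = d (i - 1) y"
  using assms B_iff by blast

lemma B_add: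
  assumes "x \<in> B i" "y \<in> B i"
  shows "x \<oplus>\<^bsub>V i\<^esub> y \<in> B i"
proof -
  obtain u v where *: "u \<in> carrier (V (i - 1))" "x = d (i - 1) u" "v \<in> carrier (V (i - 1))" "y = d (i - 1) v"
    using assms by (metis B_cases)
  then have "x \<oplus>\<^bsub>V i\<^esub> y = d (i - 1) (u \<oplus>\<^bsub>V (i - 1)\<^esub> v)"
    using linear_map_add[OF d_linear'] by simp
  then show ?thesis using d_B abelian_groupE(1)[OF abelian_V] * by metis
qed

lemma B_zero: "\<zero>\<^bsub>V i\<^esub> \<in> B i"
  using d_B[OF abelian_groupE(2)[OF abelian_V], of i] linear_map_zero[OF d_linear' abelian_V abelian_V, of i]
  by simp

lemma B_minus: "x \<in> B i \<Longrightarrow> \<ominus>\<^bsub>V i\<^esub> x \<in> B i"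
  by (metis B_cases d_B linear_map_minus[OF d_linear' abelian_V abelian_V]
      abelian_group.a_inv_closed[OF abelian_V])

lemma B_smult: "a \<in> carrier K \<Longrightarrow> x \<in> B i \<Longrightarrow> a \<odot>\<^bsub>V i\<^esub> x \<in> B i"
  by (metis B_cases d_B linear_map_smult[OF d_linear'] module.smult_closed[OF module_V])

lemma coset_self: "x \<in> carrier (V i) \<Longrightarrow> x \<in> coset i x"
proof -
  interpret abelian_group "V i" by (rule abelian_V)
  show "x \<in> carrier (V i) \<Longrightarrow> x \<in> coset i x" using B_zero[of i] by (force simp: coset_def)
qed

lemma coset_shift:
  assumes "b \<in> B i" "x \<in> carrier (V i)"
  shows "coset i (b \<oplus>\<^bsub>V i\<^esub> x) = coset i x"
proof -
  interpret abelian_group "V i" by (rule abelian_V)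
  have b: "b \<in> carrier (V i)" using B_sub assms by auto
  have "c \<oplus>\<^bsub>V i\<^esub> (b \<oplus>\<^bsub>V i\<^esub> x) \<in> coset i x" if "c \<in> B i" for c
  proof -
    have "c \<oplus>\<^bsub>V i\<^esub> (b \<oplus>\<^bsub>V i\<^esub> x) = (c \<oplus>\<^bsub>V i\<^esub> b) \<oplus>\<^bsub>V i\<^esub> x"
      using b B_sub[OF that] assms by (simp add: a_assoc)
    then show ?thesis using B_add[OF that assms(1)] by (auto simp: coset_def)
  qed
  moreover have "c \<oplus>\<^bsub>V i\<^esub> x \<in> coset i (b \<oplus>\<^bsub>V i\<^esub> x)" if "c \<in> B i" for c
  proof -
    have "c \<oplus>\<^bsub>V i\<^esub> x = (c \<oplus>\<^bsub>V i\<^esub> \<ominus>\<^bsub>V i\<^esub> b) \<oplus>\<^bsub>V i\<^esub> (b \<oplus>\<^bsub>V i\<^esub> x)"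
      using b B_sub[OF that] assms by (simp add: a_assoc r_neg1)
    then show ?thesis using B_add[OF that B_minus[OF assms(1)]] by (auto simp: coset_def)
  qed
  ultimately show ?thesis by (auto simp: coset_def)
qed

lemma coset_a_r_coset: "B i +>\<^bsub>V i\<^esub> x = coset i x"
  by (auto simp: a_r_coset_def' coset_def)

lemma coset_restrict: "B i +>\<^bsub>(V i)\<lparr>carrier := Z i\<rparr>\<^esub> x = coset i x"
  by (auto simp: a_r_coset_def' coset_def)

lemma carrier_cohomology: "carrier (cohomology_space X i) = coset i ` Z i"
  by (auto simp: cohomology_space_def quotient_module_def FactRing_def A_RCOSETS_def' coset_restrict)

lemma add_cohomology:
  assumes "x \<in> carrier (V i)" "y \<in> carrier (V i)"
  shows "coset i x \<oplus>\<^bsub>cohomology_space X i\<^esub> coset i y = coset i (x \<oplus>\<^bsub>V i\<^esub> y)"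
proof -
  interpret abelian_group "V i" by (rule abelian_V)
  have e: "(b \<oplus>\<^bsub>V i\<^esub> x) \<oplus>\<^bsub>V i\<^esub> (c \<oplus>\<^bsub>V i\<^esub> y) = (b \<oplus>\<^bsub>V i\<^esub> c) \<oplus>\<^bsub>V i\<^esub> (x \<oplus>\<^bsub>V i\<^esub> y)"
    if "b \<in> B i" "c \<in> B i" for b c
    using assms B_sub[OF that(1)] B_sub[OF that(2)] by (simp add: a_ac)
  have "coset i x \<oplus>\<^bsub>cohomology_space X i\<^esub> coset i y =
     {(b \<oplus>\<^bsub>V i\<^esub> x) \<oplus>\<^bsub>V i\<^esub> (c \<oplus>\<^bsub>V i\<^esub> y) | b c. b \<in> B i \<and> c \<in> B i}"
    by (auto simp: cohomology_space_def quotient_module_def FactRing_def set_add_def' coset_def)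
  also have "\<dots> = coset i (x \<oplus>\<^bsub>V i\<^esub> y)"
  proof (intro equalityI subsetI)
    fix z assume "z \<in> {(b \<oplus>\<^bsub>V i\<^esub> x) \<oplus>\<^bsub>V i\<^esub> (c \<oplus>\<^bsub>V i\<^esub> y) | b c. b \<in> B i \<and> c \<in> B i}"
    then show "z \<in> coset i (x \<oplus>\<^bsub>V i\<^esub> y)" using e B_add by (auto simp: coset_def)
  next
    fix z assume "z \<in> coset i (x \<oplus>\<^bsub>V i\<^esub> y)"
    then obtain b where b: "b \<in> B i" "z = b \<oplus>\<^bsub>V i\<^esub> (x \<oplus>\<^bsub>V i\<^esub> y)" by (auto simp: coset_def)
    then have "z = (b \<oplus>\<^bsub>V i\<^esub> x) \<oplus>\<^bsub>V i\<^esub> (\<zero>\<^bsub>V i\<^esub> \<oplus>\<^bsub>V i\<^esub> y)"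
      using e[OF b(1) B_zero] B_sub[OF b(1)] by simp
    then show "z \<in> {(b \<oplus>\<^bsub>V i\<^esub> x) \<oplus>\<^bsub>V i\<^esub> (c \<oplus>\<^bsub>V i\<^esub> y) | b c. b \<in> B i \<and> c \<in> B i}"
      using b(1) B_zero by blast
  qed
  finally show ?thesis .
qed

lemma smult_cohomology:
  assumes "a \<in> carrier K" "x \<in> carrier (V i)"
  shows "a \<odot>\<^bsub>cohomology_space X i\<^esub> coset i x = coset i (a \<odot>\<^bsub>V i\<^esub> x)"
proof -
  interpret module K "V i" by (rule module_V)
  have eq: "coset i (a \<odot>\<^bsub>V i\<^esub> y) = coset i (a \<odot>\<^bsub>V i\<^esub> x)" if "y \<in> coset i x" for y
  proof -
    obtain b where b: "b \<in> B i" "y = b \<oplus>\<^bsub>V i\<^esub> x" using \<open>y \<in> coset i x\<close> by (auto simp: coset_def)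
    then have "a \<odot>\<^bsub>V i\<^esub> y = a \<odot>\<^bsub>V i\<^esub> b \<oplus>\<^bsub>V i\<^esub> a \<odot>\<^bsub>V i\<^esub> x"
      using assms B_sub[OF b(1)] by (simp add: smult_r_distr)
    then show ?thesis using coset_shift[OF B_smult[OF assms(1) b(1)]] assms by simp
  qed
  have "a \<odot>\<^bsub>cohomology_space X i\<^esub> coset i x = (\<Union>y\<in>coset i x. coset i (a \<odot>\<^bsub>V i\<^esub> y))"
    by (simp add: cohomology_space_def quotient_module_def coset_restrict)
  also have "\<dots> = (\<Union>y\<in>coset i x. coset i (a \<odot>\<^bsub>V i\<^esub> x))"
    by (rule SUP_cong) (auto simp: eq)
  also have "\<dots> = coset i (a \<odot>\<^bsub>V i\<^esub> x)" using coset_self[OF assms(2)] by (subst UN_constant) auto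
  finally show ?thesis .
qed

lemma m2_closed: "x \<in> carrier (V 0) \<Longrightarrow> y \<in> carrier (V 0) \<Longrightarrow> m [(0, x), (0, y)] \<in> carrier (V 0)"
  using m_closed[of "[(0, x), (0, y)]"] by (simp add: homogeneous_def output_degree_shifted)

lemma m2_add:
  assumes "x \<in> carrier (V 0)" "y \<in> carrier (V 0)" "z \<in> carrier (V 0)"
  shows "m [(0, x \<oplus>\<^bsub>V 0\<^esub> y), (0, z)] = m [(0, x), (0, z)] \<oplus>\<^bsub>V 0\<^esub> m [(0, y), (0, z)]"
    "m [(0, z), (0, x \<oplus>\<^bsub>V 0\<^esub> y)] = m [(0, z), (0, x)] \<oplus>\<^bsub>V 0\<^esub> m [(0, z), (0, y)]"
  using linear_map_add[OF m_linear[of "[]" "[(0, z)]" 0] assms(1,2)]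
    linear_map_add[OF m_linear[of "[(0, z)]" "[]" 0] assms(1,2)] assms(3)
  by (simp_all add: homogeneous_def output_degree_shifted)

lemma m2_Z: "x \<in> Z 0 \<Longrightarrow> y \<in> Z 0 \<Longrightarrow> m [(0, x), (0, y)] \<in> Z 0"
proof -
  assume xy: "x \<in> Z 0" "y \<in> Z 0"
  interpret abelian_group "V 1" by (rule abelian_V)
  have "m [(1, \<zero>\<^bsub>V 1\<^esub>), (0, y)] = \<zero>\<^bsub>V 1\<^esub>" "m [(0, x), (1, \<zero>\<^bsub>V 1\<^esub>)] = \<zero>\<^bsub>V 1\<^esub>"
    using linear_map_zero[OF m_linear[of "[]" "[(0, y)]" 1] abelian_V abelian_V]
      linear_map_zero[OF m_linear[of "[(0, x)]" "[]" 1] abelian_V abelian_V] xy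
    by (simp_all add: homogeneous_def output_degree_shifted Z_iff)
  then show ?thesis using Leibniz[of x 0 y 0] xy m2_closed by (simp add: Z_iff signed_def)
qed

lemma m2_B:
  assumes "b \<in> B 0" "x \<in> Z 0"
  shows "m [(0, b), (0, x)] \<in> B 0" "m [(0, x), (0, b)] \<in> B 0"
proof -
  interpret abelian_group "V 0" by (rule abelian_V)
  obtain y where y: "y \<in> carrier (V (- 1))" "b = d (- 1) y" using assms by (auto simp: B_iff)
  have x: "x \<in> carrier (V 0)" "d 0 x = \<zero>\<^bsub>V 1\<^esub>" using assms by (auto simp: Z_iff)
  have b: "b \<in> carrier (V 0)" using B_sub assms by auto
  have "m [(- 1, y), (1, \<zero>\<^bsub>V 1\<^esub>)] = \<zero>\<^bsub>V 0\<^esub>" "m [(1, \<zero>\<^bsub>V 1\<^esub>), (- 1, y)] = \<zero>\<^bsub>V 0\<^esub>"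
    using linear_map_zero[OF m_linear[of "[(- 1, y)]" "[]" 1] abelian_V abelian_V]
      linear_map_zero[OF m_linear[of "[]" "[(- 1, y)]" 1] abelian_V abelian_V] y
    by (simp_all add: homogeneous_def output_degree_shifted)
  then have "m [(0, b), (0, x)] = d (- 1) (m [(- 1, y), (0, x)])"
    "m [(0, x), (0, b)] = d (- 1) (m [(0, x), (- 1, y)])"
    using Leibniz[of y "- 1" x 0] Leibniz[of x 0 y "- 1"] x y m2_closed[OF b x(1)] m2_closed[OF x(1) b]
    by (auto simp: signed_def neg_zero)
  moreover have "m [(- 1, y), (0, x)] \<in> carrier (V (- 1))" "m [(0, x), (- 1, y)] \<in> carrier (V (- 1))"
    using m_closed[of "[(- 1, y), (0, x)]"] m_closed[of "[(0, x), (- 1, y)]"] x y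
    by (simp_all add: homogeneous_def output_degree_shifted)
  ultimately show "m [(0, b), (0, x)] \<in> B 0" "m [(0, x), (0, b)] \<in> B 0"
    using d_B[of _ 0] by auto
qed

text \<open>
  The product of cohomology classes is defined as a union over representatives; this union is a
  single coset by the Leibniz rule.
\<close>
lemma mult_cohomology:
  assumes "x \<in> Z 0" "y \<in> Z 0"
  shows "gmult (cohomology X) 0 0 (coset 0 x) (coset 0 y) = coset 0 (m [(0, x), (0, y)])"
proof -
  interpret abelian_group "V 0" by (rule abelian_V)
  have xy: "x \<in> carrier (V 0)" "y \<in> carrier (V 0)" using assms by (auto simp: Z_iff)
  have eq: "coset 0 (m [(0, u), (0, v)]) = coset 0 (m [(0, x), (0, y)])"
    if uv: "u \<in> coset 0 x" "v \<in> coset 0 y" for u v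
  proof -
    obtain b c where bc: "b \<in> B 0" "u = b \<oplus>\<^bsub>V 0\<^esub> x" "c \<in> B 0" "v = c \<oplus>\<^bsub>V 0\<^esub> y"
      using uv by (auto simp: coset_def)
    have cl: "b \<in> carrier (V 0)" "c \<in> carrier (V 0)" using bc B_sub by auto
    have m1: "m [(0, b), (0, y)] \<in> B 0" and m2: "m [(0, x), (0, c)] \<in> B 0"
      and m3: "m [(0, b), (0, c)] \<in> B 0"
      using m2_B bc assms B_Z by auto
    have "m [(0, u), (0, v)] = (m [(0, b), (0, c)] \<oplus>\<^bsub>V 0\<^esub> m [(0, b), (0, y)]) \<oplus>\<^bsub>V 0\<^esub>
        (m [(0, x), (0, c)] \<oplus>\<^bsub>V 0\<^esub> m [(0, x), (0, y)])"
      unfolding bc using cl xy by (simp add: m2_add m2_closed add_exchange)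
    also have "coset 0 \<dots> = coset 0 (m [(0, x), (0, c)] \<oplus>\<^bsub>V 0\<^esub> m [(0, x), (0, y)])"
      by (rule coset_shift) (use m1 m2 m3 B_add xy cl m2_closed in auto)
    also have "\<dots> = coset 0 (m [(0, x), (0, y)])"
      by (rule coset_shift) (use m2 xy m2_closed in auto)
    finally show ?thesis .
  qed
  have "gmult (cohomology X) 0 0 (coset 0 x) (coset 0 y)
    = (\<Union>u\<in>coset 0 x. \<Union>v\<in>coset 0 y. coset 0 (m [(0, u), (0, v)]))"
    using coset_a_r_coset[of 0] by (simp add: cohomology_def)
  also have "\<dots> = (\<Union>u\<in>coset 0 x. \<Union>v\<in>coset 0 y. coset 0 (m [(0, x), (0, y)]))"
    by (intro SUP_cong refl eq)
  also have "\<dots> = coset 0 (m [(0, x), (0, y)])"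
    using coset_self[OF xy(1)] coset_self[OF xy(2)] by auto
  finally show ?thesis .
qed

lemma \<phi>_linear: "linear_map K (cohomology_space X 0) A (\<phi> 0)"
proof -
  have "linear_map K (component (cohomology X) 0) (component (concentrated_in_degree_0 A) 0) (\<phi> 0)"
    using iso unfolding graded_algebra_iso_def by blast
  then show ?thesis by (simp add: cohomology_def concentrated_in_degree_0_def)
qed

lemma \<phi>_bij: "bij_betw (\<phi> 0) (coset 0 ` Z 0) (carrier A)"
proof -
  have "bij_betw (\<phi> 0) (carrier (component (cohomology X) 0)) (carrier (component (concentrated_in_degree_0 A) 0))"
    using iso unfolding graded_algebra_iso_def by blast
  then show ?thesis by (simp add: cohomology_def concentrated_in_degree_0_def carrier_cohomology)
qed

lemma \<phi>_mult: "x \<in> Z 0 \<Longrightarrow> y \<in> Z 0 \<Longrightarrow>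
    \<phi> 0 (coset 0 (m [(0, x), (0, y)])) = \<phi> 0 (coset 0 x) \<otimes> \<phi> 0 (coset 0 y)"
proof -
  assume xy: "x \<in> Z 0" "y \<in> Z 0"
  then have "coset 0 x \<in> carrier (component (cohomology X) 0)"
    "coset 0 y \<in> carrier (component (cohomology X) 0)"
    using carrier_cohomology[of 0] by (auto simp: cohomology_def)
  then have "\<phi> (0 + 0) (gmult (cohomology X) 0 0 (coset 0 x) (coset 0 y)) =
      gmult (concentrated_in_degree_0 A) 0 0 (\<phi> 0 (coset 0 x)) (\<phi> 0 (coset 0 y))"
    using iso unfolding graded_algebra_iso_def by blast
  then show ?thesis using mult_cohomology[OF xy] by (simp add: concentrated_in_degree_0_def)
qed

lemma cohomology_zero: "i \<noteq> 0 \<Longrightarrow> card (coset i ` Z i) = 1"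
proof -
  assume i: "i \<noteq> 0"
  have "bij_betw (\<phi> i) (carrier (component (cohomology X) i)) (carrier (component (concentrated_in_degree_0 A) i))"
    using iso unfolding graded_algebra_iso_def by blast
  then have "bij_betw (\<phi> i) (coset i ` Z i) {\<zero>}"
    using i carrier_cohomology[of i] by (simp add: cohomology_def concentrated_in_degree_0_def)
  from bij_betw_same_card[OF this] show ?thesis by simp
qed

text \<open>Outside degree \<open>0\<close>, the cohomology is isomorphic to a zero space.\<close>
lemma Z_imp_B: "i \<noteq> 0 \<Longrightarrow> z \<in> Z i \<Longrightarrow> z \<in> B i"
proof -
  assume i: "i \<noteq> 0" and z: "z \<in> Z i"
  interpret abelian_group "V i" by (rule abelian_V)
  have "coset i z \<in> coset i ` Z i" "coset i \<zero>\<^bsub>V i\<^esub> \<in> coset i ` Z i"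
    using z B_Z[OF B_zero] by auto
  then have "coset i z = coset i \<zero>\<^bsub>V i\<^esub>"
    using cohomology_zero[OF i] by (metis card_1_singletonE singletonD)
  moreover have "z \<in> coset i z" using coset_self z by (auto simp: Z_iff)
  ultimately show ?thesis using B_sub by (auto simp: coset_def)
qed

end

lemma bar_sign_snd: "bar_sign (us @ (i, x) # vs) = bar_sign (us @ (i, y) # vs)"
  by (simp add: bar_sign_append)

lemma split_three: "take r w @ take s (drop r w) @ drop (r + s) w = w"
  by (metis append_take_drop_id drop_drop add.commute)

lemma length_le_concat: "[] \<notin> set B \<Longrightarrow> length B \<le> length (concat B)"
proof (induction B)
  case (Cons b B) then show ?case by (cases b) auto
qed simp

text \<open>Sums over infinite index sets are zero by convention, so finiteness has to be checked.\<close>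
lemma finite_partitions: "finite {B. concat B = xs \<and> [] \<notin> set B}"
proof (rule finite_subset)
  let ?P = "{ys. set ys \<subseteq> set xs \<and> length ys \<le> length xs}"
  show "{B. concat B = xs \<and> [] \<notin> set B} \<subseteq> {B. set B \<subseteq> ?P \<and> length B \<le> length xs}"
  proof
    fix B assume "B \<in> {B. concat B = xs \<and> [] \<notin> set B}"
    then have B: "concat B = xs" "[] \<notin> set B" by auto
    have "set B \<subseteq> ?P"
    proof
      fix ys assume "ys \<in> set B"
      then obtain us vs where "B = us @ ys # vs" by (meson split_list)
      then show "ys \<in> ?P" using B by auto
    qed
    then show "B \<in> {B. set B \<subseteq> ?P \<and> length B \<le> length xs}" using length_le_concat[OF B(2)] B by auto
  qed
  show "finite {B. set B \<subseteq> ?P \<and> length B \<le> length xs}"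
    by (intro finite_lists_length_le) simp
qed

context degree_zero_cohomology begin

definition \<mu> :: "(int \<times> 'b) list \<Rightarrow> 'b" where
  "\<mu> ys = signed (V (output_degree 2 ys)) (bar_sign ys) (m ys)"

lemma \<mu>_multilinear: "multilinear_family K V V 2 \<mu>"
  unfolding multilinear_family_def
proof (intro allI impI, elim conjE)
  fix us i vs assume h: "homogeneous V us" "homogeneous V vs"
  let ?k = "output_degree 2 us + i - 1 + output_degree 0 vs"
  have k: "output_degree 2 (us @ (i, x) # vs) = ?k" for x
    by (simp add: output_degree_shifted)
  have "linear_map K (V i) (V ?k) (\<lambda>x. m (us @ (i, x) # vs))"
    using m_linear[OF h, of i undefined] by (simp only: k)
  note lin = linear_map_signed_comp[OF this module_V]
  define N where "N = bar_sign (us @ (i, undefined) # vs)"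
  have N: "bar_sign (us @ (i, x) # vs) = N" for x unfolding N_def by (rule bar_sign_snd)
  show "linear_map K (V i) (V ?k) (\<lambda>x. \<mu> (us @ (i, x) # vs))"
    unfolding \<mu>_def k N by (rule lin)
qed

text \<open>
  The map \<open>p\<close> is the given isomorphism applied to the class of \<open>e x\<close>, so that it is defined on all of
  \<open>X\<close> in degree \<open>0\<close> and not only on cocycles.
\<close>
lemma twisting_data: "\<exists>h e. A_infinity_twisting K A V \<mu> h e (\<lambda>x. \<phi> 0 (coset 0 (e 0 x))) \<and>
   (\<forall>z\<in>Z 0. coset 0 (e 0 z) = coset 0 z)"
proof -
  obtain h e where h: "\<And>i. linear_map K (V i) (V (i - 1)) (h i)"
    and e: "\<And>i. linear_map K (V i) (V i) (e i)"
    and homotopy: "\<And>i x. x \<in> carrier (V i) \<Longrightarrow>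
      d (i - 1) (h i x) \<oplus>\<^bsub>V i\<^esub> h (i + 1) (d i x) \<oplus>\<^bsub>V i\<^esub> e i x = x"
    and d_e: "\<And>i x. x \<in> carrier (V i) \<Longrightarrow> d i (e i x) = \<zero>\<^bsub>V (i + 1)\<^esub>"
    and e_d: "\<And>i x. x \<in> carrier (V i) \<Longrightarrow> e (i + 1) (d i x) = \<zero>\<^bsub>V (i + 1)\<^esub>"
    and e_zero: "\<And>i x. (\<And>z. z \<in> carrier (V i) \<Longrightarrow> d i z = \<zero>\<^bsub>V (i + 1)\<^esub> \<Longrightarrow>
        \<exists>y\<in>carrier (V (i - 1)). z = d (i - 1) y) \<Longrightarrow> x \<in> carrier (V i) \<Longrightarrow> e i x = \<zero>\<^bsub>V i\<^esub>"
    by (rule contraction_exists[OF field_K module_V d_linear d_d]) blast+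
  note ecl = linear_map_closed[OF e]
  have eZ: "e 0 x \<in> Z 0" if "x \<in> carrier (V 0)" for x
    using d_e[OF that] ecl[OF that] by (simp add: Z_iff)
  have coset_e: "coset 0 (e 0 z) = coset 0 z" if z: "z \<in> Z 0" for z
  proof -
    interpret abelian_group "V 0" by (rule abelian_V)
    have "h 1 (\<zero>\<^bsub>V 1\<^esub>) = \<zero>\<^bsub>V 0\<^esub>" using linear_map_zero[OF h[of 1] abelian_V abelian_V] by simp
    then have "z = d (- 1) (h 0 z) \<oplus>\<^bsub>V 0\<^esub> e 0 z"
      using homotopy[of z 0] z linear_map_closed[OF h[of 0]] linear_map_closed[OF d_linear[of "- 1"]]
      by (auto simp: Z_iff)
    moreover have "d (- 1) (h 0 z) \<in> B 0"
      using d_B[of "h 0 z" 0] linear_map_closed[OF h[of 0]] z by (auto simp: Z_iff)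
    ultimately show ?thesis using coset_shift[of _ 0 "e 0 z"] ecl z by (metis Z_iff)
  qed
  let ?p = "\<lambda>x. \<phi> 0 (coset 0 (e 0 x))"
  have \<mu>1: "\<mu> [(i, x)] = d i x" for i x by (simp add: \<mu>_def d_def signed_def)
  have \<mu>2: "\<mu> [(0, x), (0, y)] = m [(0, x), (0, y)]" for x y by (simp add: \<mu>_def signed_def)
  interpret tw: twisting K A V \<mu> h e ?p
  proof (rule twisting.intro[OF kalgebra_axioms twisting_axioms.intro])
    show "module K (V i)" for i by (rule module_V)
    show "multilinear_family K V V 2 \<mu>" by (rule \<mu>_multilinear)
    show "linear_map K (V i) (V (i - 1)) (h i)" for i by (rule h)
    show "linear_map K (V i) (V i) (e i)" for i by (rule e)
    show "linear_map K (V 0) A ?p"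
    proof (rule linear_mapI)
      have c: "coset 0 (e 0 x) \<in> carrier (cohomology_space X 0)" if "x \<in> carrier (V 0)" for x
        using eZ[OF that] by (simp add: carrier_cohomology)
      fix x assume x: "x \<in> carrier (V 0)"
      show "?p x \<in> carrier A" by (rule linear_map_closed[OF \<phi>_linear c[OF x]])
      show "?p (x \<oplus>\<^bsub>V 0\<^esub> y) = ?p x \<oplus> ?p y" if y: "y \<in> carrier (V 0)" for y
        using linear_map_add[OF \<phi>_linear c[OF x] c[OF y]] add_cohomology[OF ecl[OF x] ecl[OF y]]
        by (simp add: linear_map_add[OF e x y])
      show "?p (a \<odot>\<^bsub>V 0\<^esub> x) = a \<odot> ?p x" if a: "a \<in> carrier K" for a
        using linear_map_smult[OF \<phi>_linear a c[OF x]] smult_cohomology[OF a ecl[OF x]]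
        by (simp add: linear_map_smult[OF e a x])
    qed
    show "\<mu> [(i - 1, h i x)] \<oplus>\<^bsub>V i\<^esub> h (i + 1) (\<mu> [(i, x)]) \<oplus>\<^bsub>V i\<^esub> e i x = x"
      if "x \<in> carrier (V i)" for i x using homotopy[OF that] by (simp add: \<mu>1)
    show "\<mu> [(i, e i x)] = \<zero>\<^bsub>V (i + 1)\<^esub>" if "x \<in> carrier (V i)" for i x using d_e[OF that] by (simp add: \<mu>1)
    show "e (i + 1) (\<mu> [(i, x)]) = \<zero>\<^bsub>V (i + 1)\<^esub>" if "x \<in> carrier (V i)" for i x using e_d[OF that] by (simp add: \<mu>1)
    show "e i x = \<zero>\<^bsub>V i\<^esub>" if "i \<noteq> 0" "x \<in> carrier (V i)" for i x
      using e_zero[OF _ that(2)] Z_imp_B[OF that(1)] by (metis Z_iff B_iff)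
    show "?p (\<mu> [(- 1, x)]) = \<zero>" if x: "x \<in> carrier (V (- 1))" for x
    proof -
      have "e 0 (d (- 1) x) = \<zero>\<^bsub>V 0\<^esub>" using e_d[OF x] by simp
      moreover have "\<phi> 0 (coset 0 \<zero>\<^bsub>V 0\<^esub>) = \<zero>"
      proof -
        interpret V0: abelian_group "V 0" by (rule abelian_V)
        have c: "coset 0 \<zero>\<^bsub>V 0\<^esub> \<in> carrier (cohomology_space X 0)"
          using B_Z[OF B_zero] by (simp add: carrier_cohomology)
        have "\<phi> 0 (coset 0 \<zero>\<^bsub>V 0\<^esub>) = \<phi> 0 (coset 0 \<zero>\<^bsub>V 0\<^esub>) \<oplus> \<phi> 0 (coset 0 \<zero>\<^bsub>V 0\<^esub>)"
          using linear_map_add[OF \<phi>_linear c c] by (simp add: add_cohomology)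
        then show ?thesis using linear_map_closed[OF \<phi>_linear c] M.add.l_cancel_one' by metis
      qed
      ultimately show ?thesis by (simp add: \<mu>1)
    qed
    show "?p (\<mu> [(0, e 0 x), (0, e 0 y)]) = ?p (e 0 x) \<otimes> ?p (e 0 y)"
      if "x \<in> carrier (V 0)" "y \<in> carrier (V 0)" for x y
      using \<phi>_mult[OF eZ eZ, OF that] coset_e[OF m2_Z[OF eZ eZ, OF that]]
        coset_e[OF eZ[OF that(1)]] coset_e[OF eZ[OF that(2)]]
      by (simp add: \<mu>2)
  qed
  have "A_infinity_twisting K A V \<mu> h e ?p"
  proof (rule A_infinity_twisting.intro[OF tw.twisting_axioms A_infinity_twisting_axioms.intro])
    fix w assume w: "list_all tw.hom w" "w \<noteq> []"
    let ?k = "shifted_degree w + 3"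
    let ?S = "{(r, s). 1 \<le> s \<and> r + s \<le> length w}"
    let ?ys = "\<lambda>r s. take s (drop r w)"
    let ?t = "\<lambda>r s. m (take r w @ (output_degree 2 (?ys r s), m (?ys r s)) # drop (r + s) w)"
    let ?g = "\<lambda>r s. signed (V ?k) (int (length (take r w)) + int s * int (length (drop (r + s) w))
       + (2 - int s) * total_degree (take r w)) (?t r s)"
    have main: "signed (V ?k) (shifted_degree (take r w)) (\<mu> (take r w @ tw.M (?ys r s) # drop (r + s) w))
        = signed (V ?k) (bar_sign w) (?g r s) \<and> ?g r s \<in> carrier (V ?k)" if rs: "(r, s) \<in> ?S" for r s
    proof -
      define us ys vs where uyv: "us = take r w" "ys = ?ys r s" "vs = drop (r + s) w"
      have wsp: "us @ ys @ vs = w" by (simp add: uyv split_three)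
      have len: "length us = r" "length ys = s" using rs by (auto simp: uyv)
      have hm: "homogeneous V us" "homogeneous V ys" "homogeneous V vs"
        using w(1) unfolding tw.homogeneous_iff wsp[symmetric] by auto
      have ne: "ys \<noteq> []" using len rs by auto
      let ?j = "output_degree 2 ys"
      have my: "m ys \<in> carrier (V ?j)" by (rule m_closed[OF hm(2) ne])
      have k: "output_degree 2 (us @ (?j, y) # vs) = ?k" for y
        by (simp add: output_degree_shifted wsp[symmetric])
      have lm: "linear_map K (V ?j) (V ?k) (\<lambda>x. m (us @ (?j, x) # vs))"
        using m_linear[OF hm(1,3), of ?j undefined] k by simp
      let ?T = "m (us @ (?j, m ys) # vs)"
      define N where "N = bar_sign (us @ (?j, m ys) # vs)"
      have N: "bar_sign (us @ (?j, x) # vs) = N" for x unfolding N_def by (rule bar_sign_snd)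
      have Tc: "?T \<in> carrier (V ?k)" by (rule linear_map_closed[OF lm my])
      have "\<mu> (us @ tw.M ys # vs) = signed (V ?k) N (signed (V ?k) (bar_sign ys) ?T)"
        using linear_map_signed[OF lm abelian_V abelian_V my]
        unfolding tw.M_def \<mu>_def k N by simp
      then have "signed (V ?k) (shifted_degree us) (\<mu> (us @ tw.M ys # vs)) =
         signed (V ?k) (shifted_degree us + (bar_sign (us @ (?j, m ys) # vs) + bar_sign ys)) ?T"
        unfolding N using Tc by (simp add: signed_signed[OF abelian_V])
      also have "\<dots> = signed (V ?k) (bar_sign (us @ ys @ vs) + (int (length us) + int (length ys) * int (length vs)
      + (2 - int (length ys)) * total_degree us)) ?T"
        by (rule signed_cong, rule bar_sign_insert)
      finally show ?thesis using Tc signed_closed[OF abelian_V Tc]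
        unfolding wsp len uyv[symmetric] by (simp add: signed_signed[OF abelian_V] wsp uyv)
    qed
    have "(\<Oplus>\<^bsub>V ?k\<^esub>q\<in>?S. case q of (r, s) \<Rightarrow> signed (V ?k) (shifted_degree (take r w))
        (\<mu> (take r w @ tw.M (?ys r s) # drop (r + s) w))) =
      (\<Oplus>\<^bsub>V ?k\<^esub>q\<in>?S. signed (V ?k) (bar_sign w) (case q of (r, s) \<Rightarrow> ?g r s))"
      by (rule abelian_monoid.finsum_cong'[OF abelian_group.axioms(1)[OF abelian_V] refl])
        (use main signed_closed[OF abelian_V] in auto)
    also have "\<dots> = signed (V ?k) (bar_sign w) (\<Oplus>\<^bsub>V ?k\<^esub>q\<in>?S. case q of (r, s) \<Rightarrow> ?g r s)"
      by (rule abelian_group.finsum_additive_endo[OF abelian_V])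
        (use main signed_closed[OF abelian_V] signed_add[OF abelian_V] in auto)
    also have "(\<Oplus>\<^bsub>V ?k\<^esub>q\<in>?S. case q of (r, s) \<Rightarrow> ?g r s) = insertion_sum (V ?k) m m w"
      unfolding insertion_sum_def
      by (rule abelian_monoid.finsum_cong'[OF abelian_group.axioms(1)[OF abelian_V] refl])
        (use main in \<open>auto simp: Let_def\<close>)
    also have "\<dots> = \<zero>\<^bsub>V ?k\<^esub>"
      using A_infinity[of w] w by (simp add: tw.homogeneous_iff output_degree_shifted)
    finally show "(\<Oplus>\<^bsub>V ?k\<^esub>q\<in>?S. case q of (r, s) \<Rightarrow> signed (V ?k) (shifted_degree (take r w))
        (\<mu> (take r w @ tw.M (?ys r s) # drop (r + s) w))) = \<zero>\<^bsub>V ?k\<^esub>"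
      by (simp add: signed_zero[OF abelian_V])
  qed
  then show ?thesis using coset_e by blast
qed

end

section \<open>Intrinsic formality\<close>

lemma (in kalgebra) module_zero: "module K (A\<lparr>carrier := {\<zero>}\<rparr>)"
proof (rule moduleI)
  show "abelian_group (A\<lparr>carrier := {\<zero>}\<rparr>)"
    by (rule abelian_groupI) auto
qed (auto simp: V.R.is_cring smult_r_null)

lemma (in A_infinity_twisting) T_stable: "length w \<le> n \<Longrightarrow> T n w = T (length w) w"
proof (induction n)
  case (Suc n)
  then show ?case by (cases "length w = Suc n") (auto simp: T_Suc_short)
qed simp

context degree_zero_cohomology begin

abbreviation Y where "Y \<equiv> formal_A_infinity (concentrated_in_degree_0 A)"

lemma space_Y: "A_space Y i = (if i = 0 then A else A\<lparr>carrier := {\<zero>}\<rparr>)"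
  by (simp add: formal_A_infinity_def concentrated_in_degree_0_def)

lemma module_Y: "module K (A_space Y i)"
  using module_zero module_axioms by (simp add: space_Y)

lemma zero_Y: "\<zero>\<^bsub>A_space Y i\<^esub> = \<zero>"
  by (simp add: space_Y)

lemma ops_Y_two: "A_ops Y [u, v] = snd u \<otimes> snd v"
  by (cases u, cases v) (simp add: formal_A_infinity_def concentrated_in_degree_0_def)

lemma ops_Y_other: "length bs \<noteq> 2 \<Longrightarrow> A_ops Y bs = \<zero>"
  by (auto simp: formal_A_infinity_def concentrated_in_degree_0_def split: list.splits)

lemma abelian_Y: "abelian_group (A_space Y i)"
  using module_Y module.axioms by blast

lemma finsum_zero_Y: "(\<And>q. q \<in> S \<Longrightarrow> f q = \<zero>) \<Longrightarrow> finsum (A_space Y i) f S = \<zero>"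
proof -
  interpret abelian_group "A_space Y i" by (rule abelian_Y)
  show "(\<And>q. q \<in> S \<Longrightarrow> f q = \<zero>) \<Longrightarrow> finsum (A_space Y i) f S = \<zero>"
    using add.finprod_one_eqI[of S f] by (simp add: zero_Y)
qed

lemma signed_zero_Y: "signed (A_space Y i) k \<zero> = \<zero>"
  using signed_zero[OF abelian_Y, of i k] by (simp add: zero_Y)

text \<open>
  The morphism is the twisting cochain with the bar signs removed. As the target has only a binary
  product, in the morphism equation only the cuts of a word into two blocks contribute; in output
  degrees other than \<open>0\<close> both sides vanish. On cohomology the morphism induces the isomorphism
  that was given.
\<close>
theorem formality: "\<exists>F. A_infinity_quasi_isomorphism K X Y F"
proof -
  obtain h e where "A_infinity_twisting K A V \<mu> h e (\<lambda>x. \<phi> 0 (coset 0 (e 0 x)))"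
    and coset_e: "\<And>z. z \<in> Z 0 \<Longrightarrow> coset 0 (e 0 z) = coset 0 z"
    using twisting_data by blast
  then interpret tw: A_infinity_twisting K A V \<mu> h e "\<lambda>x. \<phi> 0 (coset 0 (e 0 x))" by simp
  define F where "F w = signed A (bar_sign w) (tw.T (length w) w)" for w
  note AA = A.is_abelian_group
  have F_closed: "F w \<in> carrier A" for w by (simp add: F_def signed_closed[OF AA])
  have F_deg: "F w = \<zero>" if "shifted_degree w \<noteq> - 1" for w
    using tw.T_degree[OF that] by (simp add: F_def signed_zero[OF AA])
  have F_n: "F w = signed A (bar_sign w) (tw.T n w)" if "length w \<le> n" for w n
    using tw.T_stable[OF that] by (simp add: F_def)
  have "multilinear_family K V (A_space Y) 1 F"
    unfolding multilinear_family_def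
  proof (intro allI impI, elim conjE)
    fix us i vs assume hm: "homogeneous V us" "homogeneous V vs"
    let ?j = "output_degree 1 us + i - 1 + output_degree 0 vs"
    define N where "N = bar_sign (us @ (i, undefined) # vs)"
    have N: "bar_sign (us @ (i, x) # vs) = N" for x unfolding N_def by (rule bar_sign_snd)
    show "linear_map K (V i) (A_space Y ?j) (\<lambda>x. F (us @ (i, x) # vs))"
    proof (cases "?j = 0")
      case True
      have "lin (V i) (\<lambda>x. tw.T (length us + Suc (length vs)) (us @ (i, x) # vs))"
        by (rule tw.multilinearD[OF tw.multilinear_T]) (use hm in \<open>simp_all add: tw.homogeneous_iff\<close>)
      from linear_map_signed_comp[OF this module_axioms, of N]
      show ?thesis unfolding True by (simp add: F_def N space_Y)
    next
      case False
      then have "F (us @ (i, x) # vs) = \<zero>" for x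
        by (intro F_deg) (simp add: output_degree_shifted)
      then show ?thesis using False by (auto intro!: linear_mapI simp: space_Y smult_r_null)
    qed
  qed
  moreover have "insertion_sum (A_space Y (output_degree 2 xs)) m F xs =
      composition_sum (A_space Y (output_degree 2 xs)) (A_ops Y) F xs"
    if xs: "homogeneous V xs" "xs \<noteq> []" for xs
  proof (cases "output_degree 2 xs = 0")
    case False
    then have deg: "shifted_degree xs \<noteq> - 2" by (simp add: output_degree_shifted)
    have "insertion_sum (A_space Y (output_degree 2 xs)) m F xs = \<zero>"
      unfolding insertion_sum_def
    proof (rule finsum_zero_Y)
      fix q assume "q \<in> {(r, s). 1 \<le> s \<and> r + s \<le> length xs}"
      obtain r s where q: "q = (r, s)" by (cases q)
      have "shifted_degree xs = shifted_degree (take r xs @ take s (drop r xs) @ drop (r + s) xs)"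
        by (simp only: split_three)
      then have "F (take r xs @ (output_degree 2 (take s (drop r xs)), m (take s (drop r xs))) # drop (r + s) xs) = \<zero>"
        using deg by (intro F_deg) (simp add: output_degree_shifted)
      then show "(case q of (r, s) \<Rightarrow> let us = take r xs; ys = take s (drop r xs); vs = drop (r + s) xs
          in signed (A_space Y (output_degree 2 xs)) (int r + int s * int (length vs) + (2 - int s) * total_degree us)
               (F (us @ (output_degree 2 ys, m ys) # vs))) = \<zero>"
        by (simp add: q Let_def signed_zero_Y)
    qed
    moreover have "composition_sum (A_space Y (output_degree 2 xs)) (A_ops Y) F xs = \<zero>"
      unfolding composition_sum_def
    proof (rule finsum_zero_Y)
      fix Bl assume Bl: "Bl \<in> {B. concat B = xs \<and> [] \<notin> set B}"
      have "A_ops Y (map (\<lambda>ys. (output_degree 1 ys, F ys)) Bl) = \<zero>"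
      proof (cases "length Bl = 2")
        case True
        then obtain us vs where uv: "Bl = [us, vs]" by (auto simp: length_Suc_conv numeral_2_eq_2)
        then have "shifted_degree us \<noteq> - 1 \<or> shifted_degree vs \<noteq> - 1" using Bl deg by auto
        then show ?thesis using F_closed F_deg by (auto simp: uv ops_Y_two)
      qed (simp add: ops_Y_other)
      then show "signed (A_space Y (output_degree 2 xs))
          (\<Sum>j<length Bl. int (length Bl - 1 - j) * (int (length (Bl ! j)) - 1) +
            (1 - int (length (Bl ! j))) * total_degree (concat (take j Bl)))
          (A_ops Y (map (\<lambda>ys. (output_degree 1 ys, F ys)) Bl)) = \<zero>"
        by (simp add: signed_zero_Y)
    qed
    ultimately show ?thesis by simp
  next
    case True
    then have deg: "shifted_degree xs = - 2" by (simp add: output_degree_shifted)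
    have hom: "list_all tw.hom xs" using xs by (simp add: tw.homogeneous_iff)
    let ?n = "length xs"
    let ?T = "tw.T ?n"
    let ?S = "{(r, s). 1 \<le> s \<and> r + s \<le> ?n}"
    let ?b = "signed A (bar_sign xs)"
    have b_add: "?b (x \<oplus> y) = ?b x \<oplus> ?b y" if "x \<in> carrier A" "y \<in> carrier A" for x y
      using that by (rule signed_add[OF AA])
    have "insertion_sum A m F xs = (\<Oplus>q\<in>?S. ?b (case q of (r, s) \<Rightarrow>
      flip (tw.par (take r xs)) (?T (take r xs @ tw.M (take s (drop r xs)) # drop (r + s) xs))))"
      unfolding insertion_sum_def
    proof (rule finsum_cong')
      fix q assume qS: "q \<in> ?S"
      then obtain r s where q: "q = (r, s)" and rs: "1 \<le> s" "r + s \<le> ?n" by auto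
      define us ys vs where uyv: "us = take r xs" "ys = take s (drop r xs)" "vs = drop (r + s) xs"
      have sp: "us @ ys @ vs = xs" by (simp add: uyv split_three)
      have len: "length us = r" "length ys = s" using rs by (auto simp: uyv)
      have hm: "homogeneous V us" "homogeneous V ys" "homogeneous V vs"
        using hom unfolding tw.homogeneous_iff sp[symmetric] by auto
      have ne: "ys \<noteq> []" using len rs by auto
      let ?j = "output_degree 2 ys"
      have my: "m ys \<in> carrier (V ?j)" by (rule m_closed[OF hm(2) ne])
      have lT: "lin (V ?j) (\<lambda>x. ?T (us @ (?j, x) # vs))"
        by (rule tw.multilinearD[OF tw.multilinear_T]) (use hm in \<open>simp_all add: tw.homogeneous_iff\<close>)
      let ?t = "?T (us @ (?j, m ys) # vs)"
      have "?T (us @ tw.M ys # vs) = signed A (bar_sign ys) ?t"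
        using linear_map_signed[OF lT abelian_V AA my] by (simp add: tw.M_def \<mu>_def)
      then have "?b (flip (tw.par us) (?T (us @ tw.M ys # vs))) =
          signed A (bar_sign xs + (shifted_degree us + bar_sign ys)) ?t"
        by (simp add: tw.par_iff signed_def flip_def)
      also have "\<dots> = signed A ((int (length us) + int (length ys) * int (length vs)
      + (2 - int (length ys)) * total_degree us) + bar_sign (us @ (?j, m ys) # vs)) ?t"
      proof (rule signed_cong)
        have *: "even ((x + (y + z)) - (u + v)) \<Longrightarrow> even ((u + (x + z)) - (v + y))" for x y z u v :: int
          by presburger
        show "even (bar_sign xs + (shifted_degree us + bar_sign ys) - (int (length us) + int (length ys) * int (length vs) +
            (2 - int (length ys)) * total_degree us + bar_sign (us @ (?j, m ys) # vs)))"
          by (rule *) (rule bar_sign_insert[of us ys "m ys" vs, unfolded sp])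
      qed
      also have "\<dots> = signed A (int (length us) + int (length ys) * int (length vs)
      + (2 - int (length ys)) * total_degree us) (F (us @ (?j, m ys) # vs))"
      proof -
        have "length (us @ (?j, m ys) # vs) \<le> ?n" using len rs sp by (metis One_nat_def Suc_leI add_le_mono le_refl length_Cons length_append nat_add_left_cancel_le plus_1_eq_Suc)
        then show ?thesis by (simp add: F_n signed_signed[OF AA])
      qed
      finally show "(case q of (r, s) \<Rightarrow> let us = take r xs; ys = take s (drop r xs); vs = drop (r + s) xs
          in signed A (int r + int s * int (length vs) + (2 - int s) * total_degree us)
               (F (us @ (output_degree 2 ys, m ys) # vs))) =
         ?b (case q of (r, s) \<Rightarrow>
            flip (tw.par (take r xs)) (?T (take r xs @ tw.M (take s (drop r xs)) # drop (r + s) xs)))"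
        unfolding q len prod.case Let_def uyv[symmetric] by simp
    qed (auto simp: signed_closed[OF AA])
    also have "\<dots> = ?b (\<Oplus>q\<in>?S. case q of (r, s) \<Rightarrow>
      flip (tw.par (take r xs)) (?T (take r xs @ tw.M (take s (drop r xs)) # drop (r + s) xs)))"
      by (rule finsum_additive_endo) (auto simp: b_add signed_closed[OF AA])
    also have "\<dots> = ?b (tw.D ?T xs)"
      by (subst tw.D_finsum) auto
    also have "\<dots> = ?b (cup ?T ?T xs)"
      using tw.twisting_equation[OF hom, of ?n] by simp
    finally have L: "insertion_sum A m F xs = ?b (cup ?T ?T xs)" .
    let ?P = "{B. concat B = xs \<and> [] \<notin> set B}"
    define trm where "trm B = signed A
          (\<Sum>j<length B. int (length B - 1 - j) * (int (length (B ! j)) - 1) +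
            (1 - int (length (B ! j))) * total_degree (concat (take j B)))
          (A_ops Y (map (\<lambda>ys. (output_degree 1 ys, F ys)) B))" for B
    let ?c = "\<lambda>k. [take k xs, drop k xs]"
    let ?I = "{0<..<?n}"
    have cI: "?c ` ?I \<subseteq> ?P" by auto
    have trm0: "trm B = \<zero>" if "B \<in> ?P - ?c ` ?I" for B
    proof -
      have "length B \<noteq> 2"
      proof
        assume "length B = 2"
        then obtain us vs where uv: "B = [us, vs]" by (auto simp: length_Suc_conv numeral_2_eq_2)
        then have "B = ?c (length us)" "length us \<in> ?I" using that by auto
        then show False using that by blast
      qed
      then show ?thesis by (simp add: trm_def ops_Y_other signed_zero[OF AA])
    qed
    have trm_c: "trm (?c k) = ?b (?T (take k xs) \<otimes> ?T (drop k xs))" if k: "k \<in> ?I" for k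
    proof -
      define us vs where uv: "us = take k xs" "vs = drop k xs"
      have sp: "us @ vs = xs" by (simp add: uv)
      have Fu: "F us = signed A (bar_sign us) (?T us)" and Fv: "F vs = signed A (bar_sign vs) (?T vs)"
        by (auto intro!: F_n simp: uv)
      have "trm (?c k) = signed A ((int (length us) - 1) + (1 - int (length vs)) * total_degree us)
          (F us \<otimes> F vs)"
        by (simp add: trm_def uv[symmetric] ops_Y_two numeral_2_eq_2 total_degree_def[of "[]"])
      also have "F us \<otimes> F vs = signed A (bar_sign us + bar_sign vs) (?T us \<otimes> ?T vs)"
        unfolding Fu Fv by (auto simp: signed_def l_minus r_minus)
      also have "signed A ((int (length us) - 1) + (1 - int (length vs)) * total_degree us) \<dots>
        = signed A (((int (length us) - 1) + (1 - int (length vs)) * total_degree us) + (bar_sign us + bar_sign vs))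
            (?T us \<otimes> ?T vs)"
        by (simp add: signed_signed[OF AA])
      also have "\<dots> = ?b (?T us \<otimes> ?T vs)"
      proof (cases "shifted_degree us = - 1")
        case False
        then show ?thesis by (simp add: tw.T_degree signed_zero[OF AA])
      next
        case True
        then have t: "total_degree us = int (length us) - 1" by (simp add: shifted_degree_def)
        have "((int (length us) - 1) + (1 - int (length vs)) * total_degree us) + (bar_sign us + bar_sign vs)
           - bar_sign xs = 2 * ((int (length us) - 1) * (1 - int (length vs)))"
          unfolding sp[symmetric] by (simp add: bar_sign_append t algebra_simps)
        then have "even (((int (length us) - 1) + (1 - int (length vs)) * total_degree us) + (bar_sign us + bar_sign vs)
           - bar_sign xs)" by (simp only: dvd_triv_left)
        then show ?thesis by (rule signed_cong)
      qed
      finally show ?thesis by (simp only: uv)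
    qed
    have opc: "A_ops Y (map (\<lambda>ys. (output_degree 1 ys, F ys)) B) \<in> carrier A" for B
    proof (cases "length B = 2")
      case True
      then obtain us vs where "B = [us, vs]" by (auto simp: length_Suc_conv numeral_2_eq_2)
      then show ?thesis by (simp add: ops_Y_two F_closed)
    qed (simp add: ops_Y_other)
    have trm_closed: "trm B \<in> carrier A" for B
      unfolding trm_def by (rule signed_closed[OF AA opc])
    have "composition_sum A (A_ops Y) F xs = finsum A trm ?P"
      unfolding composition_sum_def trm_def[abs_def] ..
    also have "\<dots> = finsum A trm (?c ` ?I)"
      by (rule M.add.finprod_mono_neutral_cong_right)
        (use cI trm0 trm_closed finite_partitions in auto)
    also have "\<dots> = (\<Oplus>k\<in>?I. trm (?c k))"
    proof (rule finsum_reindex)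
      show "inj_on ?c ?I"
        by (rule inj_onI) (metis greaterThanLessThan_iff length_take less_or_eq_imp_le list.inject min.absorb2)
    qed (simp add: trm_closed)
    also have "\<dots> = (\<Oplus>k\<in>?I. ?b (?T (take k xs) \<otimes> ?T (drop k xs)))"
      by (rule finsum_cong') (auto simp: trm_c signed_closed[OF AA])
    also have "\<dots> = ?b (\<Oplus>k\<in>?I. ?T (take k xs) \<otimes> ?T (drop k xs))"
      by (rule finsum_additive_endo) (auto simp: b_add signed_closed[OF AA])
    also have "(\<Oplus>k\<in>?I. ?T (take k xs) \<otimes> ?T (drop k xs)) = (\<Oplus>k\<in>{..?n}. ?T (take k xs) \<otimes> ?T (drop k xs))"
    proof (rule M.add.finprod_mono_neutral_cong_left)
      fix k assume "k \<in> {..?n} - ?I"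
      then have "k = 0 \<or> k = ?n" by auto
      then show "?T (take k xs) \<otimes> ?T (drop k xs) = \<zero>" by auto
    qed auto
    also have "\<dots> = cup ?T ?T xs"
      unfolding cup_def by (rule cuts_finsum[symmetric]) simp
    finally show ?thesis unfolding True space_Y using L by simp
  qed
  ultimately have "A_infinity_morphism K X Y F"
    by (simp add: A_infinity_morphism_def)
  moreover have "bij_betw (cohomology_map Y F i) (carrier (cohomology_space X i)) (carrier (cohomology_space Y i))" for i
  proof -
    have cb: "coboundaries Y j = {\<zero>}" for j
    proof -
      have "carrier (A_space Y (j - 1)) \<noteq> {}" by (auto simp: space_Y)
      then show ?thesis by (auto simp: coboundaries_def ops_Y_other)
    qed
    have cz: "cocycles Y j = carrier (A_space Y j)" for j
      by (auto simp: cocycles_def ops_Y_other zero_Y)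
    have cY: "carrier (cohomology_space Y i) = (\<lambda>a. {a}) ` carrier (A_space Y i)"
      by (auto simp: cohomology_space_def quotient_module_def FactRing_def A_RCOSETS_def' cb cz
          a_r_coset_def' space_Y split: if_splits)
    show ?thesis
    proof (cases "i = 0")
      case False
      obtain C where C: "coset i ` Z i = {C}" using cohomology_zero[OF False] by (auto simp: card_1_singleton_iff)
      have "coset i \<zero>\<^bsub>V i\<^esub> \<in> {C}" using B_Z[OF B_zero[of i]] unfolding C[symmetric] by (rule imageI)
      then have "C \<noteq> {}" using coset_self[OF B_sub[OF B_zero[of i]]] by auto
      then have "cohomology_map Y F i C = {\<zero>}"
        using False by (auto simp: cohomology_map_def cb a_r_coset_def' space_Y F_deg)
      then show ?thesis unfolding carrier_cohomology cY C using False
        by (simp add: space_Y bij_betw_def)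
    next
      case True
      have cm: "cohomology_map Y F 0 (coset 0 z) = {\<phi> 0 (coset 0 z)}" if z: "z \<in> Z 0" for z
      proof -
        have "F [(0, x)] = \<phi> 0 (coset 0 z)" if x: "x \<in> coset 0 z" for x
        proof -
          obtain b where b: "b \<in> B 0" "x = b \<oplus>\<^bsub>V 0\<^esub> z" using x by (auto simp: coset_def)
          have zc: "z \<in> carrier (V 0)" "b \<in> carrier (V 0)" "b \<in> Z 0" using z b B_sub B_Z by (auto simp: Z_iff)
          interpret V0: abelian_group "V 0" by (rule abelian_V)
          interpret V1: abelian_group "V 1" by (rule abelian_V)
          have xZ: "x \<in> Z 0" using zc z b linear_map_add[OF d_linear[of 0] zc(2,1)] by (simp add: Z_iff)
          then have xV: "x \<in> carrier (V 0)" by (simp add: Z_iff)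
          then have "F [(0, x)] = \<phi> 0 (coset 0 (e 0 x))"
            using linear_map_closed[OF tw.p_linear xV]
            by (simp add: F_def tw.T_Suc tw.base_def signed_def)
          also have "\<dots> = \<phi> 0 (coset 0 z)"
            using coset_e[OF xZ] coset_shift[OF b(1) zc(1)] b by simp
          finally show ?thesis .
        qed
        moreover have "\<phi> 0 (coset 0 z) \<in> carrier A" using \<phi>_bij z by (auto simp: bij_betw_def)
        ultimately show ?thesis using coset_self[of z 0] z
          by (auto simp: cohomology_map_def cb a_r_coset_def' space_Y Z_iff)
      qed
      have "bij_betw ((\<lambda>a. {a}) \<circ> \<phi> 0) (coset 0 ` Z 0) ((\<lambda>a. {a}) ` carrier A)"
        by (rule bij_betw_trans[OF \<phi>_bij]) (simp add: bij_betw_def inj_on_def)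
      then have "bij_betw (cohomology_map Y F 0) (coset 0 ` Z 0) ((\<lambda>a. {a}) ` carrier A)"
        by (rule bij_betw_cong[THEN iffD1, rotated]) (auto simp: cm)
      then show ?thesis using True cY by (simp add: carrier_cohomology space_Y)
    qed
  qed
  ultimately show ?thesis unfolding A_infinity_quasi_isomorphism_def by blast
qed

end

theorem (in kalgebra) intrinsically_formal_concentrated:
  assumes "field K"
  shows "intrinsically_formal TYPE('b) K (concentrated_in_degree_0 A)"
  unfolding intrinsically_formal_def
proof (intro allI impI, elim conjE exE)
  fix X :: "('k, 'b) A_infinity" and \<phi>
  assume "A_infinity_algebra K X" "graded_algebra_iso K (cohomology X) (concentrated_in_degree_0 A) \<phi>"
  then have "degree_zero_cohomology K A X \<phi>"
    using assms by (intro degree_zero_cohomology.intro degree_zero_cohomology_axioms.intro kalgebra_axioms)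
  then show "\<exists>F. A_infinity_quasi_isomorphism K X (formal_A_infinity (concentrated_in_degree_0 A)) F"
    by (rule degree_zero_cohomology.formality)
qed

section \<open>Power series and bilinear maps\<close>

text \<open>The series \<open>t\<^sup>n x\<close>, for coefficients with zero element \<open>z\<close>.\<close>

definition shift :: "'u \<Rightarrow> nat \<Rightarrow> (nat \<Rightarrow> 'u) \<Rightarrow> nat \<Rightarrow> 'u" where
  "shift z n x = (\<lambda>i. if i < n then z else x (i - n))"

definition const :: "'u \<Rightarrow> 'u \<Rightarrow> nat \<Rightarrow> 'u" where
  "const z a = (\<lambda>i. if i = 0 then a else z)"

lemma shift_simps [simp]: "shift z (Suc 0) x 0 = z" "shift z (Suc 0) x (Suc i) = x i"
  by (auto simp: shift_def)

lemma const_simps [simp]: "const z a 0 = a" "const z a (Suc i) = z"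
  by (auto simp: const_def)

definition series :: "('u, 'm) ring_scheme \<Rightarrow> (nat \<Rightarrow> 'u) set" where
  "series U = {x. \<forall>i. x i \<in> carrier U}"

lemma seriesI: "(\<And>i. x i \<in> carrier U) \<Longrightarrow> x \<in> series U"
  by (simp add: series_def)

lemma seriesD [simp]: "x \<in> series U \<Longrightarrow> x i \<in> carrier U"
  by (simp add: series_def)

lemma (in abelian_group) series_closed:
  "x \<in> series G \<Longrightarrow> shift \<zero> n x \<in> series G"
  "a \<in> carrier G \<Longrightarrow> const \<zero> a \<in> series G"
  "x \<in> series G \<Longrightarrow> y \<in> series G \<Longrightarrow> (\<lambda>i. x i \<oplus> y i) \<in> series G"
  by (auto intro!: seriesI simp: shift_def const_def)

lemma (in abelian_group) series_split:
  "x \<in> series G \<Longrightarrow> x = (\<lambda>i. const \<zero> (x 0) i \<oplus> shift \<zero> 1 (\<lambda>i. x (Suc i)) i)"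
proof
  fix i assume "x \<in> series G"
  then show "x i = const \<zero> (x 0) i \<oplus> shift \<zero> 1 (\<lambda>i. x (Suc i)) i" by (cases i) auto
qed

text \<open>\<open>k[t]\<close>-bilinear maps, phrased without a module structure on the series.\<close>

definition (in kalgebra) t_bilinear ::
  "('u, 'm) ring_scheme \<Rightarrow> ('v, 'n) ring_scheme \<Rightarrow> ((nat \<Rightarrow> 'u) \<Rightarrow> (nat \<Rightarrow> 'v) \<Rightarrow> nat \<Rightarrow> 'a) \<Rightarrow> bool" where
  "t_bilinear U W \<beta> \<longleftrightarrow>
    (\<forall>x\<in>series U. \<forall>y\<in>series W. \<beta> x y \<in> series A \<and>
      \<beta> (shift \<zero>\<^bsub>U\<^esub> 1 x) y = shift \<zero> 1 (\<beta> x y) \<and> \<beta> x (shift \<zero>\<^bsub>W\<^esub> 1 y) = shift \<zero> 1 (\<beta> x y) \<and>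
      (\<forall>x'\<in>series U. \<beta> (\<lambda>i. x i \<oplus>\<^bsub>U\<^esub> x' i) y = (\<lambda>i. \<beta> x y i \<oplus> \<beta> x' y i)) \<and>
      (\<forall>y'\<in>series W. \<beta> x (\<lambda>i. y i \<oplus>\<^bsub>W\<^esub> y' i) = (\<lambda>i. \<beta> x y i \<oplus> \<beta> x y' i)))"

lemma (in kalgebra) t_bilinearD:
  assumes "t_bilinear U W \<beta>" "x \<in> series U" "y \<in> series W"
  shows "\<beta> x y \<in> series A" "\<beta> (shift \<zero>\<^bsub>U\<^esub> 1 x) y = shift \<zero> 1 (\<beta> x y)"
    "\<beta> x (shift \<zero>\<^bsub>W\<^esub> 1 y) = shift \<zero> 1 (\<beta> x y)"
    "x' \<in> series U \<Longrightarrow> \<beta> (\<lambda>i. x i \<oplus>\<^bsub>U\<^esub> x' i) y = (\<lambda>i. \<beta> x y i \<oplus> \<beta> x' y i)"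
    "y' \<in> series W \<Longrightarrow> \<beta> x (\<lambda>i. y i \<oplus>\<^bsub>W\<^esub> y' i) = (\<lambda>i. \<beta> x y i \<oplus> \<beta> x y' i)"
  using assms unfolding t_bilinear_def by blast+

text \<open>
  Write \<open>x = x\<^sub>0 + t x'\<close> and \<open>y = y\<^sub>0 + t y'\<close>. The coefficient at \<open>t\<^bsup>n+1\<^esup>\<close> involves the constant parts
  and coefficients at \<open>t\<^sup>n\<close>, so an induction on \<open>n\<close> compares the two maps; continuity is automatic.
\<close>
lemma (in kalgebra) t_bilinear_eqI:
  assumes U: "abelian_group U" and W: "abelian_group W"
    and \<beta>: "t_bilinear U W \<beta>" and \<gamma>: "t_bilinear U W \<gamma>"
    and const: "\<And>a b. a \<in> carrier U \<Longrightarrow> b \<in> carrier W \<Longrightarrow>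
      \<beta> (const \<zero>\<^bsub>U\<^esub> a) (const \<zero>\<^bsub>W\<^esub> b) = \<gamma> (const \<zero>\<^bsub>U\<^esub> a) (const \<zero>\<^bsub>W\<^esub> b)"
    and "x \<in> series U" "y \<in> series W"
  shows "\<beta> x y = \<gamma> x y"
proof
  fix i
  interpret U: abelian_group U by fact
  interpret W: abelian_group W by fact
  show "\<beta> x y i = \<gamma> x y i" using assms(6,7)
  proof (induction i arbitrary: x y)
    case (0 x y)
    define c s b r where "c = const \<zero>\<^bsub>U\<^esub> (x 0)" "s = (\<lambda>i. x (Suc i))"
      "b = const \<zero>\<^bsub>W\<^esub> (y 0)" "r = (\<lambda>i. y (Suc i))"
    note d = this
    have m: "c \<in> series U" "s \<in> series U" "b \<in> series W" "r \<in> series W"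
      using 0 by (auto intro!: seriesI simp: d const_def)
    have "\<alpha> x y 0 = \<alpha> c b 0" if \<alpha>: "t_bilinear U W \<alpha>" for \<alpha>
    proof -
      have "\<alpha> x y = (\<lambda>i. \<alpha> c y i \<oplus> shift \<zero> 1 (\<alpha> s y) i)"
        by (subst U.series_split[OF 0(1)], fold d)
          (simp only: t_bilinearD[OF \<alpha>] m 0 U.series_closed)
      then have "\<alpha> x y 0 = \<alpha> c y 0" using t_bilinearD(1)[OF \<alpha> m(1) 0(2)] by simp
      also have "\<alpha> c y = (\<lambda>i. \<alpha> c b i \<oplus> shift \<zero> 1 (\<alpha> c r) i)"
        by (subst W.series_split[OF 0(2)], fold d)
          (simp only: t_bilinearD[OF \<alpha>] m 0 W.series_closed)
      also have "\<dots> 0 = \<alpha> c b 0" using t_bilinearD(1)[OF \<alpha> m(1,3)] by simp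
      finally show ?thesis .
    qed
    from this[OF \<beta>] this[OF \<gamma>] show ?case using const[of "x 0" "y 0"] 0 by (simp add: d)
  next
    case (Suc n x y)
    define c s b r where "c = const \<zero>\<^bsub>U\<^esub> (x 0)" "s = (\<lambda>i. x (Suc i))"
      "b = const \<zero>\<^bsub>W\<^esub> (y 0)" "r = (\<lambda>i. y (Suc i))"
    note d = this
    have m: "c \<in> series U" "s \<in> series U" "b \<in> series W" "r \<in> series W"
      using Suc.prems by (auto intro!: seriesI simp: d const_def)
    have "\<alpha> x y (Suc n) = (\<alpha> c b (Suc n) \<oplus> \<alpha> c r n) \<oplus> \<alpha> s y n" if \<alpha>: "t_bilinear U W \<alpha>" for \<alpha>
    proof -
      have "\<alpha> x y = (\<lambda>i. \<alpha> c y i \<oplus> shift \<zero> 1 (\<alpha> s y) i)"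
        by (subst U.series_split[OF Suc.prems(1)], fold d)
          (simp only: t_bilinearD[OF \<alpha>] m Suc.prems U.series_closed)
      moreover have "\<alpha> c y = (\<lambda>i. \<alpha> c b i \<oplus> shift \<zero> 1 (\<alpha> c r) i)"
        by (subst W.series_split[OF Suc.prems(2)], fold d)
          (simp only: t_bilinearD[OF \<alpha>] m Suc.prems W.series_closed)
      ultimately show ?thesis by simp
    qed
    from this[OF \<beta>] this[OF \<gamma>] show ?case
      using const[of "x 0" "y 0"] Suc m by (simp add: d)
  qed
qed

definition (in kalgebra) conv :: "('u \<Rightarrow> 'v \<Rightarrow> 'a) \<Rightarrow> (nat \<Rightarrow> 'u) \<Rightarrow> (nat \<Rightarrow> 'v) \<Rightarrow> nat \<Rightarrow> 'a" where
  "conv f x y i = (\<Oplus>j\<in>{..i}. f (x j) (y (i - j)))"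

lemma (in kalgebra) t_bilinear_conv:
  assumes U: "abelian_group U" and W: "abelian_group W"
    and f: "\<And>a b. a \<in> carrier U \<Longrightarrow> b \<in> carrier W \<Longrightarrow> f a b \<in> carrier A"
      "\<And>a a' b. a \<in> carrier U \<Longrightarrow> a' \<in> carrier U \<Longrightarrow> b \<in> carrier W \<Longrightarrow> f (a \<oplus>\<^bsub>U\<^esub> a') b = f a b \<oplus> f a' b"
      "\<And>a b b'. a \<in> carrier U \<Longrightarrow> b \<in> carrier W \<Longrightarrow> b' \<in> carrier W \<Longrightarrow> f a (b \<oplus>\<^bsub>W\<^esub> b') = f a b \<oplus> f a b'"
  shows "t_bilinear U W (conv f)"
  unfolding t_bilinear_def
proof (intro ballI conjI ext)
  interpret U: abelian_group U by fact
  interpret W: abelian_group W by fact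
  fix x y assume x: "x \<in> series U" and y: "y \<in> series W"
  have fz: "f \<zero>\<^bsub>U\<^esub> b = \<zero>" if "b \<in> carrier W" for b
    by (rule additive_zero[OF U A.is_abelian_group]) (use that f in auto)
  have fz': "f a \<zero>\<^bsub>W\<^esub> = \<zero>" if "a \<in> carrier U" for a
    by (rule additive_zero[OF W A.is_abelian_group]) (use that f in auto)
  show "conv f x y \<in> series A" using x y f by (auto intro!: seriesI simp: conv_def)
  fix i
  show "conv f (shift \<zero>\<^bsub>U\<^esub> 1 x) y i = shift \<zero> 1 (conv f x y) i"
  proof (cases i)
    case 0 then show ?thesis using x y by (simp add: conv_def fz)
  next
    case (Suc n)
    have "conv f (shift \<zero>\<^bsub>U\<^esub> 1 x) y (Suc n) =
      (\<Oplus>j\<in>{..n}. f (x j) (y (n - j))) \<oplus> f \<zero>\<^bsub>U\<^esub> (y (Suc n))"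
      unfolding conv_def using x y f by (subst finsum_Suc2) (auto simp: shift_def)
    then show ?thesis using Suc x y f by (simp add: conv_def fz)
  qed
  show "conv f x (shift \<zero>\<^bsub>W\<^esub> 1 y) i = shift \<zero> 1 (conv f x y) i"
  proof (cases i)
    case 0 then show ?thesis using x y by (simp add: conv_def fz')
  next
    case (Suc n)
    have "conv f x (shift \<zero>\<^bsub>W\<^esub> 1 y) (Suc n) =
      f (x (Suc n)) \<zero>\<^bsub>W\<^esub> \<oplus> (\<Oplus>j\<in>{..n}. f (x j) (shift \<zero>\<^bsub>W\<^esub> 1 y (Suc n - j)))"
      unfolding conv_def using x y f by (subst finsum_Suc) (auto simp: shift_def)
    also have "(\<Oplus>j\<in>{..n}. f (x j) (shift \<zero>\<^bsub>W\<^esub> 1 y (Suc n - j))) = (\<Oplus>j\<in>{..n}. f (x j) (y (n - j)))"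
      by (rule finsum_cong') (use x y f in \<open>auto simp: shift_def\<close>)
    finally show ?thesis using Suc x y f by (simp add: conv_def fz')
  qed
  show "conv f (\<lambda>i. x i \<oplus>\<^bsub>U\<^esub> x' i) y i = conv f x y i \<oplus> conv f x' y i" if "x' \<in> series U" for x'
    using that x y f by (simp add: conv_def finsum_addf)
  show "conv f x (\<lambda>i. y i \<oplus>\<^bsub>W\<^esub> y' i) i = conv f x y i \<oplus> conv f x y' i" if "y' \<in> series W" for y'
    using that x y f by (simp add: conv_def finsum_addf)
qed

lemma (in kalgebra) conv_const:
  assumes "x \<in> series W" "a \<in> carrier U" "abelian_group U"
    and f: "\<And>a b. a \<in> carrier U \<Longrightarrow> b \<in> carrier W \<Longrightarrow> f a b \<in> carrier A"
      "\<And>b. b \<in> carrier W \<Longrightarrow> f \<zero>\<^bsub>U\<^esub> b = \<zero>"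
  shows "conv f (const \<zero>\<^bsub>U\<^esub> a) x i = f a (x i)"
proof (cases i)
  case 0 then show ?thesis using assms by (simp add: conv_def)
next
  case (Suc n)
  interpret U: abelian_group U by fact
  have "conv f (const \<zero>\<^bsub>U\<^esub> a) x (Suc n) = (\<Oplus>j\<in>{..n}. f \<zero>\<^bsub>U\<^esub> (x (n - j))) \<oplus> f a (x (Suc n))"
    unfolding conv_def using assms by (subst finsum_Suc2) (auto simp: const_def)
  also have "(\<Oplus>j\<in>{..n}. f \<zero>\<^bsub>U\<^esub> (x (n - j))) = \<zero>"
    using assms by (simp add: M.add.finprod_one_eqI)
  finally show ?thesis using Suc assms by simp
qed

definition (in kalgebra) bilinear :: "('a \<Rightarrow> 'a \<Rightarrow> 'a) \<Rightarrow> bool" where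
  "bilinear c \<longleftrightarrow> (\<forall>x\<in>carrier A. linear_map K A A (c x) \<and> linear_map K A A (\<lambda>y. c y x))"

definition (in kalgebra) cocycle :: "('a \<Rightarrow> 'a \<Rightarrow> 'a) \<Rightarrow> bool" where
  "cocycle c \<longleftrightarrow> bilinear c \<and> (\<forall>x\<in>carrier A. \<forall>y\<in>carrier A. \<forall>z\<in>carrier A.
     x \<otimes> c y z \<oplus> c x (y \<otimes> z) = c (x \<otimes> y) z \<oplus> c x y \<otimes> z)"

definition (in kalgebra) coboundary :: "('a \<Rightarrow> 'a \<Rightarrow> 'a) \<Rightarrow> bool" where
  "coboundary c \<longleftrightarrow> (\<exists>\<psi>. linear_map K A A \<psi> \<and> (\<forall>x\<in>carrier A. \<forall>y\<in>carrier A.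
     x \<otimes> \<psi> y \<oplus> \<psi> x \<otimes> y = c x y \<oplus> \<psi> (x \<otimes> y)))"

locale deformation = kalgebra K A
  for K :: "('k, 'r) ring_scheme" and A :: "('k, 'a) module" (structure) +
  fixes \<mu> :: "(nat \<Rightarrow> 'a) \<Rightarrow> (nat \<Rightarrow> 'a) \<Rightarrow> nat \<Rightarrow> 'a"
  assumes deformation: "formal_deformation K A \<mu>"
begin

abbreviation "P \<equiv> series A"
abbreviation "sh \<equiv> shift \<zero>"
abbreviation "cst \<equiv> const \<zero>"

lemma carrier_P: "carrier (power_series_algebra A) = P"
  by (simp add: power_series_algebra_def series_def del: seriesD)

lemma add_P: "x \<oplus>\<^bsub>power_series_algebra A\<^esub> y = (\<lambda>i. x i \<oplus> y i)"
  by (simp add: power_series_algebra_def)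

lemma mult_P: "x \<otimes>\<^bsub>power_series_algebra A\<^esub> y = conv (\<otimes>) x y"
  by (simp add: power_series_algebra_def conv_def[abs_def])

lemma smult_P: "a \<odot>\<^bsub>power_series_algebra A\<^esub> x = conv (\<odot>) a x"
  by (simp add: power_series_algebra_def conv_def[abs_def])

lemma carrier_R: "carrier (power_series_ring K) = series K"
  by (simp add: power_series_ring_def series_def del: seriesD)

lemma linear_right: "x \<in> P \<Longrightarrow> linear_map (power_series_ring K) (power_series_algebra A) (power_series_algebra A) (\<mu> x)"
  and linear_left: "y \<in> P \<Longrightarrow> linear_map (power_series_ring K) (power_series_algebra A) (power_series_algebra A) (\<lambda>x. \<mu> x y)"
  and \<mu>_assoc: "x \<in> P \<Longrightarrow> y \<in> P \<Longrightarrow> z \<in> P \<Longrightarrow> \<mu> (\<mu> x y) z = \<mu> x (\<mu> y z)"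
  and \<mu>_0: "x \<in> P \<Longrightarrow> y \<in> P \<Longrightarrow> \<mu> x y 0 = x 0 \<otimes> y 0"
  using deformation unfolding formal_deformation_def Let_def carrier_P by auto

lemma \<mu>_closed [simp, intro]: "x \<in> P \<Longrightarrow> y \<in> P \<Longrightarrow> \<mu> x y \<in> P"
  using linear_map_closed[OF linear_right] by (simp add: carrier_P)

lemma \<mu>_add_right: "x \<in> P \<Longrightarrow> y \<in> P \<Longrightarrow> z \<in> P \<Longrightarrow> \<mu> x (\<lambda>i. y i \<oplus> z i) = (\<lambda>i. \<mu> x y i \<oplus> \<mu> x z i)"
  using linear_map_add[OF linear_right, of x y z] by (simp add: carrier_P add_P)

lemma \<mu>_add_left: "x \<in> P \<Longrightarrow> y \<in> P \<Longrightarrow> z \<in> P \<Longrightarrow> \<mu> (\<lambda>i. x i \<oplus> y i) z = (\<lambda>i. \<mu> x z i \<oplus> \<mu> y z i)"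
  using linear_map_add[OF linear_left, of z x y] by (simp add: carrier_P add_P)

lemma conv_smult_bilinear: "t_bilinear K A (conv (\<odot>))"
  by (rule t_bilinear_conv)
    (auto simp: A.is_abelian_group V.R.is_abelian_group smult_l_distr smult_r_distr)

lemma conv_mult_bilinear: "t_bilinear A A (conv (\<otimes>))"
  by (rule t_bilinear_conv) (auto simp: A.is_abelian_group l_distr r_distr)

lemma smult_const: "a \<in> carrier K \<Longrightarrow> x \<in> P \<Longrightarrow> conv (\<odot>) (const \<zero>\<^bsub>K\<^esub> a) x = (\<lambda>i. a \<odot> x i)"
  by (rule ext, rule conv_const) (auto simp: smult_l_null V.R.is_abelian_group)

lemma shift_one: "sh 1 x = conv (\<odot>) (shift \<zero>\<^bsub>K\<^esub> 1 (const \<zero>\<^bsub>K\<^esub> \<one>\<^bsub>K\<^esub>)) x" if "x \<in> P"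
proof -
  have c: "const \<zero>\<^bsub>K\<^esub> \<one>\<^bsub>K\<^esub> \<in> series K" by (simp add: V.R.series_closed)
  show ?thesis
    using t_bilinearD(2)[OF conv_smult_bilinear c that] smult_const[OF _ that, of "\<one>\<^bsub>K\<^esub>"] that by simp
qed

lemma \<mu>_shift_1:
  assumes "x \<in> P" "y \<in> P"
  shows "\<mu> x (sh 1 y) = sh 1 (\<mu> x y)" "\<mu> (sh 1 x) y = sh 1 (\<mu> x y)"
proof -
  have c: "shift \<zero>\<^bsub>K\<^esub> 1 (const \<zero>\<^bsub>K\<^esub> \<one>\<^bsub>K\<^esub>) \<in> series K" by (simp add: V.R.series_closed)
  show "\<mu> x (sh 1 y) = sh 1 (\<mu> x y)" "\<mu> (sh 1 x) y = sh 1 (\<mu> x y)"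
    using linear_map_smult[OF linear_right[OF assms(1)], of _ y] linear_map_smult[OF linear_left[OF assms(2)], of _ x]
      c assms by (simp_all only: carrier_R carrier_P smult_P shift_one \<mu>_closed)
qed

lemma shift_Suc: "sh (Suc n) x = sh 1 (sh n x)"
proof
  fix i show "sh (Suc n) x i = sh 1 (sh n x) i" by (cases i) (auto simp: shift_def)
qed

lemma \<mu>_shift:
  assumes "x \<in> P" "y \<in> P"
  shows "\<mu> x (sh n y) = sh n (\<mu> x y)" "\<mu> (sh n x) y = sh n (\<mu> x y)"
proof (induction n)
  case 0
  { case 1 show ?case by (simp add: shift_def) next case 2 show ?case by (simp add: shift_def) }
next
  case (Suc n)
  { case 1 show ?case unfolding shift_Suc using Suc assms
      by (simp only: \<mu>_shift_1 series_closed)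
  next
    case 2 show ?case unfolding shift_Suc using Suc assms
      by (simp only: \<mu>_shift_1 series_closed) }
qed

lemma \<mu>_smult:
  assumes a: "a \<in> carrier K" and x: "x \<in> P" and y: "y \<in> P"
  shows "\<mu> x (\<lambda>i. a \<odot> y i) = (\<lambda>i. a \<odot> \<mu> x y i)" "\<mu> (\<lambda>i. a \<odot> x i) y = (\<lambda>i. a \<odot> \<mu> x y i)"
proof -
  let ?c = "const \<zero>\<^bsub>K\<^esub> a"
  have c: "?c \<in> series K" using a by (simp add: V.R.series_closed)
  have "\<mu> x (conv (\<odot>) ?c y) = conv (\<odot>) ?c (\<mu> x y)" "\<mu> (conv (\<odot>) ?c x) y = conv (\<odot>) ?c (\<mu> x y)"
    using linear_map_smult[OF linear_right[OF x], of ?c y] linear_map_smult[OF linear_left[OF y], of ?c x] c x y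
    by (simp_all add: carrier_R carrier_P smult_P)
  then show "\<mu> x (\<lambda>i. a \<odot> y i) = (\<lambda>i. a \<odot> \<mu> x y i)" "\<mu> (\<lambda>i. a \<odot> x i) y = (\<lambda>i. a \<odot> \<mu> x y i)"
    by (simp_all only: smult_const[OF a x] smult_const[OF a y] smult_const[OF a \<mu>_closed[OF x y]])
qed

text \<open>Divisibility by \<open>t\<^sup>n\<close> is respected, and the leading coefficient is a product in \<open>A\<close>.\<close>
lemma \<mu>_low:
  assumes "x \<in> P" "y \<in> P" "\<And>i. i < n \<Longrightarrow> x i = \<zero>"
  shows "i < n \<Longrightarrow> \<mu> x y i = \<zero>" "i < n \<Longrightarrow> \<mu> y x i = \<zero>"
    "\<mu> x y n = x n \<otimes> y 0" "\<mu> y x n = y 0 \<otimes> x n"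
proof -
  define z where "z = (\<lambda>i. x (i + n))"
  have z: "z \<in> P" "x = sh n z" using assms by (auto intro!: seriesI simp: z_def shift_def)
  show "i < n \<Longrightarrow> \<mu> x y i = \<zero>" "i < n \<Longrightarrow> \<mu> y x i = \<zero>"
    unfolding z(2) \<mu>_shift[OF z(1) assms(2)] \<mu>_shift[OF assms(2) z(1)] by (simp_all add: shift_def)
  have "\<mu> x y n = \<mu> z y 0" "\<mu> y x n = \<mu> y z 0"
    unfolding z(2) \<mu>_shift[OF z(1) assms(2)] \<mu>_shift[OF assms(2) z(1)] by (simp_all add: shift_def)
  then show "\<mu> x y n = x n \<otimes> y 0" "\<mu> y x n = y 0 \<otimes> x n"
    using \<mu>_0 z(1) assms(2) by (simp_all add: z_def)
qed

lemma \<mu>_cong: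
  assumes P: "x \<in> P" "x' \<in> P" "y \<in> P" "y' \<in> P"
    and eq: "\<And>j. j \<le> i \<Longrightarrow> x j = x' j" "\<And>j. j \<le> i \<Longrightarrow> y j = y' j"
  shows "\<mu> x y i = \<mu> x' y' i"
proof -
  define u v where "u = (\<lambda>j. x j \<ominus> x' j)" "v = (\<lambda>j. y j \<ominus> y' j)"
  have uv: "u \<in> P" "v \<in> P" using P by (auto intro!: seriesI simp: u_v_def)
  have low: "j < Suc i \<Longrightarrow> u j = \<zero>" "j < Suc i \<Longrightarrow> v j = \<zero>" for j
    using eq P by (auto simp: u_v_def r_neg a_minus_def)
  have *: "a = b \<oplus> (a \<ominus> b)" if "a \<in> carrier A" "b \<in> carrier A" for a b using that by algebra
  have x: "x = (\<lambda>j. x' j \<oplus> u j)" and y: "y = (\<lambda>j. y' j \<oplus> v j)"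
    unfolding u_v_def using P by (auto intro!: ext *)
  have "\<mu> x y i = \<mu> x' y i" 
    by (subst x) (use P uv \<mu>_low(1)[OF uv(1) P(3), of "Suc i" i] low in \<open>simp add: \<mu>_add_left\<close>)
  also have "\<dots> = \<mu> x' y' i"
    by (subst y) (use P uv \<mu>_low(2)[OF uv(2) P(2), of "Suc i" i] low in \<open>simp add: \<mu>_add_right\<close>)
  finally show ?thesis .
qed

text \<open>
  \<open>f\<close> lifts the identity of \<open>A\<close> to a map into the deformed algebra that is multiplicative modulo
  \<open>t\<^sup>n\<close>.
\<close>
definition stage :: "nat \<Rightarrow> ('a \<Rightarrow> nat \<Rightarrow> 'a) \<Rightarrow> bool" where
  "stage n f \<longleftrightarrow> (\<forall>i. linear_map K A A (\<lambda>x. f x i)) \<and> (\<forall>x\<in>carrier A. f x 0 = x) \<and>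
    (\<forall>x\<in>carrier A. \<forall>y\<in>carrier A. \<forall>i<n. f (x \<otimes> y) i = \<mu> (f x) (f y) i)"

lemma stage_linear: "stage n f \<Longrightarrow> linear_map K A A (\<lambda>x. f x i)"
  by (simp add: stage_def)

lemma stage_P: "stage n f \<Longrightarrow> x \<in> carrier A \<Longrightarrow> f x \<in> P"
  using linear_map_closed[OF stage_linear] by (auto intro!: seriesI)

lemma stage_add: "stage n f \<Longrightarrow> x \<in> carrier A \<Longrightarrow> y \<in> carrier A \<Longrightarrow> f (x \<oplus> y) = (\<lambda>i. f x i \<oplus> f y i)"
  using linear_map_add[OF stage_linear] by auto

lemma stage_smult: "stage n f \<Longrightarrow> a \<in> carrier K \<Longrightarrow> x \<in> carrier A \<Longrightarrow> f (a \<odot> x) = (\<lambda>i. a \<odot> f x i)"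
  using linear_map_smult[OF stage_linear] by auto

lemma stage_1: "stage (Suc 0) (const \<zero>)"
  unfolding stage_def
proof (intro conjI allI ballI impI)
  show "linear_map K A A (\<lambda>x. cst x i)" for i
    by (rule linear_mapI) (auto simp: const_def smult_r_null)
  show "cst (x \<otimes> y) i = \<mu> (cst x) (cst y) i" if "x \<in> carrier A" "y \<in> carrier A" "i < Suc 0" for x y i
    using that \<mu>_0[of "cst x" "cst y"] by (simp add: series_closed)
qed auto

text \<open>
  The obstruction to being multiplicative one order further is the leading coefficient \<open>c\<close> of
  \<open>f (x y) - f x \<cdot> f y\<close>. Associativity of both products makes it a Hochschild cocycle, and if it is the
  coboundary of \<open>\<psi>\<close>, adding \<open>t\<^bsup>n+1\<^esup> \<psi>\<close> to \<open>f\<close> removes it.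
\<close>
lemma stage_step:
  assumes f: "stage (Suc n) f" and H2: "\<And>c. cocycle c \<Longrightarrow> coboundary c"
  shows "\<exists>g. stage (Suc (Suc n)) g \<and> (\<forall>x\<in>carrier A. \<forall>i\<le>n. g x i = f x i)"
proof -
  let ?N = "Suc n"
  note fP [simp, intro] = stage_P[OF f]
  have f0 [simp]: "f x 0 = x" if "x \<in> carrier A" for x using f that by (simp add: stage_def)
  define o' where "o' x y = (\<lambda>i. f (x \<otimes> y) i \<ominus> \<mu> (f x) (f y) i)" for x y
  have oP: "o' x y \<in> P" if "x \<in> carrier A" "y \<in> carrier A" for x y
    using that fP[of x] fP[of y] fP[of "x \<otimes> y"] by (auto intro!: seriesI simp: o'_def)
  have olow: "o' x y i = \<zero>" if "x \<in> carrier A" "y \<in> carrier A" "i < ?N" for x y i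
    using that f by (simp add: o'_def stage_def r_neg a_minus_def)
  have sub: "a = b \<oplus> (a \<ominus> b)" if "a \<in> carrier A" "b \<in> carrier A" for a b using that by algebra
  have ff: "f (x \<otimes> y) = (\<lambda>i. \<mu> (f x) (f y) i \<oplus> o' x y i)" if "x \<in> carrier A" "y \<in> carrier A" for x y
    unfolding o'_def by (rule ext, rule sub) (use that in auto)
  define c where "c x y = o' x y ?N" for x y
  have cc [simp, intro]: "c x y \<in> carrier A" if "x \<in> carrier A" "y \<in> carrier A" for x y
    using oP[OF that] by (auto simp: c_def)
  have distr: "(a \<oplus> b) \<ominus> (a' \<oplus> b') = (a \<ominus> a') \<oplus> (b \<ominus> b')"
    if "a \<in> carrier A" "b \<in> carrier A" "a' \<in> carrier A" "b' \<in> carrier A" for a b a' b' using that by algebra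
  have "bilinear c"
    unfolding bilinear_def
  proof (intro ballI conjI; rule linear_mapI)
    fix x y assume [simp]: "x \<in> carrier A" "y \<in> carrier A"
    show "c x (y \<oplus> z) = c x y \<oplus> c x z" if [simp]: "z \<in> carrier A" for z
      by (simp add: c_def o'_def r_distr stage_add[OF f] \<mu>_add_right) (rule distr; simp)
    show "c (y \<oplus> z) x = c y x \<oplus> c z x" if [simp]: "z \<in> carrier A" for z
      by (simp add: c_def o'_def l_distr stage_add[OF f] \<mu>_add_left) (rule distr; simp)
    show "c x (a \<odot> y) = a \<odot> c x y" if [simp]: "a \<in> carrier K" for a
      by (simp add: c_def o'_def smult_mult_right stage_smult[OF f] \<mu>_smult a_minus_def smult_r_distr smult_r_minus)
    show "c (a \<odot> y) x = a \<odot> c y x" if [simp]: "a \<in> carrier K" for a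
      by (simp add: c_def o'_def smult_mult_left stage_smult[OF f] \<mu>_smult a_minus_def smult_r_distr smult_r_minus)
  qed auto
  moreover have "x \<otimes> c y z \<oplus> c x (y \<otimes> z) = c (x \<otimes> y) z \<oplus> c x y \<otimes> z"
    if [simp]: "x \<in> carrier A" "y \<in> carrier A" "z \<in> carrier A" for x y z
  proof -
    have "f ((x \<otimes> y) \<otimes> z) ?N = \<mu> (\<mu> (f x) (f y)) (f z) ?N \<oplus> \<mu> (o' x y) (f z) ?N \<oplus> c (x \<otimes> y) z"
      by (simp add: ff[of "x \<otimes> y" z] c_def) (simp add: ff \<mu>_add_left oP)
    moreover have "f (x \<otimes> (y \<otimes> z)) ?N = \<mu> (f x) (\<mu> (f y) (f z)) ?N \<oplus> \<mu> (f x) (o' y z) ?N \<oplus> c x (y \<otimes> z)"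
      by (simp add: ff[of x "y \<otimes> z"] c_def) (simp add: ff \<mu>_add_right oP)
    moreover have "\<mu> (o' x y) (f z) ?N = c x y \<otimes> z" "\<mu> (f x) (o' y z) ?N = x \<otimes> c y z"
      using \<mu>_low(3)[of "o' x y" "f z" ?N] \<mu>_low(4)[of "o' y z" "f x" ?N] by (auto simp: oP olow c_def)
    moreover have "(x \<otimes> y) \<otimes> z = x \<otimes> (y \<otimes> z)" by (simp add: m_assoc)
    ultimately have eq: "\<mu> (f x) (\<mu> (f y) (f z)) ?N \<oplus> (c x y \<otimes> z) \<oplus> c (x \<otimes> y) z =
      \<mu> (f x) (\<mu> (f y) (f z)) ?N \<oplus> (x \<otimes> c y z) \<oplus> c x (y \<otimes> z)" by (simp add: \<mu>_assoc)
    have mem: "\<mu> (f x) (\<mu> (f y) (f z)) ?N \<in> carrier A" by (intro seriesD) auto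
    have cancel: "r \<oplus> s = q \<oplus> p"
      if "k \<oplus> p \<oplus> q = k \<oplus> r \<oplus> s" "k \<in> carrier A" "p \<in> carrier A" "q \<in> carrier A" "r \<in> carrier A" "s \<in> carrier A"
      for k p q r s
    proof -
      have "(q \<oplus> p) \<oplus> k = (r \<oplus> s) \<oplus> k" using that by (simp add: a_ac)
      then show ?thesis using that M.add.right_cancel[of k "q \<oplus> p" "r \<oplus> s"] by simp
    qed
    show ?thesis by (rule cancel[OF eq mem]) auto
  qed
  ultimately have "cocycle c" by (simp add: cocycle_def)
  then obtain \<psi> where \<psi>: "linear_map K A A \<psi>"
    and \<psi>c: "\<And>x y. x \<in> carrier A \<Longrightarrow> y \<in> carrier A \<Longrightarrow> x \<otimes> \<psi> y \<oplus> \<psi> x \<otimes> y = c x y \<oplus> \<psi> (x \<otimes> y)"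
    using H2[OF \<open>cocycle c\<close>] unfolding coboundary_def by blast
  note \<psi>cl [simp, intro] = linear_map_closed[OF \<psi>]
  define s where "s x = sh ?N (cst (\<psi> x))" for x
  have sP [simp, intro]: "s x \<in> P" if "x \<in> carrier A" for x using that by (simp add: s_def series_closed)
  have s_low: "s x i = \<zero>" if "i < ?N" for x i using that by (simp add: s_def shift_def)
  have sN: "s x ?N = \<psi> x" for x by (simp add: s_def shift_def)
  define g where "g x = (\<lambda>i. f x i \<oplus> s x i)" for x
  have gP: "g x \<in> P" if "x \<in> carrier A" for x using that by (simp add: g_def series_closed)
  have g_low: "g x i = f x i" if "x \<in> carrier A" "i < ?N" for x i
    using that by (simp add: g_def s_low)
  have s_lin: "linear_map K A A (\<lambda>x. s x i)" for i
    by (rule linear_mapI) (auto simp: s_def shift_def const_def smult_r_null linear_map_add[OF \<psi>] linear_map_smult[OF \<psi>])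
  have "stage (Suc ?N) g"
    unfolding stage_def
  proof (intro conjI allI ballI impI)
    show "linear_map K A A (\<lambda>x. g x i)" for i
      unfolding g_def
      by (rule linear_mapI)
        (auto simp: linear_map_add[OF s_lin] linear_map_smult[OF s_lin] stage_add[OF f] stage_smult[OF f]
          smult_r_distr M.a_ac)
    show "g x 0 = x" if "x \<in> carrier A" for x using g_low[OF that, of 0] that by simp
    fix x y i assume [simp]: "x \<in> carrier A" "y \<in> carrier A" and i: "i < Suc ?N"
    have m: "\<mu> (g x) (g y) j = (\<mu> (f x) (f y) j \<oplus> \<mu> (f x) (s y) j) \<oplus> \<mu> (s x) (g y) j" for j
      using gP[of y] by (simp add: g_def[of x] \<mu>_add_left) (simp add: g_def[of y] \<mu>_add_right)
    note gy = gP[of y]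
    show "g (x \<otimes> y) i = \<mu> (g x) (g y) i"
    proof (cases "i = ?N")
      case False
      then have i: "i < ?N" using i by simp
      then have "\<mu> (f x) (s y) i = \<zero>" "\<mu> (s x) (g y) i = \<zero>"
        using \<mu>_low(2)[of "s y" "f x" ?N i] \<mu>_low(1)[of "s x" "g y" ?N i] gy s_low by auto
      then show ?thesis using f i g_low[of "x \<otimes> y" i] by (simp add: m stage_def)
    next
      case True
      have "\<mu> (f x) (s y) ?N = x \<otimes> \<psi> y" "\<mu> (s x) (g y) ?N = \<psi> x \<otimes> y"
        using \<mu>_low(4)[of "s y" "f x" ?N] \<mu>_low(3)[of "s x" "g y" ?N] gy g_low[of y 0] s_low
        by (auto simp: sN)
      then have "\<mu> (g x) (g y) ?N = \<mu> (f x) (f y) ?N \<oplus> (x \<otimes> \<psi> y \<oplus> \<psi> x \<otimes> y)"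
        by (simp add: m a_assoc)
      also have "\<dots> = g (x \<otimes> y) ?N"
        by (simp add: \<psi>c g_def sN ff a_assoc flip: c_def)
      finally show ?thesis using True by simp
    qed
  qed
  moreover have "\<forall>x\<in>carrier A. \<forall>i\<le>n. g x i = f x i" using g_low by auto
  ultimately show ?thesis by blast
qed

lemma straightening:
  assumes H2: "\<And>c. cocycle c \<Longrightarrow> coboundary c"
  obtains F where "\<And>n. stage n F"
proof -
  have "\<exists>fs. \<forall>n. stage (Suc n) (fs n) \<and> (\<forall>x\<in>carrier A. \<forall>i\<le>n. fs (Suc n) x i = fs n x i)"
    by (rule dependent_nat_choice) (use stage_1 stage_step[OF _ H2] in blast)+
  then obtain fs where fs: "\<And>n. stage (Suc n) (fs n)"
    and agree: "\<And>n x i. x \<in> carrier A \<Longrightarrow> i \<le> n \<Longrightarrow> fs (Suc n) x i = fs n x i" by blast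
  have stable: "fs (i + k) x i = fs i x i" if "x \<in> carrier A" for i k x
    by (induction k) (use agree[OF that] in auto)
  define F where "F x i = fs i x i" for x i
  have FP: "F x \<in> P" if "x \<in> carrier A" for x
    using stage_P[OF fs that] by (auto intro!: seriesI simp: F_def)
  have F: "F x j = fs i x j" if "x \<in> carrier A" "j \<le> i" for x i j
    using stable[OF that(1), of j "i - j"] that by (simp add: F_def)
  have "stage n F" for n
    unfolding stage_def
  proof (intro conjI allI ballI impI)
    show "linear_map K A A (\<lambda>x. F x i)" for i
      unfolding F_def by (rule stage_linear[OF fs])
    show "F x 0 = x" if "x \<in> carrier A" for x using fs[of 0] that by (simp add: F_def stage_def)
    fix x y i assume *: "x \<in> carrier A" "y \<in> carrier A" "i < n"
    have "F (x \<otimes> y) i = \<mu> (fs i x) (fs i y) i" using fs[of i] * by (simp add: F_def stage_def)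
    also have "\<dots> = \<mu> (F x) (F y) i"
      by (rule \<mu>_cong) (use * F FP stage_P[OF fs] in auto)
    finally show "F (x \<otimes> y) i = \<mu> (F x) (F y) i" .
  qed
  then show ?thesis by (rule that)
qed

end

context deformation begin

context
  fixes F :: "'a \<Rightarrow> nat \<Rightarrow> 'a"
  assumes F: "\<And>n. stage n F"
begin

lemma F_P: "x \<in> carrier A \<Longrightarrow> F x \<in> P"
  by (rule stage_P[OF F])

lemma F_closed [simp]: "x \<in> carrier A \<Longrightarrow> F x i \<in> carrier A"
  using F_P by simp

lemma F_0 [simp]: "x \<in> carrier A \<Longrightarrow> F x 0 = x"
  using F[of 0] by (simp add: stage_def)

lemma F_mult: "x \<in> carrier A \<Longrightarrow> y \<in> carrier A \<Longrightarrow> F (x \<otimes> y) = \<mu> (F x) (F y)"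
  using F unfolding stage_def by (metis ext lessI)

lemma F_zero [simp]: "F \<zero> i = \<zero>"
  using linear_map_zero[OF stage_linear[OF F] A.is_abelian_group A.is_abelian_group] .

text \<open>The \<open>t\<close>-linear extension of \<open>F\<close> to power series.\<close>
definition \<Psi> :: "(nat \<Rightarrow> 'a) \<Rightarrow> nat \<Rightarrow> 'a" where
  "\<Psi> x i = (\<Oplus>j\<in>{..i}. F (x j) (i - j))"

lemma \<Psi>_closed [simp]: "x \<in> P \<Longrightarrow> \<Psi> x \<in> P"
  by (auto intro!: seriesI simp: \<Psi>_def)

lemma \<Psi>_0: "x \<in> P \<Longrightarrow> \<Psi> x 0 = x 0"
  by (simp add: \<Psi>_def)

lemma \<Psi>_add: "x \<in> P \<Longrightarrow> y \<in> P \<Longrightarrow> \<Psi> (\<lambda>i. x i \<oplus> y i) = (\<lambda>i. \<Psi> x i \<oplus> \<Psi> y i)"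
  by (rule ext) (simp add: \<Psi>_def stage_add[OF F] finsum_addf)

lemma \<Psi>_shift:
  assumes x: "x \<in> P"
  shows "\<Psi> (sh 1 x) = sh 1 (\<Psi> x)"
proof
  fix i show "\<Psi> (sh 1 x) i = sh 1 (\<Psi> x) i"
  proof (cases i)
    case 0 then show ?thesis by (simp add: \<Psi>_def)
  next
    case (Suc n)
    have "\<Psi> (sh 1 x) (Suc n) = (\<Oplus>j\<in>{..n}. F (x j) (n - j)) \<oplus> F \<zero> (Suc n)"
      unfolding \<Psi>_def using x by (subst finsum_Suc2) (auto simp: shift_def)
    then show ?thesis using Suc x by (simp add: \<Psi>_def)
  qed
qed

lemma \<Psi>_const:
  assumes a: "a \<in> carrier A"
  shows "\<Psi> (cst a) = F a"
proof
  fix i show "\<Psi> (cst a) i = F a i"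
  proof (cases i)
    case 0 then show ?thesis using a by (simp add: \<Psi>_def)
  next
    case (Suc n)
    have "\<Psi> (cst a) (Suc n) = (\<Oplus>j\<in>{..n}. \<zero>) \<oplus> F a (Suc n)"
      unfolding \<Psi>_def using a by (subst finsum_Suc2) (auto simp: const_def)
    then show ?thesis using Suc a by simp
  qed
qed

lemma \<Psi>_comp_bilinear: "t_bilinear U W \<beta> \<Longrightarrow> t_bilinear U W (\<lambda>x y. \<Psi> (\<beta> x y))"
  unfolding t_bilinear_def by (auto simp: \<Psi>_add \<Psi>_shift simp del: One_nat_def)

lemma \<Psi>_mult:
  assumes "x \<in> P" "y \<in> P"
  shows "\<Psi> (conv (\<otimes>) x y) = \<mu> (\<Psi> x) (\<Psi> y)"
proof (rule t_bilinear_eqI[OF A.is_abelian_group A.is_abelian_group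
      \<Psi>_comp_bilinear[OF conv_mult_bilinear] _ _ assms])
  show "t_bilinear A A (\<lambda>x y. \<mu> (\<Psi> x) (\<Psi> y))"
    unfolding t_bilinear_def
    by (auto simp: \<Psi>_add \<Psi>_shift \<mu>_add_left \<mu>_add_right \<mu>_shift_1 simp del: One_nat_def)
  fix a b assume ab: "a \<in> carrier A" "b \<in> carrier A"
  have "conv (\<otimes>) (cst a) (cst b) = cst (a \<otimes> b)"
  proof
    fix i show "conv (\<otimes>) (cst a) (cst b) i = cst (a \<otimes> b) i"
      using conv_const[of "cst b" A a A "(\<otimes>)" i] ab A.is_abelian_group
      by (simp add: series_closed) (simp add: const_def)
  qed
  then show "\<Psi> (conv (\<otimes>) (cst a) (cst b)) = \<mu> (\<Psi> (cst a)) (\<Psi> (cst b))"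
    using ab by (simp add: \<Psi>_const F_mult)
qed

lemma \<Psi>_smult:
  assumes "a \<in> series K" "x \<in> P"
  shows "\<Psi> (conv (\<odot>) a x) = conv (\<odot>) a (\<Psi> x)"
proof (rule t_bilinear_eqI[OF V.R.is_abelian_group A.is_abelian_group
      \<Psi>_comp_bilinear[OF conv_smult_bilinear] _ _ assms])
  show "t_bilinear K A (\<lambda>a x. conv (\<odot>) a (\<Psi> x))"
    using t_bilinearD[OF conv_smult_bilinear] unfolding t_bilinear_def
    by (auto simp: \<Psi>_add \<Psi>_shift simp del: One_nat_def)
  fix a b assume ab: "a \<in> carrier K" "b \<in> carrier A"
  have "conv (\<odot>) (const \<zero>\<^bsub>K\<^esub> a) (cst b) = cst (a \<odot> b)"
    using ab by (simp add: smult_const series_closed) (auto simp: const_def smult_r_null)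
  moreover have "F (a \<odot> b) = (\<lambda>i. a \<odot> F b i)" by (rule stage_smult[OF F ab])
  ultimately show "\<Psi> (conv (\<odot>) (const \<zero>\<^bsub>K\<^esub> a) (cst b)) = conv (\<odot>) (const \<zero>\<^bsub>K\<^esub> a) (\<Psi> (cst b))"
    using ab by (simp add: \<Psi>_const smult_const F_P)
qed

text \<open>
  \<open>\<Psi>\<close> is unitriangular with respect to the powers of \<open>t\<close>, and hence bijective.
\<close>
lemma \<Psi>_top:
  assumes x: "x \<in> P"
  shows "\<Psi> x i = x i \<oplus> (\<Oplus>j\<in>{..<i}. F (x j) (i - j))"
proof -
  have "{..i} = insert i {..<i}" by auto
  then show ?thesis unfolding \<Psi>_def using x by (simp add: finsum_insert)
qed

lemma \<Psi>_inj: "inj_on \<Psi> P"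
proof (rule inj_onI, rule ext)
  fix x y i assume x: "x \<in> P" and y: "y \<in> P" and eq: "\<Psi> x = \<Psi> y"
  show "x i = y i"
  proof (induction i rule: less_induct)
    case (less i)
    have "(\<Oplus>j\<in>{..<i}. F (x j) (i - j)) = (\<Oplus>j\<in>{..<i}. F (y j) (i - j))"
      by (rule finsum_cong') (use less y in auto)
    moreover have "(\<Oplus>j\<in>{..<i}. F (y j) (i - j)) \<in> carrier A" using y by (auto intro!: finsum_closed)
    ultimately show ?case
      using fun_cong[OF eq, of i] x y
        M.add.right_cancel[of "\<Oplus>j\<in>{..<i}. F (y j) (i - j)" "x i" "y i"] by (simp add: \<Psi>_top)
  qed
qed

text \<open>
  The triangular system is solved from the lowest coefficient upwards. The conditional is always
  true in the sum; it records that the recursive calls are at smaller indices.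
\<close>
fun preimage :: "(nat \<Rightarrow> 'a) \<Rightarrow> nat \<Rightarrow> 'a" where
  "preimage y i = y i \<ominus> (\<Oplus>j\<in>{..<i}. F (if j < i then preimage y j else \<zero>) (i - j))"

declare preimage.simps [simp del]

lemma preimage_P: "y \<in> P \<Longrightarrow> preimage y \<in> P"
proof (rule seriesI)
  fix i assume y: "y \<in> P"
  show "preimage y i \<in> carrier A"
  proof (induction i rule: less_induct)
    case (less i)
    then show ?case using y by (subst preimage.simps) (auto intro!: minus_closed finsum_closed)
  qed
qed

lemma \<Psi>_preimage:
  assumes y: "y \<in> P"
  shows "\<Psi> (preimage y) = y"
proof
  fix i
  note p = preimage_P[OF y]
  let ?s = "\<Oplus>j\<in>{..<i}. F (preimage y j) (i - j)"
  have s: "?s \<in> carrier A" using p by (auto intro!: finsum_closed)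
  have "(\<Oplus>j\<in>{..<i}. F (if j < i then preimage y j else \<zero>) (i - j)) = ?s"
    by (rule finsum_cong') (use p in auto)
  then have "preimage y i = y i \<ominus> ?s" by (subst preimage.simps) simp
  then have "\<Psi> (preimage y) i = (y i \<ominus> ?s) \<oplus> ?s" using p by (simp add: \<Psi>_top)
  also have "\<dots> = y i" using s y by (simp add: a_minus_def a_assoc l_neg)
  finally show "\<Psi> (preimage y) i = y i" .
qed

lemma trivial: "trivial_deformation K A \<mu>"
proof -
  have bij: "bij_betw \<Psi> P P"
    unfolding bij_betw_def using \<Psi>_inj
  proof
    show "\<Psi> ` P = P"
    proof
      show "P \<subseteq> \<Psi> ` P" using \<Psi>_preimage preimage_P by (metis image_eqI subsetI)
    qed auto
  qed
  define \<Phi> where "\<Phi> = the_inv_into P \<Psi>"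
  have b: "bij_betw \<Phi> P P" unfolding \<Phi>_def by (rule bij_betw_the_inv_into[OF bij])
  have \<Phi>P: "\<Phi> x \<in> P" if "x \<in> P" for x using b that by (auto simp: bij_betw_def)
  have \<Psi>\<Phi>: "\<Psi> (\<Phi> x) = x" if "x \<in> P" for x
    unfolding \<Phi>_def by (rule f_the_inv_into_f_bij_betw[OF bij that])
  have \<Phi>I: "\<Phi> y = x" if "\<Psi> x = y" "x \<in> P" for x y
    unfolding \<Phi>_def using the_inv_into_f_f[OF \<Psi>_inj that(2)] that(1) by simp
  have "linear_map (power_series_ring K) (power_series_algebra A) (power_series_algebra A) \<Phi>"
  proof (rule linear_mapI; unfold carrier_P carrier_R add_P smult_P)
    show "\<Phi> x \<in> P" if "x \<in> P" for x by (rule \<Phi>P[OF that])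
    show "\<Phi> (\<lambda>i. x i \<oplus> y i) = (\<lambda>i. \<Phi> x i \<oplus> \<Phi> y i)" if "x \<in> P" "y \<in> P" for x y
      by (rule \<Phi>I) (use that \<Phi>P \<Psi>\<Phi> in \<open>simp_all add: \<Psi>_add series_closed\<close>)
    show "\<Phi> (conv (\<odot>) a x) = conv (\<odot>) a (\<Phi> x)" if "a \<in> series K" "x \<in> P" for a x
      by (rule \<Phi>I) (use that \<Phi>P \<Psi>\<Phi> t_bilinearD(1)[OF conv_smult_bilinear] in \<open>simp_all add: \<Psi>_smult\<close>)
  qed
  moreover have "\<Phi> (\<mu> x y) = conv (\<otimes>) (\<Phi> x) (\<Phi> y)" if "x \<in> P" "y \<in> P" for x y
    by (rule \<Phi>I) (use that \<Phi>P \<Psi>\<Phi> t_bilinearD(1)[OF conv_mult_bilinear] in \<open>simp_all add: \<Psi>_mult\<close>)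
  moreover have "\<Phi> x 0 = x 0" if "x \<in> P" for x
    using \<Psi>_0[OF \<Phi>P[OF that]] \<Psi>\<Phi>[OF that] by simp
  ultimately show ?thesis
    unfolding trivial_deformation_def Let_def carrier_P mult_P using b by blast
qed

end

end

theorem (in kalgebra) rigid_if_cocycles_cobound:
  assumes "\<And>c. cocycle c \<Longrightarrow> coboundary c"
  shows "rigid K A"
  unfolding rigid_def
proof (intro allI impI)
  fix \<mu> assume "formal_deformation K A \<mu>"
  then interpret deformation K A \<mu>
    by (intro deformation.intro deformation_axioms.intro kalgebra_axioms)
  obtain F where "\<And>n. stage n F" using straightening[OF assms] by blast
  then show "trivial_deformation K A \<mu>" by (rule trivial)
qed

section \<open>Hochschild two-cocycles\<close>

text \<open>
  The prism decomposition of the homotopy between two simplicial maps, for a two-cocycle: the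
  hypotheses are the cocycle conditions on the three tetrahedra of a prism over a triangle, whose
  ends have the values \<open>x4\<close> and \<open>z1\<close>.
\<close>
lemma (in ring) homotopy_identity:
  assumes "x1 \<in> carrier R" "x2 \<in> carrier R" "x3 \<in> carrier R" "x4 \<in> carrier R"
    "y1 \<in> carrier R" "y3 \<in> carrier R" "y4 \<in> carrier R"
    "z1 \<in> carrier R" "z2 \<in> carrier R" "z4 \<in> carrier R"
    and h1: "x1 \<oplus> x2 = x3 \<oplus> x4" and h2: "y1 \<oplus> x2 = y3 \<oplus> y4" and h3: "z1 \<oplus> z2 = y3 \<oplus> z4"
  shows "x4 \<oplus> (x3 \<ominus> z2) = (y4 \<ominus> z4) \<oplus> (x1 \<ominus> y1) \<oplus> z1"
proof -
  have *: "c = a \<oplus> b \<ominus> c'" if "a \<oplus> b = c' \<oplus> c" "c \<in> carrier R" "c' \<in> carrier R" "a \<in> carrier R" "b \<in> carrier R" for a b c c'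
    unfolding that(1) using that(2-) by algebra
  have x4: "x4 = x1 \<oplus> x2 \<ominus> x3" and y4: "y4 = y1 \<oplus> x2 \<ominus> y3" using * h1 h2 assms by blast+
  have z4: "z4 = z1 \<oplus> z2 \<ominus> y3" using * h3 assms by blast
  show ?thesis unfolding x4 y4 z4 using assms(1-10) by algebra
qed

context kalgebra begin

definition hochschild :: "('a \<Rightarrow> 'a) \<Rightarrow> 'a \<Rightarrow> 'a \<Rightarrow> 'a" where
  "hochschild \<psi> x y = x \<otimes> \<psi> y \<oplus> \<psi> x \<otimes> y \<ominus> \<psi> (x \<otimes> y)"

lemma bilinear_linear:
  assumes "bilinear c" "x \<in> carrier A"
  shows "linear_map K A A (c x)" "linear_map K A A (\<lambda>y. c y x)"
  using assms by (auto simp: bilinear_def)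

lemma bilinear_closed: "bilinear c \<Longrightarrow> x \<in> carrier A \<Longrightarrow> y \<in> carrier A \<Longrightarrow> c x y \<in> carrier A"
  using linear_map_closed[OF bilinear_linear(1)] .

lemma bilinear_minus: "bilinear c \<Longrightarrow> bilinear d \<Longrightarrow> bilinear (\<lambda>x y. c x y \<ominus> d x y)"
  unfolding bilinear_def by (auto intro: lin_diff)

lemma bilinear_hochschild: "linear_map K A A \<psi> \<Longrightarrow> bilinear (hochschild \<psi>)"
  unfolding bilinear_def hochschild_def
  by (auto intro!: lin_diff lin_add lin_mult_left lin_mult_right lin_id linear_map_closed[of _ _ _ \<psi>]
      intro: linear_map_comp[of _ _ _ _ _ \<psi>])

lemma cocycleD:
  "cocycle c \<Longrightarrow> x \<in> carrier A \<Longrightarrow> y \<in> carrier A \<Longrightarrow> z \<in> carrier A \<Longrightarrow>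
    x \<otimes> c y z \<oplus> c x (y \<otimes> z) = c (x \<otimes> y) z \<oplus> c x y \<otimes> z"
  and cocycle_bilinear: "cocycle c \<Longrightarrow> bilinear c"
  by (auto simp: cocycle_def)

lemma cocycle_minus_hochschild:
  assumes c: "cocycle c" and \<psi>: "linear_map K A A \<psi>"
  shows "cocycle (\<lambda>x y. c x y \<ominus> hochschild \<psi> x y)"
  unfolding cocycle_def
proof (intro conjI ballI)
  show "bilinear (\<lambda>x y. c x y \<ominus> hochschild \<psi> x y)"
    by (intro bilinear_minus bilinear_hochschild cocycle_bilinear assms)
  fix x y z assume xyz: "x \<in> carrier A" "y \<in> carrier A" "z \<in> carrier A"
  note cl = linear_map_closed[OF \<psi>] bilinear_closed[OF cocycle_bilinear[OF c]]
  have m: "a \<oplus> b \<ominus> (d \<oplus> e) = (a \<ominus> d) \<oplus> (b \<ominus> e)"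
    if "a \<in> carrier A" "b \<in> carrier A" "d \<in> carrier A" "e \<in> carrier A" for a b d e
    using that by algebra
  have h: "x \<otimes> hochschild \<psi> y z \<oplus> hochschild \<psi> x (y \<otimes> z) = hochschild \<psi> (x \<otimes> y) z \<oplus> hochschild \<psi> x y \<otimes> z"
  proof -
    have *: "x \<otimes> (y \<otimes> c \<oplus> b \<otimes> z \<ominus> p) \<oplus> (x \<otimes> p \<oplus> a \<otimes> (y \<otimes> z) \<ominus> r) =
       ((x \<otimes> y) \<otimes> c \<oplus> q \<otimes> z \<ominus> r) \<oplus> (x \<otimes> b \<oplus> a \<otimes> y \<ominus> q) \<otimes> z"
      if "a \<in> carrier A" "b \<in> carrier A" "c \<in> carrier A" "p \<in> carrier A" "q \<in> carrier A" "r \<in> carrier A"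
      for a b c p q r using that xyz by algebra
    show ?thesis unfolding hochschild_def using xyz by (subst *) (auto simp: cl m_assoc)
  qed
  have hc: "hochschild \<psi> u v \<in> carrier A" if "u \<in> carrier A" "v \<in> carrier A" for u v
    using that by (auto simp: hochschild_def cl)
  have "x \<otimes> (c y z \<ominus> hochschild \<psi> y z) \<oplus> (c x (y \<otimes> z) \<ominus> hochschild \<psi> x (y \<otimes> z)) =
     (x \<otimes> c y z \<oplus> c x (y \<otimes> z)) \<ominus> (x \<otimes> hochschild \<psi> y z \<oplus> hochschild \<psi> x (y \<otimes> z))"
    using xyz by (simp add: m cl hc a_minus_def r_distr r_minus)
      (simp add: cl hc minus_add a_ac)
  also have "\<dots> = (c (x \<otimes> y) z \<oplus> c x y \<otimes> z) \<ominus> (hochschild \<psi> (x \<otimes> y) z \<oplus> hochschild \<psi> x y \<otimes> z)"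
    unfolding h cocycleD[OF c xyz] ..
  also have "\<dots> = (c (x \<otimes> y) z \<ominus> hochschild \<psi> (x \<otimes> y) z) \<oplus> (c x y \<ominus> hochschild \<psi> x y) \<otimes> z"
    using xyz by (simp add: cl hc a_minus_def l_distr l_minus) (simp add: cl hc minus_add a_ac)
  finally show "x \<otimes> (c y z \<ominus> hochschild \<psi> y z) \<oplus> (c x (y \<otimes> z) \<ominus> hochschild \<psi> x (y \<otimes> z)) =
    (c (x \<otimes> y) z \<ominus> hochschild \<psi> (x \<otimes> y) z) \<oplus> (c x y \<ominus> hochschild \<psi> x y) \<otimes> z" .
qed

lemma coboundary_minus_hochschild:
  assumes c: "bilinear c" and \<psi>: "linear_map K A A \<psi>"
    and b: "coboundary (\<lambda>x y. c x y \<ominus> hochschild \<psi> x y)"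
  shows "coboundary c"
proof -
  obtain \<theta> where \<theta>: "linear_map K A A \<theta>" and eq: "\<And>x y. x \<in> carrier A \<Longrightarrow> y \<in> carrier A \<Longrightarrow>
     x \<otimes> \<theta> y \<oplus> \<theta> x \<otimes> y = (c x y \<ominus> hochschild \<psi> x y) \<oplus> \<theta> (x \<otimes> y)"
    using b unfolding coboundary_def by blast
  note cl = linear_map_closed[OF \<psi>] linear_map_closed[OF \<theta>] bilinear_closed[OF c]
  show ?thesis
    unfolding coboundary_def
  proof (intro exI conjI ballI)
    show "linear_map K A A (\<lambda>x. \<theta> x \<oplus> \<psi> x)" by (rule lin_add[OF \<theta> \<psi>])
    fix x y assume xy: "x \<in> carrier A" "y \<in> carrier A"
    have "x \<otimes> (\<theta> y \<oplus> \<psi> y) \<oplus> (\<theta> x \<oplus> \<psi> x) \<otimes> y = (x \<otimes> \<theta> y \<oplus> \<theta> x \<otimes> y) \<oplus> (x \<otimes> \<psi> y \<oplus> \<psi> x \<otimes> y)"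
      using xy by (simp add: cl l_distr r_distr a_ac)
    also have "\<dots> = ((c x y \<ominus> hochschild \<psi> x y) \<oplus> \<theta> (x \<otimes> y)) \<oplus> (x \<otimes> \<psi> y \<oplus> \<psi> x \<otimes> y)"
      unfolding eq[OF xy] ..
    also have "\<dots> = c x y \<oplus> (\<theta> (x \<otimes> y) \<oplus> \<psi> (x \<otimes> y))"
    proof -
      have "((C \<ominus> (u \<ominus> v)) \<oplus> w) \<oplus> u = C \<oplus> (w \<oplus> v)"
        if "C \<in> carrier A" "u \<in> carrier A" "v \<in> carrier A" "w \<in> carrier A" for C u v w
        using that by algebra
      then show ?thesis unfolding hochschild_def using xy by (simp add: cl)
    qed
    finally show "x \<otimes> (\<theta> y \<oplus> \<psi> y) \<oplus> (\<theta> x \<oplus> \<psi> x) \<otimes> y = c x y \<oplus> (\<theta> (x \<otimes> y) \<oplus> \<psi> (x \<otimes> y))" .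
  qed
qed

end

section \<open>Algebras spanned by interlacing pairs\<close>

locale orthogonal_idempotents = kalgebra K A
  for K :: "('k, 'r) ring_scheme" and A :: "('k, 'a) module" (structure) +
  fixes V :: "'v set" and e :: "'v \<Rightarrow> 'a"
  assumes finite_V: "finite V"
    and e_closed [simp, intro]: "v \<in> V \<Longrightarrow> e v \<in> carrier A"
    and e_mult: "u \<in> V \<Longrightarrow> v \<in> V \<Longrightarrow> e u \<otimes> e v = (if u = v then e u else \<zero>)"
    and sum_left: "x \<in> carrier A \<Longrightarrow> (\<Oplus>v\<in>V. e v \<otimes> x) = x"
    and sum_right: "x \<in> carrier A \<Longrightarrow> (\<Oplus>v\<in>V. x \<otimes> e v) = x"
begin

lemma bilinear_zero_left: "bilinear c \<Longrightarrow> x \<in> carrier A \<Longrightarrow> c \<zero> x = \<zero>"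
  using linear_map_zero[OF bilinear_linear(2) A.is_abelian_group A.is_abelian_group] .

lemma bilinear_zero_right: "bilinear c \<Longrightarrow> x \<in> carrier A \<Longrightarrow> c x \<zero> = \<zero>"
  using linear_map_zero[OF bilinear_linear(1) A.is_abelian_group A.is_abelian_group] .

text \<open>
  Evaluate the cocycle condition on \<open>e\<^sub>v, e\<^sub>u, x\<close>, multiply by \<open>e\<^sub>v\<close> from the left and sum over \<open>v\<close>.
\<close>
lemma normalise_left:
  assumes c: "cocycle c"
  obtains \<psi> where "linear_map K A A \<psi>"
    "\<And>u x. u \<in> V \<Longrightarrow> x \<in> carrier A \<Longrightarrow> hochschild \<psi> (e u) x = c (e u) x"
proof
  note b = cocycle_bilinear[OF c]
  note cl [simp] = bilinear_closed[OF b]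
  define \<psi> where "\<psi> x = (\<Oplus>v\<in>V. e v \<otimes> c (e v) x)" for x
  show "linear_map K A A \<psi>"
    unfolding \<psi>_def by (intro lin_finsum lin_mult_left bilinear_linear(1)[OF b]) auto
  have \<psi>cl [simp]: "\<psi> x \<in> carrier A" if "x \<in> carrier A" for x
    using that unfolding \<psi>_def by (intro finsum_closed) auto
  fix u x assume u: "u \<in> V" and x: "x \<in> carrier A"
  have 1: "e u \<otimes> \<psi> x = e u \<otimes> c (e u) x"
  proof -
    have "e u \<otimes> \<psi> x = (\<Oplus>v\<in>V. e u \<otimes> (e v \<otimes> c (e v) x))"
      unfolding \<psi>_def using u x finite_V by (intro finsum_rdistr) auto
    also have "\<dots> = e u \<otimes> (e u \<otimes> c (e u) x)"
      by (rule finsum_delta) (use u x finite_V in \<open>auto simp: e_mult simp flip: m_assoc\<close>)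
    finally show ?thesis using u x by (simp add: e_mult flip: m_assoc)
  qed
  have 2: "\<psi> (e u) \<otimes> x = (\<Oplus>v\<in>V. e v \<otimes> (c (e v) (e u) \<otimes> x))"
  proof -
    have "\<psi> (e u) \<otimes> x = (\<Oplus>v\<in>V. (e v \<otimes> c (e v) (e u)) \<otimes> x)"
      unfolding \<psi>_def using u x finite_V by (intro finsum_ldistr) auto
    also have "\<dots> = (\<Oplus>v\<in>V. e v \<otimes> (c (e v) (e u) \<otimes> x))"
      by (rule finsum_cong') (use u x in \<open>auto simp: m_assoc\<close>)
    finally show ?thesis .
  qed
  have 3: "e u \<otimes> c (e u) x = (\<Oplus>v\<in>V. e v \<otimes> c (e v \<otimes> e u) x)"
    by (subst finsum_delta[where u = u])
      (use u x finite_V in \<open>auto simp: e_mult bilinear_zero_left[OF b]\<close>)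
  have "c (e u) x \<oplus> \<psi> (e u \<otimes> x) = (\<Oplus>v\<in>V. e v \<otimes> c (e u) x \<oplus> e v \<otimes> c (e v) (e u \<otimes> x))"
    unfolding \<psi>_def using u x by (simp add: finsum_addf Pi_iff sum_left)
  also have "\<dots> = (\<Oplus>v\<in>V. e v \<otimes> c (e v \<otimes> e u) x \<oplus> e v \<otimes> (c (e v) (e u) \<otimes> x))"
  proof (rule finsum_cong')
    fix v assume v: "v \<in> V"
    have "e v \<otimes> c (e u) x \<oplus> e v \<otimes> c (e v) (e u \<otimes> x) =
      e v \<otimes> (e v \<otimes> c (e u) x \<oplus> c (e v) (e u \<otimes> x))"
      using u v x by (simp add: r_distr e_mult flip: m_assoc)
    also have "\<dots> = e v \<otimes> (c (e v \<otimes> e u) x \<oplus> c (e v) (e u) \<otimes> x)"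
      using u v x by (simp only: cocycleD[OF c] e_closed)
    also have "\<dots> = e v \<otimes> c (e v \<otimes> e u) x \<oplus> e v \<otimes> (c (e v) (e u) \<otimes> x)"
      using u v x by (simp add: r_distr)
    finally show "e v \<otimes> c (e u) x \<oplus> e v \<otimes> c (e v) (e u \<otimes> x) =
      e v \<otimes> c (e v \<otimes> e u) x \<oplus> e v \<otimes> (c (e v) (e u) \<otimes> x)" .
  qed (use u x in auto)
  also have "\<dots> = e u \<otimes> \<psi> x \<oplus> \<psi> (e u) \<otimes> x"
    unfolding 1 2 3 using u x by (intro finsum_addf) auto
  finally have eq: "e u \<otimes> \<psi> x \<oplus> \<psi> (e u) \<otimes> x = c (e u) x \<oplus> \<psi> (e u \<otimes> x)" by simp
  show "hochschild \<psi> (e u) x = c (e u) x"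
    unfolding hochschild_def eq using u x by (simp add: a_minus_def a_assoc r_neg)
qed

text \<open>
  The mirror image of \<open>normalise_left\<close>. That the first normalisation is not destroyed is due to the
  fact that \<open>c\<close> is now linear over the idempotents from the left.
\<close>
lemma normalise_right:
  assumes c: "cocycle c" and z: "\<And>u x. u \<in> V \<Longrightarrow> x \<in> carrier A \<Longrightarrow> c (e u) x = \<zero>"
  obtains \<psi> where "linear_map K A A \<psi>"
    "\<And>u x. u \<in> V \<Longrightarrow> x \<in> carrier A \<Longrightarrow> hochschild \<psi> x (e u) = c x (e u)"
    "\<And>u x. u \<in> V \<Longrightarrow> x \<in> carrier A \<Longrightarrow> hochschild \<psi> (e u) x = \<zero>"
proof
  note b = cocycle_bilinear[OF c]
  note cl [simp] = bilinear_closed[OF b]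
  define \<psi> where "\<psi> x = (\<Oplus>v\<in>V. c x (e v) \<otimes> e v)" for x
  show "linear_map K A A \<psi>"
    unfolding \<psi>_def by (intro lin_finsum lin_mult_right bilinear_linear(2)[OF b]) auto
  have \<psi>cl [simp]: "\<psi> x \<in> carrier A" if "x \<in> carrier A" for x
    using that unfolding \<psi>_def by (intro finsum_closed) auto
  fix u x assume u: "u \<in> V" and x: "x \<in> carrier A"
  have \<psi>e: "\<psi> (e u) = \<zero>" unfolding \<psi>_def
    by (rule M.add.finprod_one_eqI) (use u z in auto)
  have 1: "\<psi> x \<otimes> e u = c x (e u) \<otimes> e u"
  proof -
    have "\<psi> x \<otimes> e u = (\<Oplus>v\<in>V. (c x (e v) \<otimes> e v) \<otimes> e u)"
      unfolding \<psi>_def using u x finite_V by (intro finsum_ldistr) auto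
    also have "\<dots> = (c x (e u) \<otimes> e u) \<otimes> e u"
      by (rule finsum_delta) (use u x finite_V in \<open>auto simp: e_mult m_assoc\<close>)
    finally show ?thesis using u x by (simp add: e_mult m_assoc)
  qed
  have "c x (e u) \<otimes> e u = (\<Oplus>v\<in>V. c x (e u \<otimes> e v) \<otimes> e v)"
    by (subst finsum_delta[where u = u])
      (use u x finite_V in \<open>auto simp: e_mult bilinear_zero_right[OF b]\<close>)
  also have "\<dots> = (\<Oplus>v\<in>V. c (x \<otimes> e u) (e v) \<otimes> e v \<oplus> c x (e u) \<otimes> e v)"
  proof (rule finsum_cong')
    fix v assume v: "v \<in> V"
    have "c x (e u \<otimes> e v) = c (x \<otimes> e u) (e v) \<oplus> c x (e u) \<otimes> e v"
      using cocycleD[OF c x, of "e u" "e v"] u v x by (simp add: z)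
    then have "c x (e u \<otimes> e v) \<otimes> e v = (c (x \<otimes> e u) (e v) \<oplus> c x (e u) \<otimes> e v) \<otimes> e v" by simp
    then show "c x (e u \<otimes> e v) \<otimes> e v = c (x \<otimes> e u) (e v) \<otimes> e v \<oplus> c x (e u) \<otimes> e v"
      using u v x by (simp add: l_distr m_assoc e_mult)
  qed (use u x in auto)
  also have "\<dots> = \<psi> (x \<otimes> e u) \<oplus> c x (e u)"
    unfolding \<psi>_def using u x by (simp add: finsum_addf Pi_iff sum_right)
  finally have 2: "c x (e u) \<otimes> e u = c x (e u) \<oplus> \<psi> (x \<otimes> e u)" using u x by (simp add: a_comm)
  show "hochschild \<psi> x (e u) = c x (e u)"
    unfolding hochschild_def 1 \<psi>e 2 using u x by (simp add: a_minus_def a_assoc r_neg)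
  have "\<psi> (e u \<otimes> x) = (\<Oplus>v\<in>V. e u \<otimes> (c x (e v) \<otimes> e v))"
    unfolding \<psi>_def
  proof (rule finsum_cong')
    fix v assume v: "v \<in> V"
    have "c (e u \<otimes> x) (e v) = e u \<otimes> c x (e v)"
      using cocycleD[OF c _ x, of "e u" "e v"] u v x by (simp add: z)
    then show "c (e u \<otimes> x) (e v) \<otimes> e v = e u \<otimes> (c x (e v) \<otimes> e v)"
      using u v x by (simp add: m_assoc)
  qed (use u x in auto)
  also have "\<dots> = e u \<otimes> \<psi> x"
    unfolding \<psi>_def using u x finite_V by (intro finsum_rdistr[symmetric]) auto
  finally show "hochschild \<psi> (e u) x = \<zero>"
    unfolding hochschild_def \<psi>e using u x by (simp add: a_minus_def r_neg)
qed

theorem coboundary_if_normalised: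
  assumes norm: "\<And>n. cocycle n \<Longrightarrow> (\<And>u x. u \<in> V \<Longrightarrow> x \<in> carrier A \<Longrightarrow> n (e u) x = \<zero> \<and> n x (e u) = \<zero>)
      \<Longrightarrow> coboundary n"
    and c: "cocycle c"
  shows "coboundary c"
proof -
  obtain \<psi> where \<psi>: "linear_map K A A \<psi>"
    "\<And>u x. u \<in> V \<Longrightarrow> x \<in> carrier A \<Longrightarrow> hochschild \<psi> (e u) x = c (e u) x"
    using normalise_left[OF c] by blast
  define c1 where "c1 x y = c x y \<ominus> hochschild \<psi> x y" for x y
  have c1: "cocycle c1"
    unfolding c1_def[abs_def] by (rule cocycle_minus_hochschild[OF c \<psi>(1)])
  have z1: "c1 (e u) x = \<zero>" if "u \<in> V" "x \<in> carrier A" for u x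
    using that bilinear_closed[OF cocycle_bilinear[OF c]] by (simp add: c1_def \<psi>(2) a_minus_def r_neg)
  obtain \<theta> where \<theta>: "linear_map K A A \<theta>"
    "\<And>u x. u \<in> V \<Longrightarrow> x \<in> carrier A \<Longrightarrow> hochschild \<theta> x (e u) = c1 x (e u)"
    "\<And>u x. u \<in> V \<Longrightarrow> x \<in> carrier A \<Longrightarrow> hochschild \<theta> (e u) x = \<zero>"
    using normalise_right[OF c1 z1] by blast
  have "coboundary (\<lambda>x y. c1 x y \<ominus> hochschild \<theta> x y)"
  proof (rule norm[OF cocycle_minus_hochschild[OF c1 \<theta>(1)]])
    fix u x assume "u \<in> V" "x \<in> carrier A"
    then show "c1 (e u) x \<ominus> hochschild \<theta> (e u) x = \<zero> \<and> c1 x (e u) \<ominus> hochschild \<theta> x (e u) = \<zero>"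
      using bilinear_closed[OF cocycle_bilinear[OF c1]] by (simp add: z1 \<theta> a_minus_def r_neg)
  qed
  then have "coboundary c1"
    by (rule coboundary_minus_hochschild[OF cocycle_bilinear[OF c1] \<theta>(1)])
  then show ?thesis
    unfolding c1_def[abs_def] by (rule coboundary_minus_hochschild[OF cocycle_bilinear[OF c] \<psi>(1)])
qed

end

text \<open>
  An algebra with a basis of elements \<open>f a b\<close> for the pairs \<open>(a, b)\<close> in a reflexive relation,
  multiplied like matrix units as long as the outer indices stay related. The maps \<open>R i\<close> form
  a sequence of homotopies from the identity to a constant map: a chain with related end points,
  mapped by \<open>R i\<close>, can be continued by images under \<open>R (i + 1)\<close>.
\<close>
locale interval_algebra = kalgebra K A
  for K :: "('k, 'r) ring_scheme" and A :: "('k, 'a) module" (structure) +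
  fixes V :: "'v set" and I :: "('v \<times> 'v) set" and f :: "'v \<Rightarrow> 'v \<Rightarrow> 'a"
    and co :: "'v \<Rightarrow> 'v \<Rightarrow> 'a \<Rightarrow> 'k" and R :: "nat \<Rightarrow> 'v \<Rightarrow> 'v" and N :: nat
  assumes finite_V: "finite V"
    and I_sub: "I \<subseteq> V \<times> V"
    and I_refl: "v \<in> V \<Longrightarrow> (v, v) \<in> I"
    and f_closed [simp, intro]: "(a, b) \<in> I \<Longrightarrow> f a b \<in> carrier A"
    and f_mult: "(a, b) \<in> I \<Longrightarrow> (b', c) \<in> I \<Longrightarrow>
      f a b \<otimes> f b' c = (if b = b' \<and> (a, c) \<in> I then f a c else \<zero>)"
    and co_closed: "x \<in> carrier A \<Longrightarrow> co a b x \<in> carrier K"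
    and co_add: "x \<in> carrier A \<Longrightarrow> y \<in> carrier A \<Longrightarrow> co a b (x \<oplus> y) = co a b x \<oplus>\<^bsub>K\<^esub> co a b y"
    and co_smult: "k \<in> carrier K \<Longrightarrow> x \<in> carrier A \<Longrightarrow> co a b (k \<odot> x) = k \<otimes>\<^bsub>K\<^esub> co a b x"
    and co_f: "(a, b) \<in> I \<Longrightarrow> (p, q) \<in> I \<Longrightarrow>
      co a b (f p q) = (if a = p \<and> b = q then \<one>\<^bsub>K\<^esub> else \<zero>\<^bsub>K\<^esub>)"
    and expand: "x \<in> carrier A \<Longrightarrow> x = (\<Oplus>p\<in>I. case p of (a, b) \<Rightarrow> co a b x \<odot> f a b)"
    and R_V: "v \<in> V \<Longrightarrow> i \<le> N \<Longrightarrow> R i v \<in> V"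
    and R_0: "v \<in> V \<Longrightarrow> R 0 v = v"
    and R_N: "v \<in> V \<Longrightarrow> w \<in> V \<Longrightarrow> R N v = R N w"
    and R_I: "(a, b) \<in> I \<Longrightarrow> i \<le> j \<Longrightarrow> j \<le> Suc i \<Longrightarrow> j \<le> N \<Longrightarrow> (R i a, R j b) \<in> I"
begin

lemma linear_ext:
  assumes g: "linear_map K A A g" and h: "linear_map K A A h"
    and eq: "\<And>a b. (a, b) \<in> I \<Longrightarrow> g (f a b) = h (f a b)" and x: "x \<in> carrier A"
  shows "g x = h x"
proof -
  have t: "(\<lambda>(a, b). co a b x \<odot> f a b) \<in> I \<rightarrow> carrier A" using x by (auto simp: co_closed)
  have "g' x = (\<Oplus>p\<in>I. case p of (a, b) \<Rightarrow> co a b x \<odot> g' (f a b))" if g': "linear_map K A A g'" for g'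
  proof -
    have "g' x = g' (\<Oplus>p\<in>I. case p of (a, b) \<Rightarrow> co a b x \<odot> f a b)" using expand[OF x] by simp
    also have "\<dots> = (\<Oplus>p\<in>I. g' (case p of (a, b) \<Rightarrow> co a b x \<odot> f a b))"
      by (rule linear_map_finsum[OF g' A.is_abelian_group A.is_abelian_group t])
    also have "\<dots> = (\<Oplus>p\<in>I. case p of (a, b) \<Rightarrow> co a b x \<odot> g' (f a b))"
      by (rule finsum_cong')
        (use x linear_map_smult[OF g'] linear_map_closed[OF g'] in \<open>auto simp: co_closed\<close>)
    finally show ?thesis .
  qed
  note 1 = this
  have "(\<Oplus>p\<in>I. case p of (a, b) \<Rightarrow> co a b x \<odot> g (f a b)) = (\<Oplus>p\<in>I. case p of (a, b) \<Rightarrow> co a b x \<odot> h (f a b))"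
    by (rule finsum_cong') (use eq x linear_map_closed[OF h] in \<open>auto simp: co_closed\<close>)
  then show ?thesis using 1[OF g] 1[OF h] by simp
qed

lemma bilinear_ext:
  assumes g: "bilinear g" and h: "bilinear h"
    and eq: "\<And>a b b' c. (a, b) \<in> I \<Longrightarrow> (b', c) \<in> I \<Longrightarrow> g (f a b) (f b' c) = h (f a b) (f b' c)"
    and x: "x \<in> carrier A" and y: "y \<in> carrier A"
  shows "g x y = h x y"
proof (rule linear_ext[OF bilinear_linear(1)[OF g x] bilinear_linear(1)[OF h x] _ y])
  fix b' c assume bc: "(b', c) \<in> I"
  show "g x (f b' c) = h x (f b' c)"
    by (rule linear_ext[OF bilinear_linear(2)[OF g f_closed[OF bc]] bilinear_linear(2)[OF h f_closed[OF bc]] _ x])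
      (rule eq[OF _ bc])
qed

sublocale orthogonal_idempotents K A V "\<lambda>v. f v v"
proof
  show "finite V" by (rule finite_V)
  show fv: "f v v \<in> carrier A" if "v \<in> V" for v using I_refl[OF that] by blast
  show "f u u \<otimes> f v v = (if u = v then f u u else \<zero>)" if "u \<in> V" "v \<in> V" for u v
    using f_mult[OF I_refl[OF that(1)] I_refl[OF that(2)]] I_refl that by auto
  fix x assume x: "x \<in> carrier A"
  have l: "linear_map K A A (\<lambda>x. \<Oplus>v\<in>V. f v v \<otimes> x)" "linear_map K A A (\<lambda>x. \<Oplus>v\<in>V. x \<otimes> f v v)"
    by (intro lin_finsum lin_mult_left lin_mult_right lin_id fv; assumption)+
  show "(\<Oplus>v\<in>V. f v v \<otimes> x) = x"
  proof (rule linear_ext[OF l(1) lin_id _ x])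
    fix a b assume ab: "(a, b) \<in> I"
    then have a: "a \<in> V" using I_sub by auto
    have "(\<Oplus>v\<in>V. f v v \<otimes> f a b) = f a a \<otimes> f a b"
      by (rule finsum_delta[OF finite_V a]) (use ab a I_refl f_mult in auto)
    then show "(\<Oplus>v\<in>V. f v v \<otimes> f a b) = f a b" using f_mult[OF I_refl[OF a] ab] ab by simp
  qed
  show "(\<Oplus>v\<in>V. x \<otimes> f v v) = x"
  proof (rule linear_ext[OF l(2) lin_id _ x])
    fix a b assume ab: "(a, b) \<in> I"
    then have b: "b \<in> V" using I_sub by auto
    have "(\<Oplus>v\<in>V. f a b \<otimes> f v v) = f a b \<otimes> f b b"
      by (rule finsum_delta[OF finite_V b]) (use ab b I_refl f_mult in auto)
    then show "(\<Oplus>v\<in>V. f a b \<otimes> f v v) = f a b" using f_mult[OF ab I_refl[OF b]] ab by simp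
  qed
qed

text \<open>Each corner of the algebra at a pair of idempotents is at most one-dimensional.\<close>
lemma corner:
  assumes a: "a \<in> V" and c: "c \<in> V" and x: "x \<in> carrier A"
  shows "f a a \<otimes> x \<otimes> f c c = (if (a, c) \<in> I then co a c x \<odot> f a c else \<zero>)"
proof (rule linear_ext[OF _ _ _ x])
  show "linear_map K A A (\<lambda>x. f a a \<otimes> x \<otimes> f c c)"
    using a c I_refl by (intro lin_mult_left lin_mult_right lin_id f_closed) auto
  show "linear_map K A A (\<lambda>x. if (a, c) \<in> I then co a c x \<odot> f a c else \<zero>)"
    by (rule linear_mapI)
      (auto simp: co_closed co_add co_smult smult_l_distr smult_assoc1 smult_r_null)
  fix p q assume pq: "(p, q) \<in> I"
  have "f a a \<otimes> f p q = (if a = p then f p q else \<zero>)"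
    using f_mult[OF I_refl[OF a] pq] pq by auto
  moreover have "f p q \<otimes> f c c = (if q = c then f p q else \<zero>)"
    using f_mult[OF pq I_refl[OF c]] pq by auto
  moreover have "f c c \<in> carrier A" using I_refl[OF c] by auto
  ultimately show "f a a \<otimes> f p q \<otimes> f c c = (if (a, c) \<in> I then co a c (f p q) \<odot> f a c else \<zero>)"
    using pq co_f[of a c p q] by (auto simp: smult_l_null)
qed

context
  fixes n assumes n: "cocycle n"
    and nz: "\<And>u x. u \<in> V \<Longrightarrow> x \<in> carrier A \<Longrightarrow> n (f u u) x = \<zero> \<and> n x (f u u) = \<zero>"
begin

lemma n_closed [simp]: "x \<in> carrier A \<Longrightarrow> y \<in> carrier A \<Longrightarrow> n x y \<in> carrier A"
  by (rule bilinear_closed[OF cocycle_bilinear[OF n]])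

lemma n_left: "u \<in> V \<Longrightarrow> x \<in> carrier A \<Longrightarrow> y \<in> carrier A \<Longrightarrow> n (f u u \<otimes> x) y = f u u \<otimes> n x y"
  using cocycleD[OF n, of "f u u" x y] nz by simp

lemma n_right: "u \<in> V \<Longrightarrow> x \<in> carrier A \<Longrightarrow> y \<in> carrier A \<Longrightarrow> n x (y \<otimes> f u u) = n x y \<otimes> f u u"
  using cocycleD[OF n, of x y "f u u"] nz by simp

lemma n_middle: "u \<in> V \<Longrightarrow> x \<in> carrier A \<Longrightarrow> y \<in> carrier A \<Longrightarrow> n x (f u u \<otimes> y) = n (x \<otimes> f u u) y"
  using cocycleD[OF n, of x "f u u" y] nz by simp

definition k :: "'v \<Rightarrow> 'v \<Rightarrow> 'v \<Rightarrow> 'k" where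
  "k a b c = co a c (n (f a b) (f b c))"

lemma k_closed [simp]: "(a, b) \<in> I \<Longrightarrow> (b, c) \<in> I \<Longrightarrow> k a b c \<in> carrier K"
  by (simp add: k_def co_closed)

text \<open>
  A normalised cocycle is bilinear and balanced over the idempotents, so its values lie in corners
  and it vanishes on pairs of basis elements that cannot be composed.
\<close>
lemma n_basis:
  assumes ab: "(a, b) \<in> I" and bc: "(b', c) \<in> I"
  shows "n (f a b) (f b' c) = (if b = b' \<and> (a, c) \<in> I then k a b c \<odot> f a c else \<zero>)"
proof -
  have V: "a \<in> V" "b \<in> V" "b' \<in> V" "c \<in> V" using ab bc I_sub by auto
  have "n (f a b) (f b' c) = n (f a a \<otimes> f a b) (f b' c \<otimes> f c c)"
    using f_mult[OF I_refl[OF V(1)] ab] f_mult[OF bc I_refl[OF V(4)]] ab bc by simp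
  also have "\<dots> = f a a \<otimes> n (f a b) (f b' c) \<otimes> f c c"
    using V ab bc by (simp add: n_left n_right m_assoc)
  also have "\<dots> = (if (a, c) \<in> I then co a c (n (f a b) (f b' c)) \<odot> f a c else \<zero>)"
    by (rule corner) (use V ab bc in auto)
  finally have 1: "n (f a b) (f b' c) = (if (a, c) \<in> I then co a c (n (f a b) (f b' c)) \<odot> f a c else \<zero>)" .
  show ?thesis
  proof (cases "b = b'")
    case True then show ?thesis by (subst 1) (simp add: k_def)
  next
    case False
    have "n (f a b) (f b' c) = n (f a b \<otimes> f b b) (f b' c)"
      using f_mult[OF ab I_refl[OF V(2)]] ab by simp
    also have "\<dots> = n (f a b) (f b b \<otimes> f b' c)" using V ab bc by (simp add: n_middle)
    also have "f b b \<otimes> f b' c = \<zero>" using f_mult[OF I_refl[OF V(2)] bc] False by simp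
    finally show ?thesis
      using False ab bilinear_zero_right[OF cocycle_bilinear[OF n]] by simp
  qed
qed

lemma k_cocycle:
  assumes "(w, a) \<in> I" "(a, b) \<in> I" "(b, c) \<in> I" "(w, b) \<in> I" "(a, c) \<in> I" "(w, c) \<in> I"
  shows "k a b c \<oplus>\<^bsub>K\<^esub> k w a c = k w b c \<oplus>\<^bsub>K\<^esub> k w a b"
proof -
  have co_mult: "co w c (x \<odot> f w c) = x" if "x \<in> carrier K" for x
    using that assms(6) by (simp add: co_smult co_f)
  have "f w a \<otimes> n (f a b) (f b c) \<oplus> n (f w a) (f a b \<otimes> f b c) =
     n (f w a \<otimes> f a b) (f b c) \<oplus> n (f w a) (f a b) \<otimes> f b c"
    using assms by (intro cocycleD[OF n]) auto
  then have "(k a b c \<oplus>\<^bsub>K\<^esub> k w a c) \<odot> f w c = (k w b c \<oplus>\<^bsub>K\<^esub> k w a b) \<odot> f w c"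
    using assms by (simp add: n_basis f_mult smult_mult_left smult_mult_right smult_l_distr)
  then show ?thesis using co_mult assms by (metis V.R.a_closed k_closed)
qed

lemma k_diag: "v \<in> V \<Longrightarrow> k v v v = \<zero>\<^bsub>K\<^esub>"
proof -
  assume v: "v \<in> V"
  have "co v v \<zero> = \<zero>\<^bsub>K\<^esub>"
    using co_smult[of "\<zero>\<^bsub>K\<^esub>" \<zero> v v] by (simp add: smult_l_null co_closed)
  then show ?thesis using nz[of v "f v v"] v I_refl[OF v] by (simp add: k_def)
qed

text \<open>
  Up to coboundaries, \<open>k\<close> agrees with its pullback along each \<open>R i\<close>, by one prism for every step from
  \<open>R i\<close> to \<open>R (i + 1)\<close>.
\<close>
lemma k_homotopy:
  assumes "i \<le> N"
  shows "\<exists>g. (\<forall>a b. (a, b) \<in> I \<longrightarrow> g a b \<in> carrier K) \<and>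
    (\<forall>a b c. (a, b) \<in> I \<longrightarrow> (b, c) \<in> I \<longrightarrow> (a, c) \<in> I \<longrightarrow>
      k a b c \<oplus>\<^bsub>K\<^esub> g a c = g a b \<oplus>\<^bsub>K\<^esub> g b c \<oplus>\<^bsub>K\<^esub> k (R i a) (R i b) (R i c))"
  using assms
proof (induction i)
  case 0
  show ?case
    by (rule exI[of _ "\<lambda>a b. \<zero>\<^bsub>K\<^esub>"]) (use I_sub R_0 in \<open>auto simp: subset_iff\<close>)
next
  case (Suc i)
  have "i \<le> N" using Suc.prems by simp
  obtain g where gcl [simp]: "\<And>a b. (a, b) \<in> I \<Longrightarrow> g a b \<in> carrier K"
    and g: "\<And>a b c. (a, b) \<in> I \<Longrightarrow> (b, c) \<in> I \<Longrightarrow> (a, c) \<in> I \<Longrightarrow>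
      k a b c \<oplus>\<^bsub>K\<^esub> g a c = g a b \<oplus>\<^bsub>K\<^esub> g b c \<oplus>\<^bsub>K\<^esub> k (R i a) (R i b) (R i c)"
    using Suc.IH[OF \<open>i \<le> N\<close>] by blast
  let ?S = "R (Suc i)" and ?R = "R i"
  have I0 [simp]: "(?R a, ?R b) \<in> I" and I1 [simp]: "(?R a, ?S b) \<in> I" and I2 [simp]: "(?S a, ?S b) \<in> I"
    if "(a, b) \<in> I" for a b using R_I[OF that] Suc.prems by auto
  have I3 [simp]: "(?R a, ?S a) \<in> I" if "(a, b) \<in> I \<or> (b, a) \<in> I" for a b
    using I1[OF I_refl, of a] I_sub that by auto
  define l where "l a b = k (?R a) (?R b) (?S b) \<ominus>\<^bsub>K\<^esub> k (?R a) (?S a) (?S b)" for a b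
  have lcl [simp]: "l a b \<in> carrier K" if "(a, b) \<in> I" for a b
  proof -
    have "(?R b, ?S b) \<in> I" "(?R a, ?S a) \<in> I" using that I3[of a b] I3[of b a] by auto
    then show ?thesis using that by (simp add: l_def)
  qed
  have step: "k (?R a) (?R b) (?R c) \<oplus>\<^bsub>K\<^esub> l a c = l a b \<oplus>\<^bsub>K\<^esub> l b c \<oplus>\<^bsub>K\<^esub> k (?S a) (?S b) (?S c)"
    if h [simp]: "(a, b) \<in> I" "(b, c) \<in> I" "(a, c) \<in> I" for a b c
  proof -
    have [simp]: "(?R a, ?S a) \<in> I" "(?R b, ?S b) \<in> I" "(?R c, ?S c) \<in> I"
      using I3[of a b] I3[of b c] I3[of c b] by auto
    show ?thesis unfolding l_def
      by (rule V.R.homotopy_identity[OF _ _ _ _ _ _ _ _ _ _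
            k_cocycle[of "?R a" "?R b" "?R c" "?S c"] k_cocycle[of "?R a" "?R b" "?S b" "?S c"]
            k_cocycle[of "?R a" "?S a" "?S b" "?S c"]]) simp_all
  qed
  show ?case
  proof (intro exI conjI allI impI)
    show "g a b \<oplus>\<^bsub>K\<^esub> l a b \<in> carrier K" if "(a, b) \<in> I" for a b using that by simp
    fix a b c assume h [simp]: "(a, b) \<in> I" "(b, c) \<in> I" "(a, c) \<in> I"
    have kcl [simp]: "k (?R a) (?R b) (?R c) \<in> carrier K" "k (?S a) (?S b) (?S c) \<in> carrier K" by auto
    have "k a b c \<oplus>\<^bsub>K\<^esub> (g a c \<oplus>\<^bsub>K\<^esub> l a c) = (k a b c \<oplus>\<^bsub>K\<^esub> g a c) \<oplus>\<^bsub>K\<^esub> l a c"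
      by (simp add: V.R.a_assoc)
    also have "\<dots> = g a b \<oplus>\<^bsub>K\<^esub> g b c \<oplus>\<^bsub>K\<^esub> (k (?R a) (?R b) (?R c) \<oplus>\<^bsub>K\<^esub> l a c)"
      unfolding g[OF h] by (simp add: V.R.a_assoc)
    also have "\<dots> = (g a b \<oplus>\<^bsub>K\<^esub> l a b) \<oplus>\<^bsub>K\<^esub> (g b c \<oplus>\<^bsub>K\<^esub> l b c) \<oplus>\<^bsub>K\<^esub> k (?S a) (?S b) (?S c)"
      unfolding step[OF h] by (simp add: V.R.a_ac)
    finally show "k a b c \<oplus>\<^bsub>K\<^esub> (g a c \<oplus>\<^bsub>K\<^esub> l a c) = (g a b \<oplus>\<^bsub>K\<^esub> l a b) \<oplus>\<^bsub>K\<^esub> (g b c \<oplus>\<^bsub>K\<^esub> l b c)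
      \<oplus>\<^bsub>K\<^esub> k (?S a) (?S b) (?S c)" .
  qed
qed

text \<open>The pullback along the last, constant map is the value of \<open>k\<close> on a degenerate simplex, which is zero.\<close>
lemma normalised_coboundary: "coboundary n"
proof -
  obtain g where gcl [simp]: "\<And>a b. (a, b) \<in> I \<Longrightarrow> g a b \<in> carrier K"
    and g0: "\<And>a b c. (a, b) \<in> I \<Longrightarrow> (b, c) \<in> I \<Longrightarrow> (a, c) \<in> I \<Longrightarrow>
      k a b c \<oplus>\<^bsub>K\<^esub> g a c = g a b \<oplus>\<^bsub>K\<^esub> g b c \<oplus>\<^bsub>K\<^esub> k (R N a) (R N b) (R N c)"
    using k_homotopy[of N] by blast
  have g: "k a b c \<oplus>\<^bsub>K\<^esub> g a c = g a b \<oplus>\<^bsub>K\<^esub> g b c"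
    if h: "(a, b) \<in> I" "(b, c) \<in> I" "(a, c) \<in> I" for a b c
  proof -
    have V: "a \<in> V" "b \<in> V" "c \<in> V" using h I_sub by auto
    have "k (R N a) (R N b) (R N c) = \<zero>\<^bsub>K\<^esub>"
      using R_N[OF V(2,1)] R_N[OF V(3,1)] k_diag[OF R_V[OF V(1)], of N] by simp
    then show ?thesis using g0[OF h] h by simp
  qed
  define \<psi> where "\<psi> x = (\<Oplus>p\<in>I. (g (fst p) (snd p) \<otimes>\<^bsub>K\<^esub> co (fst p) (snd p) x) \<odot> f (fst p) (snd p))" for x
  have fin: "finite I" using I_sub finite_V by (meson finite_SigmaI finite_subset)
  have \<psi>: "linear_map K A A \<psi>"
    unfolding \<psi>_def
  proof (rule lin_finsum)
    fix p assume p: "p \<in> I"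
    have cl: "g (fst p) (snd p) \<in> carrier K" "f (fst p) (snd p) \<in> carrier A" using p by auto
    show "linear_map K A A (\<lambda>x. (g (fst p) (snd p) \<otimes>\<^bsub>K\<^esub> co (fst p) (snd p) x) \<odot> f (fst p) (snd p))"
      by (rule linear_mapI)
        (auto simp: cl co_closed co_add co_smult V.R.r_distr smult_l_distr V.R.m_lcomm simp flip: smult_assoc1)
  qed
  have \<psi>f: "\<psi> (f a b) = g a b \<odot> f a b" if ab: "(a, b) \<in> I" for a b
    unfolding \<psi>_def
    by (subst finsum_delta[OF fin ab]) (use ab in \<open>auto simp: co_f smult_l_null\<close>)
  have \<psi>0: "\<psi> \<zero> = \<zero>" by (rule linear_map_zero[OF \<psi> A.is_abelian_group A.is_abelian_group])
  have b1: "bilinear (\<lambda>x y. x \<otimes> \<psi> y \<oplus> \<psi> x \<otimes> y)"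
    unfolding bilinear_def
    by (auto intro!: lin_add lin_mult_left lin_mult_right lin_id \<psi> linear_map_closed[OF \<psi>])
  have b2: "bilinear (\<lambda>x y. n x y \<oplus> \<psi> (x \<otimes> y))"
    unfolding bilinear_def
    by (auto intro!: lin_add bilinear_linear[OF cocycle_bilinear[OF n]]
        linear_map_comp[OF lin_mult_left[OF lin_id] \<psi>] linear_map_comp[OF lin_mult_right[OF lin_id] \<psi>])
  have "x \<otimes> \<psi> y \<oplus> \<psi> x \<otimes> y = n x y \<oplus> \<psi> (x \<otimes> y)" if xy: "x \<in> carrier A" "y \<in> carrier A" for x y
  proof (rule bilinear_ext[OF b1 b2 _ xy])
    fix a b b' c assume ab: "(a, b) \<in> I" and bc: "(b', c) \<in> I"
    have l: "f a b \<otimes> \<psi> (f b' c) \<oplus> \<psi> (f a b) \<otimes> f b' c = g b' c \<odot> (f a b \<otimes> f b' c) \<oplus> g a b \<odot> (f a b \<otimes> f b' c)"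
      using ab bc by (simp add: \<psi>f smult_mult_left smult_mult_right)
    show "f a b \<otimes> \<psi> (f b' c) \<oplus> \<psi> (f a b) \<otimes> f b' c = n (f a b) (f b' c) \<oplus> \<psi> (f a b \<otimes> f b' c)"
    proof (cases "b = b' \<and> (a, c) \<in> I")
      case True
      have "g b c \<odot> f a c \<oplus> g a b \<odot> f a c = (g a b \<oplus>\<^bsub>K\<^esub> g b c) \<odot> f a c"
        using True ab bc by (simp add: smult_l_distr a_comm)
      also have "\<dots> = (k a b c \<oplus>\<^bsub>K\<^esub> g a c) \<odot> f a c" using g[of a b c] True ab bc by simp
      also have "\<dots> = k a b c \<odot> f a c \<oplus> g a c \<odot> f a c"
        using True ab bc by (simp add: smult_l_distr)
      finally show ?thesis unfolding l using True ab bc by (simp add: f_mult n_basis \<psi>f)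
    next
      case False
      then show ?thesis unfolding l using ab bc by (auto simp: f_mult n_basis \<psi>0 smult_r_null)
    qed
  qed
  then show ?thesis unfolding coboundary_def using \<psi> by blast
qed

end

theorem cocycle_coboundary: "cocycle c \<Longrightarrow> coboundary c"
  by (rule coboundary_if_normalised) (auto intro: normalised_coboundary)

end

section \<open>Quotients and incidence algebras\<close>

context kalgebra begin

context
  fixes J :: "'a set"
  assumes J: "ideal J A"
begin

abbreviation "Q \<equiv> quotient_module A J"
definition proj :: "'a \<Rightarrow> 'a set" where "proj x = J +> x"

lemma J_smult: "k \<in> carrier K \<Longrightarrow> x \<in> J \<Longrightarrow> k \<odot> x \<in> J"
proof -
  assume k: "k \<in> carrier K" and x: "x \<in> J"
  interpret J: ideal J A by (rule J)
  have "(k \<odot> \<one>) \<otimes> x \<in> J" using k x by (intro J.I_l_closed) auto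
  then show ?thesis using k J.Icarr[OF x] by (simp add: smult_mult_left)
qed

lemma carrier_Q: "carrier Q = proj ` carrier A"
  by (auto simp: quotient_module_def FactRing_def A_RCOSETS_def' proj_def)

lemma proj_eq_iff: "x \<in> carrier A \<Longrightarrow> y \<in> carrier A \<Longrightarrow> proj x = proj y \<longleftrightarrow> x \<ominus> y \<in> J"
  using A.quotient_eq_iff_same_a_r_cos[OF J, of x y] by (simp add: proj_def)

lemma proj_add: "x \<in> carrier A \<Longrightarrow> y \<in> carrier A \<Longrightarrow> proj x \<oplus>\<^bsub>Q\<^esub> proj y = proj (x \<oplus> y)"
proof -
  interpret J: ideal J A by (rule J)
  show "x \<in> carrier A \<Longrightarrow> y \<in> carrier A \<Longrightarrow> proj x \<oplus>\<^bsub>Q\<^esub> proj y = proj (x \<oplus> y)"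
    by (simp add: quotient_module_def FactRing_def proj_def J.a_rcos_sum)
qed

lemma proj_mult: "x \<in> carrier A \<Longrightarrow> y \<in> carrier A \<Longrightarrow> proj x \<otimes>\<^bsub>Q\<^esub> proj y = proj (x \<otimes> y)"
  using ideal.rcoset_mult_add[OF J] by (simp add: quotient_module_def FactRing_def proj_def)

lemma proj_one: "\<one>\<^bsub>Q\<^esub> = proj \<one>"
  by (simp add: quotient_module_def FactRing_def proj_def)

lemma proj_zero: "\<zero>\<^bsub>Q\<^esub> = proj \<zero>"
proof -
  interpret J: ideal J A by (rule J)
  show ?thesis using J.a_rcos_const[of \<zero>] by (simp add: quotient_module_def FactRing_def proj_def)
qed

lemma proj_smult:
  assumes k: "k \<in> carrier K" and x: "x \<in> carrier A"
  shows "k \<odot>\<^bsub>Q\<^esub> proj x = proj (k \<odot> x)"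
proof -
  interpret J: ideal J A by (rule J)
  have eq: "J +> (k \<odot> y) = proj (k \<odot> x)" if y: "y \<in> proj x" for y
  proof -
    obtain j where j: "j \<in> J" "y = j \<oplus> x" using y by (auto simp: proj_def a_r_coset_def')
    have jA: "j \<in> carrier A" using j by auto
    have "k \<odot> y \<ominus> k \<odot> x = k \<odot> j"
      using jA k x j by (simp add: smult_r_distr a_minus_def a_assoc r_neg)
    then have "proj (k \<odot> y) = proj (k \<odot> x)"
      using J_smult[OF k j(1)] jA k x j by (subst proj_eq_iff) auto
    then show ?thesis by (simp add: proj_def)
  qed
  have "k \<odot>\<^bsub>Q\<^esub> proj x = (\<Union>y\<in>proj x. J +> (k \<odot> y))" by (simp add: quotient_module_def)
  also have "\<dots> = (\<Union>y\<in>proj x. proj (k \<odot> x))" by (rule SUP_cong) (auto simp: eq)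
  also have "\<dots> = proj (k \<odot> x)" using J.a_rcos_self[OF x] by (subst UN_constant) (auto simp: proj_def)
  finally show ?thesis .
qed

lemma kalgebra_quotient: "kalgebra K Q"
proof -
  have ab: "abelian_group Q"
  proof (rule abelian_groupI; unfold carrier_Q proj_zero)
    fix x assume "x \<in> proj ` carrier A"
    then obtain y where "y \<in> carrier A" "x = proj y" by blast
    then show "\<exists>y\<in>proj ` carrier A. y \<oplus>\<^bsub>Q\<^esub> x = proj \<zero>"
      by (intro bexI[of _ "proj (\<ominus> y)"]) (auto simp: proj_add l_neg)
  qed (auto simp: proj_add a_ac)
  have mon: "Group.monoid Q"
    by (rule monoidI; unfold carrier_Q proj_one) (auto simp: proj_mult m_assoc)
  have ring: "ring Q"
    by (rule ringI[OF ab mon]; unfold carrier_Q) (auto simp: proj_mult proj_add l_distr r_distr)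
  have "module K Q"
    by (rule moduleI[OF V.R.is_cring ab]; unfold carrier_Q)
      (auto simp: proj_add proj_smult smult_l_distr smult_r_distr smult_assoc1)
  with ring show ?thesis
    by (intro kalgebra.intro kalgebra_axioms.intro)
      (auto simp: carrier_Q proj_mult proj_smult smult_mult_left smult_mult_right)
qed

lemma proj_linear: "linear_map K A Q proj"
  by (rule linear_mapI) (auto simp: carrier_Q proj_add proj_smult)

end

end

lemma finite_tuples: "finite (tuples n d)"
  by (rule finite_subset[OF _ finite_lists_length_eq[of "{1..int n}" d]]) (auto simp: tuples_def)

lemma tuple_le_refl: "tuple_le x x"
  by (simp add: tuple_le_def list_all2_refl)

lemma tuple_le_trans: "tuple_le x y \<Longrightarrow> tuple_le y z \<Longrightarrow> tuple_le x z"
  unfolding tuple_le_def by (rule list_all2_trans[of "(\<le>)" "(\<le>)" "(\<le>)"]) auto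

locale incidence = field K
  for K :: "('k, 'r) ring_scheme" (structure) + fixes n d :: nat
begin

abbreviation "T \<equiv> tuples n d"
abbreviation "E \<equiv> incidence_pairs n d"
abbreviation "Inc \<equiv> incidence_algebra K n d"

lemma E_iff: "(x, y) \<in> E \<longleftrightarrow> x \<in> T \<and> y \<in> T \<and> tuple_le y x"
  by (simp add: incidence_pairs_def)

lemma E_trans: "(x, y) \<in> E \<Longrightarrow> (y, z) \<in> E \<Longrightarrow> (x, z) \<in> E"
  using tuple_le_trans by (auto simp: E_iff)

lemma E_refl: "x \<in> T \<Longrightarrow> (x, x) \<in> E"
  by (simp add: E_iff tuple_le_refl)

lemma finite_E: "finite E"
  by (rule finite_subset[of _ "T \<times> T"]) (auto simp: finite_tuples incidence_pairs_def)

lemma carrier_Inc: "\<phi> \<in> carrier Inc \<longleftrightarrow> (\<forall>p. \<phi> p \<in> carrier K) \<and> (\<forall>p. p \<notin> E \<longrightarrow> \<phi> p = \<zero>)"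
  by (auto simp: incidence_algebra_def)

lemma Inc_closed: "\<phi> \<in> carrier Inc \<Longrightarrow> \<phi> p \<in> carrier K"
  unfolding carrier_Inc by blast

lemma Inc_zero: "\<phi> \<in> carrier Inc \<Longrightarrow> p \<notin> E \<Longrightarrow> \<phi> p = \<zero>"
  unfolding carrier_Inc by blast

lemma add_Inc: "(\<phi> \<oplus>\<^bsub>Inc\<^esub> \<psi>) = (\<lambda>p. \<phi> p \<oplus> \<psi> p)"
  by (simp add: incidence_algebra_def)

lemma smult_Inc: "(a \<odot>\<^bsub>Inc\<^esub> \<phi>) = (\<lambda>p. a \<otimes> \<phi> p)"
  by (simp add: incidence_algebra_def)

lemma zero_Inc: "\<zero>\<^bsub>Inc\<^esub> = (\<lambda>p. \<zero>)"
  by (simp add: incidence_algebra_def)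

lemma one_Inc: "\<one>\<^bsub>Inc\<^esub> (x, y) = (if x = y \<and> x \<in> T then \<one> else \<zero>)"
  by (simp add: incidence_algebra_def)

text \<open>Outside the interval all summands vanish, so that the product is a matrix product.\<close>
lemma mult_Inc:
  assumes "\<phi> \<in> carrier Inc" "\<psi> \<in> carrier Inc"
  shows "(\<phi> \<otimes>\<^bsub>Inc\<^esub> \<psi>) (x, z) = (\<Oplus>y\<in>T. \<phi> (x, y) \<otimes> \<psi> (y, z))"
proof -
  have "(\<Oplus>y\<in>T. \<phi> (x, y) \<otimes> \<psi> (y, z)) = (\<Oplus>y\<in>{y \<in> T. tuple_le z y \<and> tuple_le y x}. \<phi> (x, y) \<otimes> \<psi> (y, z))"
  proof (rule add.finprod_mono_neutral_cong_right)
    fix y assume "y \<in> T - {y \<in> T. tuple_le z y \<and> tuple_le y x}"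
    then have "(x, y) \<notin> E \<or> (y, z) \<notin> E" by (auto simp: E_iff)
    then show "\<phi> (x, y) \<otimes> \<psi> (y, z) = \<zero>"
      using Inc_zero[OF assms(1)] Inc_zero[OF assms(2)] Inc_closed[OF assms(1)] Inc_closed[OF assms(2)] by auto
  qed (use assms Inc_closed finite_tuples in auto)
  then show ?thesis by (simp add: incidence_algebra_def)
qed

lemma mult_Inc_closed:
  assumes "\<phi> \<in> carrier Inc" "\<psi> \<in> carrier Inc"
  shows "\<phi> \<otimes>\<^bsub>Inc\<^esub> \<psi> \<in> carrier Inc"
  unfolding carrier_Inc split_paired_All mult_Inc[OF assms]
proof (intro conjI allI impI)
  fix x z
  show "(\<Oplus>y\<in>T. \<phi> (x, y) \<otimes> \<psi> (y, z)) \<in> carrier K" using assms Inc_closed by (auto intro!: finsum_closed)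
  assume xz: "(x, z) \<notin> E"
  show "(\<Oplus>y\<in>T. \<phi> (x, y) \<otimes> \<psi> (y, z)) = \<zero>"
  proof (rule add.finprod_one_eqI)
    fix y
    have "(x, y) \<notin> E \<or> (y, z) \<notin> E" using xz E_trans by blast
    then show "\<phi> (x, y) \<otimes> \<psi> (y, z) = \<zero>"
      using Inc_zero[OF assms(1)] Inc_zero[OF assms(2)] Inc_closed[OF assms(1)] Inc_closed[OF assms(2)] by auto
  qed
qed

lemma mult_Inc_assoc:
  assumes "\<phi> \<in> carrier Inc" "\<psi> \<in> carrier Inc" "\<chi> \<in> carrier Inc"
  shows "(\<phi> \<otimes>\<^bsub>Inc\<^esub> \<psi>) \<otimes>\<^bsub>Inc\<^esub> \<chi> = \<phi> \<otimes>\<^bsub>Inc\<^esub> (\<psi> \<otimes>\<^bsub>Inc\<^esub> \<chi>)"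
proof
  fix p :: "int list \<times> int list"
  obtain x w where p: "p = (x, w)" by (cases p)
  note cl = Inc_closed[OF assms(1)] Inc_closed[OF assms(2)] Inc_closed[OF assms(3)]
  have "((\<phi> \<otimes>\<^bsub>Inc\<^esub> \<psi>) \<otimes>\<^bsub>Inc\<^esub> \<chi>) (x, w) = (\<Oplus>z\<in>T. (\<Oplus>y\<in>T. \<phi> (x, y) \<otimes> \<psi> (y, z)) \<otimes> \<chi> (z, w))"
    by (simp add: mult_Inc assms mult_Inc_closed)
  also have "\<dots> = (\<Oplus>z\<in>T. \<Oplus>y\<in>T. \<phi> (x, y) \<otimes> (\<psi> (y, z) \<otimes> \<chi> (z, w)))"
    by (rule finsum_cong') (auto simp: finsum_ldistr cl finite_tuples m_assoc intro!: finsum_closed)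
  also have "\<dots> = (\<Oplus>y\<in>T. \<Oplus>z\<in>T. \<phi> (x, y) \<otimes> (\<psi> (y, z) \<otimes> \<chi> (z, w)))"
    by (rule finsum_swap) (auto simp: finite_tuples cl)
  also have "\<dots> = (\<Oplus>y\<in>T. \<phi> (x, y) \<otimes> (\<Oplus>z\<in>T. \<psi> (y, z) \<otimes> \<chi> (z, w)))"
    by (rule finsum_cong') (auto simp: finsum_rdistr cl finite_tuples intro!: finsum_closed)
  also have "\<dots> = (\<phi> \<otimes>\<^bsub>Inc\<^esub> (\<psi> \<otimes>\<^bsub>Inc\<^esub> \<chi>)) (x, w)"
    by (simp add: mult_Inc assms mult_Inc_closed)
  finally show "((\<phi> \<otimes>\<^bsub>Inc\<^esub> \<psi>) \<otimes>\<^bsub>Inc\<^esub> \<chi>) p = (\<phi> \<otimes>\<^bsub>Inc\<^esub> (\<psi> \<otimes>\<^bsub>Inc\<^esub> \<chi>)) p" by (simp only: p)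
qed

lemma Inc_eqI: "(\<And>x y. \<phi> (x, y) = \<psi> (x, y)) \<Longrightarrow> \<phi> = (\<psi> :: int list \<times> int list \<Rightarrow> 'k)"
  by auto

lemma one_Inc_closed: "\<one>\<^bsub>Inc\<^esub> \<in> carrier Inc"
  unfolding carrier_Inc split_paired_All one_Inc using E_refl by auto

lemma one_mult:
  assumes "\<phi> \<in> carrier Inc"
  shows "\<one>\<^bsub>Inc\<^esub> \<otimes>\<^bsub>Inc\<^esub> \<phi> = \<phi>" "\<phi> \<otimes>\<^bsub>Inc\<^esub> \<one>\<^bsub>Inc\<^esub> = \<phi>"
proof -
  note cl = Inc_closed[OF assms]
  have "(\<one>\<^bsub>Inc\<^esub> \<otimes>\<^bsub>Inc\<^esub> \<phi>) (x, z) = \<phi> (x, z)" for x z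
  proof (cases "x \<in> T")
    case True
    show ?thesis unfolding mult_Inc[OF one_Inc_closed assms] one_Inc
      by (subst finsum_delta[OF finite_tuples True]) (use cl True in auto)
  next
    case False
    then show ?thesis unfolding mult_Inc[OF one_Inc_closed assms] one_Inc
      using Inc_zero[OF assms, of "(x, z)"] cl by (auto simp: E_iff intro!: add.finprod_one_eqI)
  qed
  then show "\<one>\<^bsub>Inc\<^esub> \<otimes>\<^bsub>Inc\<^esub> \<phi> = \<phi>" by (rule Inc_eqI)
  have "(\<phi> \<otimes>\<^bsub>Inc\<^esub> \<one>\<^bsub>Inc\<^esub>) (x, z) = \<phi> (x, z)" for x z
  proof (cases "z \<in> T")
    case True
    show ?thesis unfolding mult_Inc[OF assms one_Inc_closed] one_Inc
      by (subst finsum_delta[OF finite_tuples True]) (use cl True in auto)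
  next
    case False
    then show ?thesis unfolding mult_Inc[OF assms one_Inc_closed] one_Inc
      using Inc_zero[OF assms, of "(x, z)"] cl by (auto simp: E_iff intro!: add.finprod_one_eqI)
  qed
  then show "\<phi> \<otimes>\<^bsub>Inc\<^esub> \<one>\<^bsub>Inc\<^esub> = \<phi>" by (rule Inc_eqI)
qed

lemma Inc_kalgebra: "kalgebra K Inc"
proof -
  have ab: "abelian_group Inc"
  proof (rule abelian_groupI)
    fix \<phi> assume "\<phi> \<in> carrier Inc"
    then show "\<exists>\<psi>\<in>carrier Inc. \<psi> \<oplus>\<^bsub>Inc\<^esub> \<phi> = \<zero>\<^bsub>Inc\<^esub>"
      by (intro bexI[of _ "\<lambda>p. \<ominus> \<phi> p"]) (auto simp: carrier_Inc add_Inc zero_Inc l_neg)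
  qed (auto simp: carrier_Inc add_Inc zero_Inc a_ac)
  have closed: "\<phi> \<oplus>\<^bsub>Inc\<^esub> \<psi> \<in> carrier Inc" if "\<phi> \<in> carrier Inc" "\<psi> \<in> carrier Inc" for \<phi> \<psi>
    using that by (auto simp: carrier_Inc add_Inc)
  have smult_closed: "a \<odot>\<^bsub>Inc\<^esub> \<phi> \<in> carrier Inc" if "a \<in> carrier K" "\<phi> \<in> carrier Inc" for a \<phi>
    using that by (auto simp: carrier_Inc smult_Inc)
  have mon: "Group.monoid Inc"
    by (rule monoidI) (auto simp: mult_Inc_closed one_Inc_closed one_mult mult_Inc_assoc)
  have ring: "ring Inc"
  proof (rule ringI[OF ab mon]; rule Inc_eqI)
    fix \<phi> \<psi> \<chi> x y assume "\<phi> \<in> carrier Inc" "\<psi> \<in> carrier Inc" "\<chi> \<in> carrier Inc"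
    then show "((\<phi> \<oplus>\<^bsub>Inc\<^esub> \<psi>) \<otimes>\<^bsub>Inc\<^esub> \<chi>) (x, y) = (\<phi> \<otimes>\<^bsub>Inc\<^esub> \<chi> \<oplus>\<^bsub>Inc\<^esub> \<psi> \<otimes>\<^bsub>Inc\<^esub> \<chi>) (x, y)"
      "(\<chi> \<otimes>\<^bsub>Inc\<^esub> (\<phi> \<oplus>\<^bsub>Inc\<^esub> \<psi>)) (x, y) = (\<chi> \<otimes>\<^bsub>Inc\<^esub> \<phi> \<oplus>\<^bsub>Inc\<^esub> \<chi> \<otimes>\<^bsub>Inc\<^esub> \<psi>) (x, y)"
      by (simp_all add: mult_Inc closed add_Inc[of "_ \<otimes>\<^bsub>Inc\<^esub> _"])
        (simp_all add: add_Inc Inc_closed l_distr r_distr finsum_addf Pi_iff)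
  qed
  have mod: "module K Inc"
  proof (rule moduleI[OF is_cring ab])
    show "a \<odot>\<^bsub>Inc\<^esub> \<phi> \<in> carrier Inc" if "a \<in> carrier K" "\<phi> \<in> carrier Inc" for a \<phi>
      by (rule smult_closed[OF that])
  qed (auto simp: smult_Inc add_Inc Inc_closed l_distr r_distr m_assoc)
  have "(a \<odot>\<^bsub>Inc\<^esub> \<phi>) \<otimes>\<^bsub>Inc\<^esub> \<psi> = a \<odot>\<^bsub>Inc\<^esub> (\<phi> \<otimes>\<^bsub>Inc\<^esub> \<psi>)"
    "\<phi> \<otimes>\<^bsub>Inc\<^esub> (a \<odot>\<^bsub>Inc\<^esub> \<psi>) = a \<odot>\<^bsub>Inc\<^esub> (\<phi> \<otimes>\<^bsub>Inc\<^esub> \<psi>)"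
    if a: "a \<in> carrier K" and \<phi>: "\<phi> \<in> carrier Inc" and \<psi>: "\<psi> \<in> carrier Inc" for a \<phi> \<psi>
  proof -
    have "(\<Oplus>y\<in>T. a \<otimes> \<phi> (x, y) \<otimes> \<psi> (y, z)) = a \<otimes> (\<Oplus>y\<in>T. \<phi> (x, y) \<otimes> \<psi> (y, z))"
      "(\<Oplus>y\<in>T. \<phi> (x, y) \<otimes> (a \<otimes> \<psi> (y, z))) = a \<otimes> (\<Oplus>y\<in>T. \<phi> (x, y) \<otimes> \<psi> (y, z))" for x z
      using a Inc_closed[OF \<phi>] Inc_closed[OF \<psi>]
      by (simp_all add: finsum_rdistr finite_tuples Pi_iff m_assoc m_lcomm)
    then show "(a \<odot>\<^bsub>Inc\<^esub> \<phi>) \<otimes>\<^bsub>Inc\<^esub> \<psi> = a \<odot>\<^bsub>Inc\<^esub> (\<phi> \<otimes>\<^bsub>Inc\<^esub> \<psi>)"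
      "\<phi> \<otimes>\<^bsub>Inc\<^esub> (a \<odot>\<^bsub>Inc\<^esub> \<psi>) = a \<odot>\<^bsub>Inc\<^esub> (\<phi> \<otimes>\<^bsub>Inc\<^esub> \<psi>)"
      using mult_Inc[OF smult_closed[OF a \<phi>] \<psi>] mult_Inc[OF \<phi> smult_closed[OF a \<psi>]] mult_Inc[OF \<phi> \<psi>]
      by (auto intro!: Inc_eqI simp: smult_Inc)
  qed
  then show ?thesis
    by (intro kalgebra.intro kalgebra_axioms.intro ring mod)
qed

end

section \<open>Higher Auslander algebras of type A\<close>

lemma ideal_finsum_closed:
  assumes "ideal J R" "\<And>s. s \<in> S \<Longrightarrow> g s \<in> J"
  shows "(\<Oplus>\<^bsub>R\<^esub>s\<in>S. g s) \<in> J"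
proof -
  interpret ideal J R by fact
  show ?thesis using assms(2)
  proof (induction S rule: infinite_finite_induct)
    case (insert s S)
    then have "g s \<oplus>\<^bsub>R\<^esub> (\<Oplus>\<^bsub>R\<^esub>s\<in>S. g s) \<in> J" by auto
    moreover have "g \<in> S \<rightarrow> carrier R" "g s \<in> carrier R" using insert.prems by auto
    ultimately show ?case using insert.hyps by (simp add: finsum_insert)
  qed auto
qed

context incidence begin

definition interlacing :: "(int list \<times> int list) set" where
  "interlacing = {(\<Gamma>, \<Sigma>). length \<Gamma> = d \<and> length \<Sigma> = d \<and>
    (\<forall>j<d. 1 \<le> \<Sigma> ! j \<and> \<Sigma> ! j \<le> \<Gamma> ! j \<and> \<Gamma> ! j \<le> int n \<and> (Suc j < d \<longrightarrow> \<Gamma> ! j < \<Sigma> ! Suc j))}"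

lemma tuples_iff: "x \<in> T \<longleftrightarrow> length x = d \<and> (\<forall>j<d. 1 \<le> x ! j \<and> x ! j \<le> int n \<and> (Suc j < d \<longrightarrow> x ! j \<le> x ! Suc j))"
  by (auto simp: tuples_def sorted_iff_nth_Suc subset_iff in_set_conv_nth)

lemma tuple_le_iff: "tuple_le x y \<longleftrightarrow> length x = length y \<and> (\<forall>j<length x. x ! j \<le> y ! j)"
  by (auto simp: tuple_le_def list_all2_conv_all_nth)

lemma interlacingD:
  assumes "(\<Gamma>, \<Sigma>) \<in> interlacing"
  shows "length \<Gamma> = d" "length \<Sigma> = d"
    "j < d \<Longrightarrow> 1 \<le> \<Sigma> ! j" "j < d \<Longrightarrow> \<Sigma> ! j \<le> \<Gamma> ! j" "j < d \<Longrightarrow> \<Gamma> ! j \<le> int n"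
    "Suc j < d \<Longrightarrow> \<Gamma> ! j < \<Sigma> ! Suc j"
  using assms by (auto simp: interlacing_def)

lemma interlacingI:
  assumes "length \<Gamma> = d" "length \<Sigma> = d"
    "\<And>j. j < d \<Longrightarrow> 1 \<le> \<Sigma> ! j" "\<And>j. j < d \<Longrightarrow> \<Sigma> ! j \<le> \<Gamma> ! j" "\<And>j. j < d \<Longrightarrow> \<Gamma> ! j \<le> int n"
    "\<And>j. Suc j < d \<Longrightarrow> \<Gamma> ! j < \<Sigma> ! Suc j"
  shows "(\<Gamma>, \<Sigma>) \<in> interlacing"
  using assms by (auto simp: interlacing_def)

lemma E_D:
  assumes "(\<Gamma>, \<Sigma>) \<in> E"
  shows "length \<Gamma> = d" "length \<Sigma> = d" "j < d \<Longrightarrow> 1 \<le> \<Sigma> ! j" "j < d \<Longrightarrow> \<Sigma> ! j \<le> \<Gamma> ! j"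
    "j < d \<Longrightarrow> \<Gamma> ! j \<le> int n"
    "Suc j < d \<Longrightarrow> \<Gamma> ! j \<le> \<Gamma> ! Suc j" "Suc j < d \<Longrightarrow> \<Sigma> ! j \<le> \<Sigma> ! Suc j"
  using assms by (auto simp: E_iff tuples_iff tuple_le_iff)

lemma interlacing_sub_E: "interlacing \<subseteq> E"
proof (rule subrelI)
  fix \<Gamma> \<Sigma> assume "(\<Gamma>, \<Sigma>) \<in> interlacing"
  note h = interlacingD[OF this]
  have step: "\<Gamma> ! j \<le> \<Gamma> ! Suc j" "\<Sigma> ! j \<le> \<Sigma> ! Suc j" if "Suc j < d" for j
    using h(4)[of j] h(4)[of "Suc j"] h(6)[OF that] that by auto
  have bound: "1 \<le> \<Gamma> ! j" "\<Sigma> ! j \<le> int n" if "j < d" for j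
    using h(3,4,5)[OF that] by auto
  show "(\<Gamma>, \<Sigma>) \<in> E"
    unfolding E_iff tuples_iff tuple_le_iff using h step bound by auto
qed

lemma interlacing_between:
  assumes interlacing: "(\<Delta>, \<Sigma>) \<in> interlacing" and E1: "(\<Delta>, \<Gamma>) \<in> E" and E2: "(\<Gamma>, \<Sigma>) \<in> E"
  shows "(\<Delta>, \<Gamma>) \<in> interlacing \<and> (\<Gamma>, \<Sigma>) \<in> interlacing"
proof -
  have s: "\<Delta> ! j < \<Gamma> ! Suc j" "\<Gamma> ! j < \<Sigma> ! Suc j" if "Suc j < d" for j
    using interlacingD(6)[OF interlacing that] E_D(4)[OF E1, of j] E_D(4)[OF E2, of "Suc j"] that by auto
  show ?thesis
    using interlacingI[OF E_D(1-5)[OF E1] s(1)] interlacingI[OF E_D(1-5)[OF E2] s(2)] by blast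
qed

lemma interlacing_left: "(\<Gamma>, \<Sigma>) \<in> interlacing \<Longrightarrow> (\<Gamma>, \<Gamma>) \<in> interlacing"
  using interlacing_between[of \<Gamma> \<Sigma> \<Gamma>] interlacing_sub_E E_refl by (auto simp: E_iff subset_iff)

lemma interlacing_right: "(\<Gamma>, \<Sigma>) \<in> interlacing \<Longrightarrow> (\<Sigma>, \<Sigma>) \<in> interlacing"
  using interlacing_between[of \<Gamma> \<Sigma> \<Sigma>] interlacing_sub_E E_refl by (auto simp: E_iff subset_iff)

lemma boundary_not_interlacing: "\<Delta> \<in> boundary_tuples n d \<Longrightarrow> (\<Delta>, \<Delta>) \<notin> interlacing"
  using interlacingD(6) by (fastforce simp: boundary_tuples_def)

text \<open>If \<open>\<sigma>\<^bsub>i+1\<^esub> \<le> \<gamma>\<^sub>i\<close>, the tuple \<open>\<Sigma>\<close> with \<open>\<sigma>\<^sub>i\<close> replaced by \<open>\<sigma>\<^bsub>i+1\<^esub>\<close> lies in between.\<close>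
lemma boundary_between:
  assumes E: "(\<Gamma>, \<Sigma>) \<in> E" and nI: "(\<Gamma>, \<Sigma>) \<notin> interlacing"
  obtains \<Delta> where "\<Delta> \<in> boundary_tuples n d" "(\<Gamma>, \<Delta>) \<in> E" "(\<Delta>, \<Sigma>) \<in> E"
proof -
  have \<Gamma>: "length \<Gamma> = d" "\<And>j. j < d \<Longrightarrow> \<Gamma> ! j \<le> int n" "\<And>j. Suc j < d \<Longrightarrow> \<Gamma> ! j \<le> \<Gamma> ! Suc j"
    and \<Sigma>: "length \<Sigma> = d" "\<And>j. j < d \<Longrightarrow> 1 \<le> \<Sigma> ! j" "\<And>j. j < d \<Longrightarrow> \<Sigma> ! j \<le> int n"
      "\<And>j. Suc j < d \<Longrightarrow> \<Sigma> ! j \<le> \<Sigma> ! Suc j"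
    and le: "\<And>j. j < d \<Longrightarrow> \<Sigma> ! j \<le> \<Gamma> ! j"
    using E_D[OF E] by (auto intro: order_trans)
  obtain i where i: "Suc i < d" "\<Sigma> ! Suc i \<le> \<Gamma> ! i"
    using nI interlacingI[OF \<Gamma>(1) \<Sigma>(1,2) le \<Gamma>(2)] by (meson not_le)
  let ?D = "\<Sigma>[i := \<Sigma> ! Suc i]"
  have D: "?D ! j = (if j = i then \<Sigma> ! Suc i else \<Sigma> ! j)" if "j < d" for j
    using that \<Sigma>(1) by (simp add: nth_list_update)
  have "?D \<in> T"
    unfolding tuples_iff
  proof (intro conjI allI impI)
    show "length ?D = d" using \<Sigma>(1) by simp
    fix j assume j: "j < d"
    show "1 \<le> ?D ! j" "?D ! j \<le> int n" using D[OF j] \<Sigma>(2,3) j i by auto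
    assume sj: "Suc j < d"
    show "?D ! j \<le> ?D ! Suc j"
      unfolding D[OF j] D[OF sj] using \<Sigma>(4)[OF sj] \<Sigma>(4)[OF i(1)] by auto
  qed
  moreover have "\<Gamma> \<in> T" "\<Sigma> \<in> T" using E by (auto simp: E_iff)
  moreover have "tuple_le ?D \<Gamma>" "tuple_le \<Sigma> ?D"
    using D \<Gamma>(1) \<Sigma>(1) le i \<Sigma>(4)[OF i(1)] by (auto simp: tuple_le_iff)
  moreover have "?D ! i = ?D ! Suc i" using D i by simp
  ultimately show ?thesis using i by (intro that[of ?D]) (auto simp: boundary_tuples_def E_iff)
qed

abbreviation "basis \<equiv> incidence_basis K"

sublocale Inc: kalgebra K Inc
  by (rule Inc_kalgebra)

lemma basis_closed: "(x, y) \<in> E \<Longrightarrow> basis x y \<in> carrier Inc"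
  unfolding carrier_Inc incidence_basis_def by auto

lemma basis_mult:
  assumes xy: "(x, y) \<in> E" and yz: "(y', z) \<in> E"
  shows "basis x y \<otimes>\<^bsub>Inc\<^esub> basis y' z = (if y = y' then basis x z else \<zero>\<^bsub>Inc\<^esub>)"
proof (rule Inc_eqI)
  fix a b
  have yT: "y \<in> T" using xy by (simp add: E_iff)
  have "(\<Oplus>w\<in>T. basis x y (a, w) \<otimes> basis y' z (w, b)) = basis x y (a, y) \<otimes> basis y' z (y, b)"
    by (rule finsum_delta[OF finite_tuples yT]) (auto simp: incidence_basis_def)
  then show "(basis x y \<otimes>\<^bsub>Inc\<^esub> basis y' z) (a, b) = (if y = y' then basis x z else \<zero>\<^bsub>Inc\<^esub>) (a, b)"
    using basis_closed[OF xy] basis_closed[OF yz]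
    by (simp add: mult_Inc) (auto simp: incidence_basis_def zero_Inc)
qed

lemma eval_finsum:
  assumes "\<And>s. s \<in> S \<Longrightarrow> g s \<in> carrier Inc"
  shows "(\<Oplus>\<^bsub>Inc\<^esub>s\<in>S. g s) p = (\<Oplus>s\<in>S. g s p)"
  by (rule additive_finsum[of Inc K "\<lambda>\<phi>. \<phi> p"])
    (use assms Inc_closed add_Inc Inc.A.is_abelian_group is_abelian_group in auto)

lemma expand_Inc:
  assumes \<phi>: "\<phi> \<in> carrier Inc" and S: "S \<subseteq> E" and z: "\<And>p. p \<in> E - S \<Longrightarrow> \<phi> p = \<zero>"
  shows "\<phi> = (\<Oplus>\<^bsub>Inc\<^esub>p\<in>S. \<phi> p \<odot>\<^bsub>Inc\<^esub> basis (fst p) (snd p))"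
proof (rule ext)
  fix q
  have fS: "finite S" using S finite_E finite_subset by blast
  have cl: "\<phi> p \<odot>\<^bsub>Inc\<^esub> basis (fst p) (snd p) \<in> carrier Inc" if "p \<in> S" for p
  proof -
    have "(fst p, snd p) \<in> E" using that S by auto
    then show ?thesis by (intro Inc.smult_closed Inc_closed[OF \<phi>] basis_closed)
  qed
  have "(\<Oplus>\<^bsub>Inc\<^esub>p\<in>S. \<phi> p \<odot>\<^bsub>Inc\<^esub> basis (fst p) (snd p)) q =
      (\<Oplus>p\<in>S. \<phi> p \<otimes> (if q = p then \<one> else \<zero>))"
    by (subst eval_finsum[OF cl]) (simp_all add: smult_Inc incidence_basis_def)
  also have "\<dots> = \<phi> q"
  proof (cases "q \<in> S")
    case True
    show ?thesis by (subst finsum_delta[OF fS True]) (use Inc_closed[OF \<phi>] in auto)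
  next
    case False
    then have "\<phi> q = \<zero>" using z Inc_zero[OF \<phi>] by blast
    moreover have "(\<Oplus>p\<in>S. \<phi> p \<otimes> (if q = p then \<one> else \<zero>)) = \<zero>"
      by (rule add.finprod_one_eqI) (use False Inc_closed[OF \<phi>] in auto)
    ultimately show ?thesis by simp
  qed
  finally show "\<phi> q = (\<Oplus>\<^bsub>Inc\<^esub>p\<in>S. \<phi> p \<odot>\<^bsub>Inc\<^esub> basis (fst p) (snd p)) q" by simp
qed

abbreviation "J \<equiv> Idl\<^bsub>Inc\<^esub> ((\<lambda>\<Delta>. basis \<Delta> \<Delta>) ` boundary_tuples n d)"

lemma boundary_basis_closed: "(\<lambda>\<Delta>. basis \<Delta> \<Delta>) ` boundary_tuples n d \<subseteq> carrier Inc"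
  using basis_closed E_refl by (auto simp: boundary_tuples_def)

lemma ideal_J: "ideal J Inc"
  by (rule Inc.genideal_ideal[OF boundary_basis_closed])

text \<open>
  A boundary tuple between \<open>\<Sigma>\<close> and \<open>\<Gamma>\<close> factors \<open>f\<^bsub>\<Gamma>\<Sigma>\<^esub>\<close> through an idempotent in the ideal. Conversely,
  all members of an interval with interlacing ends interlace with its ends, so the functions that
  vanish on interlacing pairs form an ideal.
\<close>
lemma J_iff: "\<phi> \<in> J \<longleftrightarrow> \<phi> \<in> carrier Inc \<and> (\<forall>p\<in>interlacing. \<phi> p = \<zero>)"
proof
  let ?W = "{\<phi> \<in> carrier Inc. \<forall>p\<in>interlacing. \<phi> p = \<zero>}"
  have "ideal ?W Inc"
  proof (rule idealI[OF Inc.A.ring_axioms])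
    show "subgroup ?W (add_monoid Inc)"
    proof (rule group.subgroupI[OF abelian_group.a_group[OF Inc.A.is_abelian_group]])
      show "?W \<noteq> {}" using zero_Inc Inc.M.zero_closed by force
      fix a assume a: "a \<in> ?W"
      have "(\<ominus>\<^bsub>Inc\<^esub> a) p = \<ominus> (a p)" for p
        by (rule additive_minus[of Inc K "\<lambda>\<phi>. \<phi> p"])
          (use a Inc_closed add_Inc Inc.A.is_abelian_group is_abelian_group in auto)
      then show "inv\<^bsub>add_monoid Inc\<^esub> a \<in> ?W" using a by (simp flip: a_inv_def)
    qed (auto simp: add_Inc[unfolded fun_eq_iff])
  next
    fix a x assume a: "a \<in> ?W" and x: "x \<in> carrier Inc"
    then have aI: "a \<in> carrier Inc" by simp
    note cl = Inc_closed[OF aI] Inc_closed[OF x]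
    have "(x \<otimes>\<^bsub>Inc\<^esub> a) (u, w) = \<zero>" "(a \<otimes>\<^bsub>Inc\<^esub> x) (u, w) = \<zero>" if uw: "(u, w) \<in> interlacing" for u w
    proof -
      have "x (u, v) \<otimes> a (v, w) = \<zero>" "a (u, v) \<otimes> x (v, w) = \<zero>" for v
      proof -
        have "(u, v) \<notin> E \<or> (v, w) \<notin> E \<or> (u, v) \<in> interlacing \<and> (v, w) \<in> interlacing" using interlacing_between[OF uw] by blast
        then show "x (u, v) \<otimes> a (v, w) = \<zero>" "a (u, v) \<otimes> x (v, w) = \<zero>"
          using a cl Inc_zero[OF aI] Inc_zero[OF x] by auto
      qed
      then show "(x \<otimes>\<^bsub>Inc\<^esub> a) (u, w) = \<zero>" "(a \<otimes>\<^bsub>Inc\<^esub> x) (u, w) = \<zero>"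
        using aI x by (simp_all add: mult_Inc)
    qed
    then show "x \<otimes>\<^bsub>Inc\<^esub> a \<in> ?W" "a \<otimes>\<^bsub>Inc\<^esub> x \<in> ?W" using aI x by auto
  qed
  moreover have "(\<lambda>\<Delta>. basis \<Delta> \<Delta>) ` boundary_tuples n d \<subseteq> ?W"
    using boundary_basis_closed boundary_not_interlacing by (auto simp: incidence_basis_def)
  ultimately have "J \<subseteq> ?W" by (rule Inc.genideal_minimal)
  then show "\<phi> \<in> J \<Longrightarrow> \<phi> \<in> carrier Inc \<and> (\<forall>p\<in>interlacing. \<phi> p = \<zero>)" by blast
next
  assume \<phi>: "\<phi> \<in> carrier Inc \<and> (\<forall>p\<in>interlacing. \<phi> p = \<zero>)"
  interpret J: ideal J Inc by (rule ideal_J)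
  have "\<phi> = (\<Oplus>\<^bsub>Inc\<^esub>p\<in>E - interlacing. \<phi> p \<odot>\<^bsub>Inc\<^esub> basis (fst p) (snd p))"
    by (rule expand_Inc) (use \<phi> in auto)
  moreover have "(\<Oplus>\<^bsub>Inc\<^esub>p\<in>E - interlacing. \<phi> p \<odot>\<^bsub>Inc\<^esub> basis (fst p) (snd p)) \<in> J"
  proof (rule ideal_finsum_closed[OF ideal_J])
    fix p assume p: "p \<in> E - interlacing"
    obtain x z where xz: "p = (x, z)" by (cases p)
    obtain y where y: "y \<in> boundary_tuples n d" "(x, y) \<in> E" "(y, z) \<in> E"
      using boundary_between[of x z] p xz by blast
    have yy: "(y, y) \<in> E" using y E_refl by (auto simp: boundary_tuples_def)
    have "basis y y \<in> J" using y Inc.genideal_self[OF boundary_basis_closed] by blast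
    then have "basis x y \<otimes>\<^bsub>Inc\<^esub> basis y y \<otimes>\<^bsub>Inc\<^esub> basis y z \<in> J"
      using y basis_closed by (intro J.I_r_closed J.I_l_closed) auto
    then have "basis x z \<in> J" using y yy by (simp add: basis_mult)
    then show "\<phi> p \<odot>\<^bsub>Inc\<^esub> basis (fst p) (snd p) \<in> J"
      using Inc.J_smult[OF ideal_J, of "\<phi> p"] Inc_closed[of \<phi> p] \<phi> xz by simp
  qed
  ultimately show "\<phi> \<in> J" by simp
qed

abbreviation "\<A> \<equiv> higher_auslander_algebra K n d"

lemma A_eq: "\<A> = quotient_module Inc J"
  by (simp add: higher_auslander_algebra_def)

abbreviation "\<pi> \<equiv> Inc.proj J"

lemma \<pi>_eqI: "\<phi> \<in> carrier Inc \<Longrightarrow> \<psi> \<in> carrier Inc \<Longrightarrow> (\<And>p. p \<in> interlacing \<Longrightarrow> \<phi> p = \<psi> p) \<Longrightarrow> \<pi> \<phi> = \<pi> \<psi>"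
  and \<pi>_eqD: "\<phi> \<in> carrier Inc \<Longrightarrow> \<psi> \<in> carrier Inc \<Longrightarrow> \<pi> \<phi> = \<pi> \<psi> \<Longrightarrow> p \<in> interlacing \<Longrightarrow> \<phi> p = \<psi> p"
proof -
  assume \<phi>: "\<phi> \<in> carrier Inc" and \<psi>: "\<psi> \<in> carrier Inc"
  have "(\<phi> \<ominus>\<^bsub>Inc\<^esub> \<psi>) p = \<phi> p \<ominus> \<psi> p" for p
  proof -
    have "(\<ominus>\<^bsub>Inc\<^esub> \<psi>) p = \<ominus> (\<psi> p)"
      by (rule additive_minus[of Inc K "\<lambda>\<phi>. \<phi> p"])
        (use \<psi> Inc_closed add_Inc Inc.A.is_abelian_group is_abelian_group in auto)
    then show ?thesis by (simp add: a_minus_def add_Inc)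
  qed
  then have *: "\<pi> \<phi> = \<pi> \<psi> \<longleftrightarrow> (\<forall>p\<in>interlacing. \<phi> p \<ominus> \<psi> p = \<zero>)"
    using Inc.proj_eq_iff[OF ideal_J \<phi> \<psi>] J_iff \<phi> \<psi> by simp
  show "\<pi> \<phi> = \<pi> \<psi>" if "\<And>p. p \<in> interlacing \<Longrightarrow> \<phi> p = \<psi> p"
    using * that Inc_closed[OF \<psi>] by (simp add: r_neg a_minus_def)
  show "\<phi> p = \<psi> p" if "\<pi> \<phi> = \<pi> \<psi>" "p \<in> interlacing"
  proof -
    have "\<phi> p = (\<phi> p \<ominus> \<psi> p) \<oplus> \<psi> p"
      using Inc_closed[OF \<phi>, of p] Inc_closed[OF \<psi>, of p] by (simp add: a_minus_def a_assoc l_neg)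
    also have "\<dots> = \<psi> p" using * that Inc_closed[OF \<psi>, of p] by simp
    finally show ?thesis .
  qed
qed

text \<open>By \<open>\<pi>_eqD\<close> the value does not depend on the representative.\<close>
definition coeff :: "int list \<Rightarrow> int list \<Rightarrow> (int list \<times> int list \<Rightarrow> 'k) set \<Rightarrow> 'k" where
  "coeff \<Gamma> \<Sigma> x = (if (\<Gamma>, \<Sigma>) \<in> interlacing then (SOME \<phi>. \<phi> \<in> carrier Inc \<and> \<pi> \<phi> = x) (\<Gamma>, \<Sigma>) else \<zero>)"

lemma coeff: "\<phi> \<in> carrier Inc \<Longrightarrow> coeff \<Gamma> \<Sigma> (\<pi> \<phi>) = (if (\<Gamma>, \<Sigma>) \<in> interlacing then \<phi> (\<Gamma>, \<Sigma>) else \<zero>)"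
proof -
  assume \<phi>: "\<phi> \<in> carrier Inc"
  then have "(SOME \<psi>. \<psi> \<in> carrier Inc \<and> \<pi> \<psi> = \<pi> \<phi>) \<in> carrier Inc \<and> \<pi> (SOME \<psi>. \<psi> \<in> carrier Inc \<and> \<pi> \<psi> = \<pi> \<phi>) = \<pi> \<phi>"
    by (intro someI[of "\<lambda>\<psi>. \<psi> \<in> carrier Inc \<and> \<pi> \<psi> = \<pi> \<phi>"]) auto
  then show ?thesis using \<pi>_eqD[OF _ \<phi>] by (simp add: coeff_def)
qed

definition pack :: "nat \<Rightarrow> int list \<Rightarrow> int list" where
  "pack i \<Sigma> = map (\<lambda>j. int j + 1) [0..<i] @ drop i \<Sigma>"

lemma pack_nth: "i \<le> d \<Longrightarrow> length \<Sigma> = d \<Longrightarrow> j < d \<Longrightarrow> pack i \<Sigma> ! j = (if j < i then int j + 1 else \<Sigma> ! j)"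
  by (auto simp: pack_def nth_append)

lemma pack_length: "i \<le> d \<Longrightarrow> length \<Sigma> = d \<Longrightarrow> length (pack i \<Sigma>) = d"
  by (simp add: pack_def)

lemma interlacing_lower:
  assumes "(\<Gamma>, \<Sigma>) \<in> interlacing" "j < d"
  shows "int j + 1 \<le> \<Sigma> ! j"
  using assms(2)
proof (induction j)
  case 0 then show ?case using assms(1) by (auto simp: interlacing_def)
next
  case (Suc j)
  then have "int j + 1 \<le> \<Sigma> ! j" "\<Sigma> ! j \<le> \<Gamma> ! j" "\<Gamma> ! j < \<Sigma> ! Suc j"
    using assms(1) by (auto simp: interlacing_def)
  then show ?case by simp
qed

text \<open>
  The first \<open>i\<close> entries of the two images agree, and entry \<open>i + 1\<close> of the smaller one may be lowered
  to its least possible value \<open>i + 1\<close>. That \<open>d \<le> n\<close> keeps the new entries in range.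
\<close>
lemma interlacing_pack:
  assumes interlacing: "(\<Gamma>, \<Sigma>) \<in> interlacing" and ij: "i \<le> j" "j \<le> Suc i" "j \<le> d" and dn: "d \<le> n"
  shows "(pack i \<Gamma>, pack j \<Sigma>) \<in> interlacing"
proof -
  have len: "length \<Gamma> = d" "length \<Sigma> = d" using interlacing by (auto simp: interlacing_def)
  have h: "1 \<le> \<Sigma> ! l" "\<Sigma> ! l \<le> \<Gamma> ! l" "\<Gamma> ! l \<le> int n" "Suc l < d \<Longrightarrow> \<Gamma> ! l < \<Sigma> ! Suc l" "int l + 1 \<le> \<Sigma> ! l"
    if "l < d" for l
    using interlacing that interlacing_lower[OF interlacing that] by (auto simp: interlacing_def)
  have i: "i \<le> d" using ij by simp
  show ?thesis
    unfolding interlacing_def mem_Collect_eq prod.case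
  proof (intro conjI allI impI)
    show "length (pack i \<Gamma>) = d" "length (pack j \<Sigma>) = d" using len i ij by (auto simp: pack_length)
    fix l assume l: "l < d"
    note n = pack_nth[OF i len(1) l] pack_nth[OF ij(3) len(2) l]
    show "1 \<le> pack j \<Sigma> ! l" "pack j \<Sigma> ! l \<le> pack i \<Gamma> ! l" "pack i \<Gamma> ! l \<le> int n"
      unfolding n using h[OF l] l ij dn by auto
    assume sl: "Suc l < d"
    show "pack i \<Gamma> ! l < pack j \<Sigma> ! Suc l"
      unfolding n pack_nth[OF ij(3) len(2) sl] using h[OF l] h[OF sl] ij sl by auto
  qed
qed

lemma higher_auslander_kalgebra: "kalgebra K \<A>"
  unfolding A_eq by (rule Inc.kalgebra_quotient[OF ideal_J])

lemma higher_auslander_interval_algebra: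
  assumes dn: "d \<le> n"
  shows "interval_algebra K \<A> {\<Sigma>. (\<Sigma>, \<Sigma>) \<in> interlacing} interlacing (\<lambda>\<Gamma> \<Sigma>. \<pi> (basis \<Gamma> \<Sigma>)) coeff pack d"
  unfolding A_eq
proof (rule interval_algebra.intro[OF higher_auslander_kalgebra[unfolded A_eq] interval_algebra_axioms.intro])
  let ?A = "quotient_module Inc J"
  note carr = Inc.carrier_Q[OF ideal_J]
  have bI: "basis x y \<in> carrier Inc" if "(x, y) \<in> interlacing" for x y using that interlacing_sub_E basis_closed by blast
  have "{\<Sigma>. (\<Sigma>, \<Sigma>) \<in> interlacing} \<subseteq> T" using interlacing_sub_E by (auto simp: incidence_pairs_def)
  then show "finite {\<Sigma>. (\<Sigma>, \<Sigma>) \<in> interlacing}" using finite_tuples finite_subset by blast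
  show "interlacing \<subseteq> {\<Sigma>. (\<Sigma>, \<Sigma>) \<in> interlacing} \<times> {\<Sigma>. (\<Sigma>, \<Sigma>) \<in> interlacing}" using interlacing_left interlacing_right by auto
  show "(v, v) \<in> interlacing" if "v \<in> {\<Sigma>. (\<Sigma>, \<Sigma>) \<in> interlacing}" for v using that by simp
  show "\<pi> (basis a b) \<in> carrier ?A" if "(a, b) \<in> interlacing" for a b using bI[OF that] by (simp add: carr)
  show "\<pi> (basis a b) \<otimes>\<^bsub>?A\<^esub> \<pi> (basis b' c) = (if b = b' \<and> (a, c) \<in> interlacing then \<pi> (basis a c) else \<zero>\<^bsub>?A\<^esub>)"
    if ab: "(a, b) \<in> interlacing" and bc: "(b', c) \<in> interlacing" for a b b' c
  proof -
    have "\<pi> (basis a c) = \<pi> \<zero>\<^bsub>Inc\<^esub>" if "b = b'" "(a, c) \<notin> interlacing"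
    proof (rule \<pi>_eqI)
      have "(a, c) \<in> E" using E_trans[of a b c] ab bc that interlacing_sub_E by blast
      then show "basis a c \<in> carrier Inc" by (rule basis_closed)
      show "\<zero>\<^bsub>Inc\<^esub> \<in> carrier Inc" by simp
    qed (use that in \<open>auto simp: incidence_basis_def zero_Inc\<close>)
    then show ?thesis
      using ab bc interlacing_sub_E by (auto simp: Inc.proj_mult[OF ideal_J] bI basis_mult Inc.proj_zero[OF ideal_J] subset_iff)
  qed
  show "coeff a b x \<in> carrier K" if "x \<in> carrier ?A" for a b x
    using that Inc_closed by (auto simp: carr coeff)
  show "coeff a b (x \<oplus>\<^bsub>?A\<^esub> y) = coeff a b x \<oplus> coeff a b y" if "x \<in> carrier ?A" "y \<in> carrier ?A" for a b x y
    using that by (auto simp: carr Inc.proj_add[OF ideal_J] coeff) (simp add: add_Inc)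
  show "coeff a b (k \<odot>\<^bsub>?A\<^esub> x) = k \<otimes> coeff a b x" if "k \<in> carrier K" "x \<in> carrier ?A" for k a b x
    using that by (auto simp: carr Inc.proj_smult[OF ideal_J] coeff) (simp add: smult_Inc)
  show "coeff a b (\<pi> (basis p q)) = (if a = p \<and> b = q then \<one> else \<zero>)"
    if "(a, b) \<in> interlacing" "(p, q) \<in> interlacing" for a b p q
    using that by (auto simp: coeff bI) (auto simp: incidence_basis_def)
  show "x = (\<Oplus>\<^bsub>?A\<^esub>p\<in>interlacing. case p of (a, b) \<Rightarrow> coeff a b x \<odot>\<^bsub>?A\<^esub> \<pi> (basis a b))" if x: "x \<in> carrier ?A" for x
  proof -
    obtain \<phi> where \<phi>: "\<phi> \<in> carrier Inc" "x = \<pi> \<phi>" using x by (auto simp: carr)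
    define \<phi>' where "\<phi>' p = (if p \<in> interlacing then \<phi> p else \<zero>)" for p
    have \<phi>': "\<phi>' \<in> carrier Inc"
      unfolding carrier_Inc using interlacing_sub_E Inc_closed[OF \<phi>(1)] by (auto simp: \<phi>'_def)
    have cl: "\<phi>' p \<odot>\<^bsub>Inc\<^esub> basis (fst p) (snd p) \<in> carrier Inc" if "p \<in> interlacing" for p
      using that bI[of "fst p" "snd p"] Inc_closed[OF \<phi>'] by auto
    interpret Q: kalgebra K ?A by (rule Inc.kalgebra_quotient[OF ideal_J])
    have "x = \<pi> \<phi>'" unfolding \<phi>(2) by (rule \<pi>_eqI) (use \<phi> \<phi>' in \<open>auto simp: \<phi>'_def\<close>)
    also have "\<phi>' = (\<Oplus>\<^bsub>Inc\<^esub>p\<in>interlacing. \<phi>' p \<odot>\<^bsub>Inc\<^esub> basis (fst p) (snd p))"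
      by (rule expand_Inc[OF \<phi>' interlacing_sub_E]) (simp add: \<phi>'_def)
    also have "\<pi> \<dots> = (\<Oplus>\<^bsub>?A\<^esub>p\<in>interlacing. \<pi> (\<phi>' p \<odot>\<^bsub>Inc\<^esub> basis (fst p) (snd p)))"
      by (rule linear_map_finsum[OF Inc.proj_linear[OF ideal_J] Inc.A.is_abelian_group Q.A.is_abelian_group])
        (use cl in auto)
    also have "\<dots> = (\<Oplus>\<^bsub>?A\<^esub>p\<in>interlacing. case p of (a, b) \<Rightarrow> coeff a b x \<odot>\<^bsub>?A\<^esub> \<pi> (basis a b))"
    proof (rule Q.M.finsum_cong')
      fix p assume p: "p \<in> interlacing"
      then show "\<pi> (\<phi>' p \<odot>\<^bsub>Inc\<^esub> basis (fst p) (snd p)) =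
          (case p of (a, b) \<Rightarrow> coeff a b x \<odot>\<^bsub>?A\<^esub> \<pi> (basis a b))"
        using Inc.proj_smult[OF ideal_J, of "\<phi>' p"] Inc_closed[OF \<phi>', of p] bI[of "fst p" "snd p"]
        by (auto simp: \<phi>(2) coeff[OF \<phi>(1)] \<phi>'_def split: prod.split)
    next
      have "(case p of (a, b) \<Rightarrow> coeff a b x \<odot>\<^bsub>?A\<^esub> \<pi> (basis a b)) \<in> carrier ?A" if "p \<in> interlacing" for p
      proof (cases p)
        case (Pair a b)
        then have "basis a b \<in> carrier Inc" "\<phi> (a, b) \<in> carrier K"
          using that bI Inc_closed[OF \<phi>(1)] by auto
        then show ?thesis using that Pair
          by (auto simp: \<phi>(2) coeff[OF \<phi>(1)] Inc.proj_smult[OF ideal_J] carr)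
      qed
      then show "(\<lambda>p. case p of (a, b) \<Rightarrow> coeff a b x \<odot>\<^bsub>?A\<^esub> \<pi> (basis a b)) \<in> interlacing \<rightarrow> carrier ?A" by blast
    qed simp
    finally show ?thesis .
  qed
  show "pack i v \<in> {\<Sigma>. (\<Sigma>, \<Sigma>) \<in> interlacing}" if "v \<in> {\<Sigma>. (\<Sigma>, \<Sigma>) \<in> interlacing}" "i \<le> d" for i v
    using that interlacing_pack[of v v i i] dn by simp
  show "pack 0 v = v" for v by (simp add: pack_def)
  show "pack d v = pack d w" if "v \<in> {\<Sigma>. (\<Sigma>, \<Sigma>) \<in> interlacing}" "w \<in> {\<Sigma>. (\<Sigma>, \<Sigma>) \<in> interlacing}" for v w
    using that by (simp add: pack_def interlacing_def)
  show "(pack i a, pack j b) \<in> interlacing" if "(a, b) \<in> interlacing" "i \<le> j" "j \<le> Suc i" "j \<le> d" for a b i j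
    by (rule interlacing_pack[OF that dn])
qed

end

theorem mainTheorem2:
  fixes K :: "('k, 'r) ring_scheme" and n d :: nat
  assumes "field K" and "1 \<le> d" and "d \<le> n"
  shows "rigid K (higher_auslander_algebra K n d) \<and>
    intrinsically_formal TYPE('b) K
      (concentrated_in_degree_0 (higher_auslander_algebra K n d))"
proof
  interpret incidence K n d by (rule incidence.intro) (rule assms(1))
  interpret kalgebra K \<A> by (rule higher_auslander_kalgebra)
  show "rigid K \<A>"
    by (rule rigid_if_cocycles_cobound)
      (rule interval_algebra.cocycle_coboundary[OF higher_auslander_interval_algebra[OF assms(3)]])
  show "intrinsically_formal TYPE('b) K (concentrated_in_degree_0 \<A>)"
    by (rule intrinsically_formal_concentrated[OF assms(1)])
qed

end
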